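(* Let $\{a_k\}_{k\in\mathbb{Z}}$ be a probability distribution on $\mathbb{Z}$ with mean $0$, positive variance $\eta^2$ and finite $r$-th absolute moment for some $r>4$. Let $\{p_k\}_{k\ge 0}$ be a probability distribution on $\{0,1,2,\dots\}$ with mean $1$, positive (finite) variance $\sigma^2$ and finite third moment. Consider the branching random walk on $\mathbb{Z}$ with step distribution $\{a_k\}$ and offspring distribution $\{p_k\}$ started from a single particle at $0$, and let $M_n$ be the location of the rightmost particle in generation $n$. Then the conditional distribution of $M_n/\sqrt n$, given that the branching process survives for $n$ generations (i.e. given $N_n\ge1$), converges weakly as $n\to\infty$ to a nontrivial (not a point mass) probability distribution $G$ on $\mathbb{R}$ that depends only on $\sigma^2$ and $\eta^2$.
   Context: Branching random walk: at time $0$ there is one particle, at the origin. In each generation every particle first jumps, its displacement having law $\{a_k\}_{k\in\mathbb{Z}}$, and then at its new location is replaced by a random number of offspring with law $\{p_k\}_{k\ge0}$, all placed at that location; all jumps and offspring numbers are independent. $N_n$ is the number of particles in generation $n$ (after the reproduction step), $X_{n,1},\dots,X_{n,N_n}$ are their locations, and $M_n=\max_{1\le i\le N_n}X_{n,i}$ (with $M_n=-\infty$ if $N_n=0$). "Depends only on $\sigma^2$ and $\eta^2$" means that any two pairs of step/offspring distributions satisfying the hypotheses with the same $\sigma^2$ and $\eta^2$ give the same limit $G$. *)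

theory Defs
  imports "HOL-Probability.Probability"
begin

(* One generation of the branching random walk, as a transition kernel on finite
   populations listed by location (with repetition): each particle independently
   draws a displacement d from a, and is then replaced by a number k of offspring
   drawn from p, all of them placed at its new location x + d. *)
primrec brw_step :: "int pmf \<Rightarrow> nat pmf \<Rightarrow> int list \<Rightarrow> int list pmf" where
  "brw_step a p [] = return_pmf []"
| "brw_step a p (x # xs) =
     bind_pmf a (\<lambda>d. bind_pmf p (\<lambda>k. bind_pmf (brw_step a p xs) (\<lambda>ys.
       return_pmf (replicate k (x + d) @ ys))))"

(* The joint law of the list [X_{n,1}, ..., X_{n,N_n}]; N_n is its length. *)
primrec brw :: "int pmf \<Rightarrow> nat pmf \<Rightarrow> nat \<Rightarrow> int list pmf" where
  "brw a p 0 = return_pmf [0]"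
| "brw a p (Suc n) = bind_pmf (brw a p n) (brw_step a p)"

(* Meaningful for nonempty populations only; the convention that the maximum is
   minus infinity on extinction plays no role below, where the law is conditioned
   on survival. *)
definition rightmost :: "int list \<Rightarrow> int" where
  "rightmost xs = Max (set xs)"

(* cond_pmf is unspecified when the conditioning event has probability 0; see
   brw_survival_possible. *)
definition brw_surviving :: "int pmf \<Rightarrow> nat pmf \<Rightarrow> nat \<Rightarrow> int list pmf" where
  "brw_surviving a p n = cond_pmf (brw a p n) {xs. length xs \<ge> 1}"

definition cond_scaled_max_law :: "int pmf \<Rightarrow> nat pmf \<Rightarrow> nat \<Rightarrow> real measure" where
  "cond_scaled_max_law a p n =
     distr (measure_pmf (brw_surviving a p n)) borel
       (\<lambda>xs. real_of_int (rightmost xs) / sqrt (real n))"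

(* The moment conditions also guarantee that the means and variances, which are
   Bochner integrals, are those of integrable functions. *)
definition step_hyp :: "int pmf \<Rightarrow> bool" where
  "step_hyp a \<longleftrightarrow>
     (\<exists>r>4. integrable (measure_pmf a) (\<lambda>k. \<bar>real_of_int k\<bar> powr r)) \<and>
     measure_pmf.expectation a real_of_int = 0 \<and>
     measure_pmf.variance a real_of_int > 0"

definition offspring_hyp :: "nat pmf \<Rightarrow> bool" where
  "offspring_hyp p \<longleftrightarrow>
     integrable (measure_pmf p) (\<lambda>k. real k ^ 3) \<and>
     measure_pmf.expectation p real = 1 \<and>
     measure_pmf.variance p real > 0"

lemma brw_survival_possible:
  assumes "measure_pmf.expectation p real = 1"
  shows "set_pmf (brw a p n) \<inter> {xs. length xs \<ge> 1} \<noteq> {}"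
proof -
  have "\<exists>k\<in>set_pmf p. k > 0"
  proof (rule ccontr)
    assume "\<not> ?thesis"
    then have "AE k in measure_pmf p. real k = 0"
      by (auto simp: AE_measure_pmf_iff)
    then have "measure_pmf.expectation p real = 0"
      by (rule integral_eq_zero_AE)
    with assms show False by simp
  qed
  then obtain k where k: "k \<in> set_pmf p" "k > 0" by blast
  have step: "\<exists>ys\<in>set_pmf (brw_step a p (x # xs)). ys \<noteq> []" for x xs
  proof -
    obtain d where "d \<in> set_pmf a" using set_pmf_not_empty[of a] by blast
    moreover obtain ys where "ys \<in> set_pmf (brw_step a p xs)"
      using set_pmf_not_empty[of "brw_step a p xs"] by blast
    ultimately have "replicate k (x + d) @ ys \<in> set_pmf (brw_step a p (x # xs))"
      using k by auto
    then show ?thesis using k by (intro bexI[of _ "replicate k (x + d) @ ys"]) auto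
  qed
  have "\<exists>xs\<in>set_pmf (brw a p n). xs \<noteq> []"
  proof (induction n)
    case (Suc n)
    then obtain x xs where "x # xs \<in> set_pmf (brw a p n)"
      by (metis neq_Nil_conv)
    with step[of x xs] show ?case
      unfolding brw.simps set_bind_pmf by blast
  qed simp
  then show ?thesis by (auto simp: Suc_le_eq)
qed

end

theory Submission
  imports Defs "HOL-Real_Asymp.Real_Asymp"
begin

text \<open>
  Let \<open>Q s = 1 - E (1 - s)\<^sup>k\<close>. By the branching property the probability that some particle of
  generation \<open>n\<close> is at or beyond \<open>x\<close> is \<open>(T\<^sup>n 1\<^bsub>[0,\<infinity>)\<^esub>) (- x)\<close> for the monotone sup-norm
  contraction \<open>(T g) x = E Q (g (x + \<xi>))\<close>. On functions \<open>g (x / \<surd>N) / N\<close> with smooth \<open>g\<close>, one step of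
  \<open>T\<close> agrees up to \<open>O(N\<^bsup>-5/2\<^esup>)\<close> with a step of size \<open>1/N\<close> of the equation
  \<open>u' = \<eta>\<^sup>2/2 u\<^sub>x\<^sub>x - \<sigma>\<^sup>2/2 u\<^sup>2\<close>, so by contractivity \<open>N\<close> steps depend asymptotically only on
  \<open>\<sigma>\<^sup>2\<close> and \<open>\<eta>\<^sup>2\<close>. Existence of solutions of the equation is avoided by comparing with an explicit
  finite-difference scheme at a common refinement of two scales.

  The singular initial condition is handled by spending the first \<open>\<epsilon>n\<close> steps separately: Kolmogorov's
  estimate \<open>n P(N\<^sub>n > 0) \<longrightarrow> 2/\<sigma>\<^sup>2\<close> and the tail bound \<open>P(M\<^sub>m \<ge> z) \<le> K m / z\<^sup>4\<close> squeeze the result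
  between two translates of one smooth function, up to an error \<open>O(\<epsilon>)\<close>. This yields a comparison of
  the distribution functions of any two admissible laws up to a small shift. Together with tightness
  it gives convergence to a common limit, which charges every interval \<open>[x,\<infinity>)\<close> since
  \<open>n P(M\<^sub>n \<ge> x \<surd>n)\<close> is bounded below by a multiple of the corresponding random-walk probability.
\<close>

text \<open>The indicator multiplied by the population scale N is not a bounded initial function,
  and a first-moment estimate does not repair this. The fourth moment of the random walk alone gives
  P(M_k >= z) <= C k^2 / z^4; with k about \<epsilon> N and z = \<delta> sqrt N, multiplication by N
  leaves a term of order \<epsilon>^2 N / \<delta>^4, which diverges. The bound that is linear in k
  leaves \<epsilon> / \<delta>^4 instead. The missing factor 1/k is the price of survival, and
  \<open>brw_tail\<close> gains it by splitting the time in halves. After these k generations the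
  rescaled function is close to c times an indicator, where c is the limit of N times the
  probability of surviving k generations. By Kolmogorov's estimate c depends only on \<sigma>^2 and
  \<epsilon>, so two different laws can be started from the same smooth function, and only then does
  the comparison through the equation apply.\<close>

lemma integrable_pmf_bounded:
  fixes f :: "'a \<Rightarrow> real"
  assumes "\<And>x. \<bar>f x\<bar> \<le> B"
  shows "integrable (measure_pmf M) f"
  by (rule measure_pmf.integrable_const_bound[where B=B]) (use assms in auto)

lemma expectation_bind_pmf:
  fixes f :: "'b \<Rightarrow> real"
  assumes "\<And>x. \<bar>f x\<bar> \<le> B"
  shows "measure_pmf.expectation (bind_pmf M K) f =
    measure_pmf.expectation M (\<lambda>x. measure_pmf.expectation (K x) f)"
  unfolding measure_pmf_bind
  by (rule integral_bind[where K="count_space UNIV" and B'=1 and B=B])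
     (use assms in \<open>auto simp: measure_pmf.emeasure_space_1 measure_pmf_in_subprob_algebra
       intro!: measure_pmf.finite_measure_axioms\<close>)

section \<open>The offspring generating function\<close>

text \<open>The complement of the generating function, s -> 1 - f(1 - s): the probability that some
  child is marked when children are marked independently with probability s. In this form extinction
  is the fixed point 0 and the expansion there starts with s - v/2 s^2.\<close>

definition gen_compl :: "nat pmf \<Rightarrow> real \<Rightarrow> real" where
  "gen_compl p s = measure_pmf.expectation p (\<lambda>k. 1 - (1 - s) ^ k)"

text \<open>Truncated binomial expansions, each preserved by multiplication with 1 - s. The
  quadratic coefficient must stay exact, because its expectation becomes v/2; the cubic one is
  coarsened to \<open>real k ^ 3\<close> so that only the third moment is left.\<close>

lemma power_one_minus_bounds:
  fixes s :: real
  assumes "0 \<le> s" "s \<le> 1"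
  shows "(1 - s) ^ k \<le> 1 - real k * s + real k * (real k - 1) / 2 * s\<^sup>2" (is ?A)
    and "(1 - s) ^ k \<ge> 1 - real k * s + real k * (real k - 1) / 2 * s\<^sup>2 - real k ^ 3 * s ^ 3" (is ?B)
proof -
  have "1 - real k * s + real k * (real k - 1) / 2 * s\<^sup>2
      - real k * (real k - 1) * (real k - 2) / 6 * s ^ 3 \<le> (1 - s) ^ k
    \<and> (1 - s) ^ k \<le> 1 - real k * s + real k * (real k - 1) / 2 * s\<^sup>2"
  proof (induction k)
    case (Suc k)
    let ?x = "real k"
    let ?u = "1 - ?x * s + ?x * (?x - 1) / 2 * s\<^sup>2"
    let ?l = "?u - ?x * (?x - 1) * (?x - 2) / 6 * s ^ 3"
    have x: "?x * (?x - 1) \<ge> 0" by (cases k) auto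
    have y: "?x * (?x - 1) * (?x - 2) \<ge> 0"
    proof (cases "k \<ge> 2")
      case False
      then have "k = 0 \<or> k = 1" by auto
      then show ?thesis by auto
    qed auto
    have "(1 - s) * (1 - s) ^ k \<le> (1 - s) * ?u"
      using Suc assms by (intro mult_left_mono) auto
    also have "\<dots> = 1 - (?x + 1) * s + (?x + 1) * ?x / 2 * s\<^sup>2 - ?x * (?x - 1) / 2 * s ^ 3"
      by (simp add: field_simps power2_eq_square power3_eq_cube)
    also have "\<dots> \<le> 1 - (?x + 1) * s + (?x + 1) * ?x / 2 * s\<^sup>2"
      using x assms by simp
    finally have 1: "(1 - s) ^ Suc k \<le> 1 - (?x + 1) * s + (?x + 1) * ?x / 2 * s\<^sup>2" by simp
    have "1 - (?x + 1) * s + (?x + 1) * ?x / 2 * s\<^sup>2 - (?x + 1) * ?x * (?x - 1) / 6 * s ^ 3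
      \<le> 1 - (?x + 1) * s + (?x + 1) * ?x / 2 * s\<^sup>2 - (?x + 1) * ?x * (?x - 1) / 6 * s ^ 3
        + ?x * (?x - 1) * (?x - 2) / 6 * s ^ 4"
      using y assms by simp
    also have "\<dots> = (1 - s) * ?l"
      by (simp add: field_simps power2_eq_square power3_eq_cube power4_eq_xxxx)
    also have "\<dots> \<le> (1 - s) * (1 - s) ^ k"
      using Suc assms by (intro mult_left_mono) auto
    finally have 2: "1 - (?x + 1) * s + (?x + 1) * ?x / 2 * s\<^sup>2 - (?x + 1) * ?x * (?x - 1) / 6 * s ^ 3
      \<le> (1 - s) ^ Suc k" by simp
    show ?case using 1 2 by (simp add: algebra_simps)
  qed auto
  moreover have "real k * (real k - 1) * (real k - 2) / 6 * s ^ 3 \<le> real k ^ 3 * s ^ 3"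
  proof (intro mult_right_mono)
    have "real k * (real k - 1) * (real k - 2) / 6 = real k * ((real k)\<^sup>2 - 3 * real k + 2) / 6"
      by (simp add: field_simps power2_eq_square)
    also have "\<dots> \<le> real k * (6 * (real k)\<^sup>2) / 6"
    proof (cases "k = 0")
      case False
      then have "real k \<ge> 1" by simp
      then have "2 \<le> 3 * real k" by simp
      then have "(real k)\<^sup>2 - 3 * real k + 2 \<le> 6 * (real k)\<^sup>2"
        using zero_le_power2[of "real k"] by linarith
      then show ?thesis by (intro divide_right_mono mult_left_mono) auto
    qed auto
    also have "\<dots> = real k ^ 3" by (simp add: power2_eq_square power3_eq_cube)
    finally show "real k * (real k - 1) * (real k - 2) / 6 \<le> real k ^ 3" .
  qed (use assms in auto)
  ultimately show ?A ?B by linarith+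
qed

lemma power_one_minus_ge2:
  fixes s :: real
  assumes "0 \<le> s" "s \<le> 1" "k \<ge> 2"
  shows "(1 - s) ^ k \<ge> 1 - real k * s + s\<^sup>2"
  using assms(3)
proof (induction k rule: dec_induct)
  case (step k)
  have "s ^ 3 \<le> s\<^sup>2" using assms by (intro power_decreasing) auto
  also have "\<dots> \<le> real k * s\<^sup>2" using step mult_right_mono[of 1 "real k" "s\<^sup>2"] by simp
  finally have "1 - real (Suc k) * s + s\<^sup>2 \<le> (1 - s) * (1 - real k * s + s\<^sup>2)"
    by (simp add: field_simps power2_eq_square power3_eq_cube)
  also have "\<dots> \<le> (1 - s) * (1 - s) ^ k"
    using step assms by (intro mult_left_mono) auto
  finally show ?case by simp
qed (simp add: power2_eq_square algebra_simps)

locale critical_offspring =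
  fixes p :: "nat pmf" and v :: real
  assumes third_moment: "integrable (measure_pmf p) (\<lambda>k. real k ^ 3)"
    and mean_one: "measure_pmf.expectation p real = 1"
    and variance_eq: "measure_pmf.variance p real = v"
    and v_pos: "v > 0"
begin

lemma integrable_id: "integrable (measure_pmf p) real"
  and integrable_sq: "integrable (measure_pmf p) (\<lambda>k. (real k)\<^sup>2)"
proof -
  have 1: "k \<le> k ^ 3" for k :: nat
    by (cases "k = 0") (auto intro!: self_le_power)
  have 2: "(real k)\<^sup>2 \<le> real k ^ 3" for k :: nat
    by (cases "k = 0") (auto intro!: power_increasing)
  show "integrable (measure_pmf p) real"
    by (rule Bochner_Integration.integrable_bound[OF third_moment]) (auto simp: 1)
  show "integrable (measure_pmf p) (\<lambda>k. (real k)\<^sup>2)"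
    by (rule Bochner_Integration.integrable_bound[OF third_moment]) (auto simp: 2)
qed

text \<open>Mean one cancels against the square of the mean, so the quadratic coefficient in the
  expansion of \<open>gen_compl\<close> is governed by the variance itself.\<close>

lemma second_factorial_moment:
  "measure_pmf.expectation p (\<lambda>k. real k * (real k - 1)) = v"
proof -
  have "v = measure_pmf.expectation p (\<lambda>k. (real k)\<^sup>2) - 1"
    using measure_pmf.variance_eq[OF integrable_id integrable_sq] mean_one variance_eq by simp
  moreover have "measure_pmf.expectation p (\<lambda>k. real k * (real k - 1))
     = measure_pmf.expectation p (\<lambda>k. (real k)\<^sup>2 - real k)"
    by (simp add: algebra_simps power2_eq_square)
  ultimately show ?thesis
    using integrable_id integrable_sq mean_one by (simp add: Bochner_Integration.integral_diff)
qed

lemma quadratic_moment: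
  "integrable (measure_pmf p) (\<lambda>k. real k * s - real k * (real k - 1) * (s\<^sup>2 / 2))" (is ?I)
  "measure_pmf.expectation p (\<lambda>k. real k * s - real k * (real k - 1) * (s\<^sup>2 / 2)) = s - v / 2 * s\<^sup>2" (is ?E)
proof -
  have i: "integrable (measure_pmf p) (\<lambda>k. real k * (real k - 1))"
    using Bochner_Integration.integrable_diff[OF integrable_sq integrable_id]
    by (simp add: algebra_simps power2_eq_square)
  show ?I
    by (intro Bochner_Integration.integrable_diff integrable_mult_left i integrable_id)
  show ?E
    by (subst Bochner_Integration.integral_diff)
       (auto intro!: integrable_mult_left i integrable_id simp: second_factorial_moment mean_one
         simp del: integrable_mult_left_iff)
qed

definition m3 :: real where "m3 = measure_pmf.expectation p (\<lambda>k. real k ^ 3)"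

lemma m3_nonneg: "m3 \<ge> 0"
  unfolding m3_def by (rule integral_nonneg_AE) auto

lemma integrable_gen:
  fixes s :: real
  assumes "0 \<le> s" "s \<le> 1"
  shows "integrable (measure_pmf p) (\<lambda>k. 1 - (1 - s) ^ k)"
proof (rule integrable_pmf_bounded[where B=1])
  fix k
  have "0 \<le> (1 - s) ^ k" "(1 - s) ^ k \<le> 1" using assms by (auto intro: power_le_one)
  then show "\<bar>1 - (1 - s) ^ k\<bar> \<le> 1" by linarith
qed

lemma gen_ge:
  assumes "0 \<le> s" "s \<le> 1"
  shows "gen_compl p s \<ge> s - v / 2 * s\<^sup>2"
proof -
  have "s - v / 2 * s\<^sup>2 = measure_pmf.expectation p (\<lambda>k. real k * s - real k * (real k - 1) * (s\<^sup>2 / 2))"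
    by (rule quadratic_moment(2)[symmetric])
  also have "\<dots> \<le> gen_compl p s"
    unfolding gen_compl_def
  proof (rule integral_mono)
    show "integrable (measure_pmf p) (\<lambda>k. real k * s - real k * (real k - 1) * (s\<^sup>2 / 2))"
      by (rule quadratic_moment(1))
  qed (use integrable_gen[OF assms] power_one_minus_bounds(1)[OF assms] in \<open>auto simp: algebra_simps\<close>)
  finally show ?thesis .
qed

lemma gen_le:
  assumes "0 \<le> s" "s \<le> 1"
  shows "gen_compl p s \<le> s - v / 2 * s\<^sup>2 + m3 * s ^ 3"
proof -
  have i: "integrable (measure_pmf p) (\<lambda>k. real k * s - real k * (real k - 1) * (s\<^sup>2 / 2))"
    by (rule quadratic_moment(1))
  have "gen_compl p s \<le> measure_pmf.expectation p
      (\<lambda>k. (real k * s - real k * (real k - 1) * (s\<^sup>2 / 2)) + real k ^ 3 * s ^ 3)"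
    unfolding gen_compl_def
  proof (rule integral_mono)
    show "integrable (measure_pmf p) (\<lambda>k. (real k * s - real k * (real k - 1) * (s\<^sup>2 / 2)) + real k ^ 3 * s ^ 3)"
      using i third_moment by auto
  qed (use integrable_gen[OF assms] power_one_minus_bounds(2)[OF assms] in \<open>auto simp: algebra_simps\<close>)
  also have "\<dots> = measure_pmf.expectation p (\<lambda>k. real k * s - real k * (real k - 1) * (s\<^sup>2 / 2)) + m3 * s ^ 3"
    using i third_moment by (subst Bochner_Integration.integral_add) (auto simp: m3_def)
  also note quadratic_moment(2)
  finally show ?thesis .
qed

lemma gen_mono:
  assumes "0 \<le> s" "s \<le> t" "t \<le> 1"
  shows "gen_compl p s \<le> gen_compl p t"
  unfolding gen_compl_def using assms
  by (intro integral_mono integrable_gen) (auto intro!: power_mono)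

text \<open>The slope of the k-th summand is at most k, so the Lipschitz constant is the mean number
  of children. Criticality makes it 1, which is why errors are not amplified over many
  generations.\<close>

lemma gen_lipschitz:
  assumes "0 \<le> s" "s \<le> t" "t \<le> 1"
  shows "gen_compl p t - gen_compl p s \<le> t - s"
proof -
  have k: "(1 - s) ^ k - (1 - t) ^ k \<le> real k * (t - s)" for k
  proof (induction k)
    case (Suc k)
    have "(1 - s) ^ Suc k - (1 - t) ^ Suc k = (1 - s) * ((1 - s) ^ k - (1 - t) ^ k) + (t - s) * (1 - t) ^ k"
      by (simp add: algebra_simps)
    also have "\<dots> \<le> 1 * (real k * (t - s)) + (t - s) * 1"
      using Suc assms by (intro add_mono mult_mono mult_left_mono)
        (auto intro!: power_le_one power_mono)
    finally show ?case by (simp add: algebra_simps)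
  qed simp
  have "gen_compl p t - gen_compl p s = measure_pmf.expectation p (\<lambda>k. (1 - (1 - t) ^ k) - (1 - (1 - s) ^ k))"
    unfolding gen_compl_def using assms
    by (subst Bochner_Integration.integral_diff) (auto intro!: integrable_gen)
  also have "\<dots> \<le> measure_pmf.expectation p (\<lambda>k. real k * (t - s))"
    using assms k by (intro integral_mono Bochner_Integration.integrable_diff integrable_gen)
      (auto simp: integrable_id)
  also have "\<dots> = t - s" by (simp add: mean_one)
  finally show ?thesis .
qed

lemma gen_0 [simp]: "gen_compl p 0 = 0"
  by (simp add: gen_compl_def)

lemma gen_le_self: "0 \<le> s \<Longrightarrow> s \<le> 1 \<Longrightarrow> gen_compl p s \<le> s"
  using gen_lipschitz[of 0 s] by simp

lemma gen_nonneg: "0 \<le> s \<Longrightarrow> s \<le> 1 \<Longrightarrow> 0 \<le> gen_compl p s"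
  using gen_mono[of 0 s] by simp

text \<open>A union bound: if children carry one of two marks with probabilities s and t, a marked
  child carries the first or the second mark.\<close>

lemma gen_subadditive:
  assumes "0 \<le> s" "0 \<le> t" "s + t \<le> 1"
  shows "gen_compl p (s + t) \<le> gen_compl p s + gen_compl p t"
proof -
  have k: "(1 - s) ^ k + (1 - t) ^ k \<le> 1 + (1 - (s + t)) ^ k" for k
  proof (induction k)
    case (Suc k)
    have 0: "0 \<le> t * (1 - (1 - s) ^ k)" "0 \<le> s * (1 - (1 - t) ^ k)"
      using assms by (auto intro!: mult_nonneg_nonneg power_le_one)
    have "(1 - s) ^ Suc k + (1 - t) ^ Suc k
      = (1 - (s + t)) * ((1 - s) ^ k + (1 - t) ^ k) + t * (1 - s) ^ k + s * (1 - t) ^ k"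
      by (simp add: algebra_simps)
    also have "\<dots> \<le> (1 - (s + t)) * (1 + (1 - (s + t)) ^ k) + t + s"
      using Suc assms 0 mult_left_mono[OF Suc, of "1 - (s + t)"] by (simp add: algebra_simps)
    finally show ?case by (simp add: algebra_simps)
  qed simp
  have "gen_compl p (s + t) \<le> measure_pmf.expectation p (\<lambda>k. (1 - (1 - s) ^ k) + (1 - (1 - t) ^ k))"
    unfolding gen_compl_def
  proof (rule integral_mono)
    show "integrable (measure_pmf p) (\<lambda>k. 1 - (1 - (s + t)) ^ k)"
      using assms by (intro integrable_gen) auto
    show "integrable (measure_pmf p) (\<lambda>k. (1 - (1 - s) ^ k) + (1 - (1 - t) ^ k))"
      using assms by (intro Bochner_Integration.integrable_add integrable_gen) auto
    show "1 - (1 - (s + t)) ^ k \<le> (1 - (1 - s) ^ k) + (1 - (1 - t) ^ k)" for k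
      using k[of k] by linarith
  qed
  also have "\<dots> = gen_compl p s + gen_compl p t"
    unfolding gen_compl_def using assms
    by (intro Bochner_Integration.integral_add integrable_gen) auto
  finally show ?thesis .
qed

definition p2 :: real where "p2 = measure_pmf.prob p {2..}"

lemma p2_pos: "p2 > 0"
proof (rule ccontr)
  assume "\<not> p2 > 0"
  then have "measure_pmf.prob p {2..} = 0"
    unfolding p2_def using measure_nonneg[of "measure_pmf p" "{2..}"] by linarith
  then have "set_pmf p \<inter> {2..} = {}" by (simp add: measure_pmf_zero_iff)
  then have "k \<in> set_pmf p \<Longrightarrow> k = 0 \<or> k = 1" for k
    by (cases "k \<ge> 2") auto
  then have "measure_pmf.expectation p (\<lambda>k. real k * (real k - 1)) = 0"
    by (intro integral_eq_zero_AE) (auto simp: AE_measure_pmf_iff)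
  then show False using second_factorial_moment v_pos by simp
qed

text \<open>A strict decrease on all of [0,1]. The cubic error in \<open>gen_le\<close> may outweigh
  its quadratic term when s is not small, so that bound alone does not start the survival estimate;
  here every k >= 2 contributes at least s^2.\<close>

lemma gen_le_quadratic:
  assumes "0 \<le> s" "s \<le> 1"
  shows "gen_compl p s \<le> s - p2 * s\<^sup>2"
proof -
  have i: "integrable (measure_pmf p) (\<lambda>k. indicator {2..} k * s\<^sup>2 :: real)"
    using assms by (intro integrable_pmf_bounded[where B="s\<^sup>2"]) (auto simp: indicator_def)
  have "gen_compl p s \<le> measure_pmf.expectation p (\<lambda>k. real k * s - indicator {2..} k * s\<^sup>2)"
    unfolding gen_compl_def
  proof (rule integral_mono)
    show "integrable (measure_pmf p) (\<lambda>k. real k * s - indicator {2..} k * s\<^sup>2)"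
      by (intro Bochner_Integration.integrable_diff i) (simp add: integrable_id)
    fix k
    show "1 - (1 - s) ^ k \<le> real k * s - indicator {2..} k * s\<^sup>2"
    proof (cases "k \<ge> 2")
      case True
      then show ?thesis using power_one_minus_ge2[OF assms True] by simp
    next
      case False
      then have "k = 0 \<or> k = 1" by auto
      then show ?thesis by auto
    qed
  qed (rule integrable_gen[OF assms])
  also have "\<dots> = s - p2 * s\<^sup>2"
    using i by (subst Bochner_Integration.integral_diff) (auto simp: integrable_id mean_one p2_def)
  finally show ?thesis .
qed

end

section \<open>The one-generation operator\<close>

text \<open>For N = 1 this is the operator T of the overview. For general N it is T conjugated by
  the diffusive scaling, see \<open>brw_op_iter_scale\<close>: values of order one stand for
  probabilities of order 1/N, and space is measured in units of \<open>sqrt N\<close>.\<close>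

definition brw_op :: "int pmf \<Rightarrow> nat pmf \<Rightarrow> real \<Rightarrow> (real \<Rightarrow> real) \<Rightarrow> real \<Rightarrow> real" where
  "brw_op a p N g x =
     measure_pmf.expectation a (\<lambda>d. N * gen_compl p (g (x + real_of_int d / sqrt N) / N))"

definition walk_op :: "int pmf \<Rightarrow> (real \<Rightarrow> real) \<Rightarrow> real \<Rightarrow> real" where
  "walk_op a g x = measure_pmf.expectation a (\<lambda>d. g (x + real_of_int d))"

definition unit_step :: "real \<Rightarrow> real" where
  "unit_step y = (if 0 \<le> y then 1 else 0)"

definition surv :: "nat pmf \<Rightarrow> nat \<Rightarrow> real" where
  "surv p n = (gen_compl p ^^ n) 1"

lemma brw_op_shift: "brw_op a p N (\<lambda>y. g (y + s)) = (\<lambda>x. brw_op a p N g (x + s))"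
  by (intro ext) (simp add: brw_op_def algebra_simps)

lemma brw_op_iter_shift: "(brw_op a p N ^^ n) (\<lambda>y. g (y + s)) = (\<lambda>x. (brw_op a p N ^^ n) g (x + s))"
proof (induction n)
  case (Suc n)
  then show ?case using brw_op_shift[of a p N "(brw_op a p N ^^ n) g" s] by simp
qed simp

lemma brw_op_iter_scale:
  assumes "N > 0"
  shows "(brw_op a p 1 ^^ n) (\<lambda>y. g (y / sqrt N) / N) = (\<lambda>y. (brw_op a p N ^^ n) g (y / sqrt N) / N)"
proof (induction n)
  case (Suc n)
  let ?h = "(brw_op a p N ^^ n) g"
  have "brw_op a p 1 (\<lambda>y. ?h (y / sqrt N) / N) y = brw_op a p N ?h (y / sqrt N) / N" for y
    using assms by (simp add: brw_op_def add_divide_distrib)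
  then show ?case using Suc by auto
qed simp

lemma brw_op_iter_const: "(brw_op a p 1 ^^ n) (\<lambda>_. s) = (\<lambda>_. (gen_compl p ^^ n) s)"
proof (induction n)
  case (Suc n)
  then show ?case by (simp add: fun_eq_iff brw_op_def)
qed simp

lemma brw_op_iter_one: "(brw_op a p 1 ^^ n) (\<lambda>_. 1) = (\<lambda>_. surv p n)"
  by (simp add: brw_op_iter_const surv_def)

section \<open>Monotonicity, contraction and subadditivity of the one-generation operator\<close>

context critical_offspring
begin

lemma scaled_gen_integrable:
  assumes "N > 0" "\<And>x. 0 \<le> g x \<and> g x \<le> N"
  shows "integrable (measure_pmf a) (\<lambda>d. N * gen_compl p (g (f d) / N))"
proof (rule integrable_pmf_bounded[where B=N])
  fix d
  have "0 \<le> g (f d) / N" "g (f d) / N \<le> 1" using assms by auto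
  then have "0 \<le> gen_compl p (g (f d) / N)" "gen_compl p (g (f d) / N) \<le> 1"
    using gen_nonneg gen_le_self by force+
  then show "\<bar>N * gen_compl p (g (f d) / N)\<bar> \<le> N" using assms(1)
    by (simp add: abs_mult)
qed

text \<open>Monotonicity (\<kappa> = 0) and sup-norm contraction (applied in both directions) in one
  inequality. At each point either g <= h, where \<open>gen_mono\<close> applies, or the slope bound
  of \<open>gen_lipschitz\<close> turns a difference of at most \<kappa> into one of at most
  \<kappa>.\<close>

lemma brw_op_mono_add:
  assumes N: "N > 0" and g: "\<And>x. 0 \<le> g x \<and> g x \<le> N" and h: "\<And>x. 0 \<le> h x \<and> h x \<le> N"
    and k: "\<kappa> \<ge> 0" and le: "\<And>x. g x \<le> h x + \<kappa>"
  shows "brw_op a p N g x \<le> brw_op a p N h x + \<kappa>"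
proof -
  have *: "N * gen_compl p (g y / N) \<le> N * gen_compl p (h y / N) + \<kappa>" for y
  proof (cases "g y \<le> h y")
    case True
    then have "gen_compl p (g y / N) \<le> gen_compl p (h y / N)"
      using N g h by (intro gen_mono) (auto simp: divide_right_mono)
    then show ?thesis using N k by (simp add: add_increasing2)
  next
    case False
    then have "gen_compl p (g y / N) - gen_compl p (h y / N) \<le> g y / N - h y / N"
      using N g h by (intro gen_lipschitz) (auto simp: divide_right_mono)
    then have "N * (gen_compl p (g y / N) - gen_compl p (h y / N)) \<le> N * (g y / N - h y / N)"
      using N by simp
    also have "\<dots> = g y - h y" using N by (simp add: field_simps)
    finally show ?thesis using le[of y] by (simp add: algebra_simps)
  qed
  have "brw_op a p N g x \<le> measure_pmf.expectation a
      (\<lambda>d. N * gen_compl p (h (x + real_of_int d / sqrt N) / N) + \<kappa>)"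
    unfolding brw_op_def
    by (intro integral_mono scaled_gen_integrable Bochner_Integration.integrable_add *)
       (use N g h in auto)
  also have "\<dots> = brw_op a p N h x + \<kappa>"
    unfolding brw_op_def
    using scaled_gen_integrable[where g=h and N=N and a=a, OF N h, where f="\<lambda>d. x + real_of_int d / sqrt N"]
    by (subst Bochner_Integration.integral_add) auto
  finally show ?thesis .
qed

lemma brw_op_range:
  assumes N: "N > 0" and g: "\<And>x. 0 \<le> g x \<and> g x \<le> c" and c: "c \<le> N"
  shows "0 \<le> brw_op a p N g x \<and> brw_op a p N g x \<le> c"
proof
  have gN: "0 \<le> g x \<and> g x \<le> N" for x using g[of x] c by linarith
  have c0: "0 \<le> c" using g[of 0] by linarith
  show "0 \<le> brw_op a p N g x" unfolding brw_op_def
    by (intro integral_nonneg_AE AE_I2) (use N gN in \<open>auto intro!: mult_nonneg_nonneg gen_nonneg\<close>)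
  have "brw_op a p N g x \<le> brw_op a p N (\<lambda>_. 0) x + c"
    by (intro brw_op_mono_add) (use N gN g c0 in auto)
  then show "brw_op a p N g x \<le> c" by (simp add: brw_op_def)
qed

lemma brw_op_iter_range:
  assumes N: "N > 0" and g: "\<And>x. 0 \<le> g x \<and> g x \<le> c" and c: "c \<le> N"
  shows "0 \<le> (brw_op a p N ^^ n) g x \<and> (brw_op a p N ^^ n) g x \<le> c"
  by (induction n arbitrary: x) (use g in \<open>auto intro!: brw_op_range[OF N _ c, THEN conjunct1] brw_op_range[OF N _ c, THEN conjunct2]\<close>)

lemma brw_op_iter_mono_add:
  assumes N: "N > 0" and g: "\<And>x. 0 \<le> g x \<and> g x \<le> N" and h: "\<And>x. 0 \<le> h x \<and> h x \<le> N"
    and k: "\<kappa> \<ge> 0" and le: "\<And>x. g x \<le> h x + \<kappa>"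
  shows "(brw_op a p N ^^ n) g x \<le> (brw_op a p N ^^ n) h x + \<kappa>"
proof (induction n arbitrary: x)
  case (Suc n)
  show ?case unfolding funpow.simps o_def
    by (rule brw_op_mono_add[OF N brw_op_iter_range[OF N g order_refl] brw_op_iter_range[OF N h order_refl] k Suc])
qed (use le in auto)

lemma brw_op_iter_mono:
  assumes N: "N > 0" and g: "\<And>x. 0 \<le> g x \<and> g x \<le> N" and h: "\<And>x. 0 \<le> h x \<and> h x \<le> N"
    and le: "\<And>x. g x \<le> h x"
  shows "(brw_op a p N ^^ n) g x \<le> (brw_op a p N ^^ n) h x"
  using brw_op_iter_mono_add[OF N g h order_refl, where n=n and x=x] le by simp

lemma brw_op_iter_monotone:
  assumes N: "N > 0" and g: "\<And>x. 0 \<le> g x \<and> g x \<le> N" and le: "\<And>x y. x \<le> y \<Longrightarrow> g x \<le> g y"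
    and xy: "x \<le> y"
  shows "(brw_op a p N ^^ n) g x \<le> (brw_op a p N ^^ n) g y"
proof -
  have "(brw_op a p N ^^ n) g x \<le> (brw_op a p N ^^ n) (\<lambda>z. g (z + (y - x))) x"
    by (intro brw_op_iter_mono N g le) (use xy in auto)
  then show ?thesis by (simp add: brw_op_iter_shift)
qed

text \<open>The union bound of \<open>gen_subadditive\<close> carried through n generations. It is
  used to split survival into survival to the right and survival to the left of a point.\<close>

lemma brw_op_iter_subadd:
  assumes g: "\<And>x. 0 \<le> g x" and h: "\<And>x. 0 \<le> h x" and le: "\<And>x. g x + h x \<le> 1"
  shows "(brw_op a p 1 ^^ n) (\<lambda>x. g x + h x) x \<le> (brw_op a p 1 ^^ n) g x + (brw_op a p 1 ^^ n) h x"
  using assms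
proof (induction n arbitrary: g h)
  case (Suc n)
  note g = Suc.prems(1) and h = Suc.prems(2) and le = Suc.prems(3)
  have g1: "0 \<le> g x \<and> g x \<le> 1" and h1: "0 \<le> h x \<and> h x \<le> 1" for x
    using g[of x] h[of x] le[of x] by auto
  let ?T = "brw_op a p 1"
  have ip: "integrable (measure_pmf a) (\<lambda>d. gen_compl p (f (x + real_of_int d)))" if "\<And>x. 0 \<le> f x \<and> f x \<le> 1" for f :: "real \<Rightarrow> real" and x :: real
    using scaled_gen_integrable[of 1 f a "\<lambda>d. x + real_of_int d"] that by simp
  have sum: "0 \<le> g x + h x \<and> g x + h x \<le> 1" for x
    using g[of x] h[of x] le[of x] by auto
  have sub: "?T (\<lambda>x. g x + h x) x \<le> ?T g x + ?T h x" for x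
  proof -
    have "?T (\<lambda>x. g x + h x) x = measure_pmf.expectation a
      (\<lambda>d. gen_compl p (g (x + real_of_int d) + h (x + real_of_int d)))"
      by (simp add: brw_op_def)
    also have "\<dots> \<le> measure_pmf.expectation a
      (\<lambda>d. gen_compl p (g (x + real_of_int d)) + gen_compl p (h (x + real_of_int d)))"
      using ip[where f="\<lambda>x. g x + h x", OF sum] ip[where f=g, OF g1] ip[where f=h, OF h1]
      by (intro integral_mono Bochner_Integration.integrable_add gen_subadditive g h le)
    also have "\<dots> = ?T g x + ?T h x"
      unfolding brw_op_def using ip[where f=g, OF g1] ip[where f=h, OF h1] by simp
    finally show ?thesis .
  qed
  define m where "m x = min (?T h x) (1 - ?T g x)" for x
  have rT: "0 \<le> ?T g x \<and> ?T g x \<le> 1" "0 \<le> ?T h x \<and> ?T h x \<le> 1" for x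
    using brw_op_range[of 1 g 1] brw_op_range[of 1 h 1] g1 h1 by auto
  have rS: "0 \<le> ?T (\<lambda>x. g x + h x) x \<and> ?T (\<lambda>x. g x + h x) x \<le> 1" for x
    using brw_op_range[of 1 "\<lambda>x. g x + h x" 1] sum by auto
  have m: "0 \<le> m x" "m x \<le> ?T h x" "?T g x + m x \<le> 1" for x
    using rT[of x] by (auto simp: m_def)
  have "(?T ^^ Suc n) (\<lambda>x. g x + h x) x = (?T ^^ n) (?T (\<lambda>x. g x + h x)) x"
    by (simp only: funpow_Suc_right o_apply)
  also have "\<dots> \<le> (?T ^^ n) (\<lambda>x. ?T g x + m x) x"
    by (intro brw_op_iter_mono) (use rT m rS sub in \<open>auto simp: m_def min_def add_increasing\<close>)
  also have "\<dots> \<le> (?T ^^ n) (?T g) x + (?T ^^ n) m x"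
    by (intro Suc.IH) (use rT m in auto)
  also have "(?T ^^ n) m x \<le> (?T ^^ n) (?T h) x"
  proof (intro brw_op_iter_mono)
    show "0 \<le> m y \<and> m y \<le> 1" for y using m[of y] rT[of y] by auto
  qed (use m rT in auto)
  finally show ?case by (simp only: funpow_Suc_right o_apply)
qed simp

lemma brw_op_le_walk:
  assumes g: "\<And>x. 0 \<le> g x \<and> g x \<le> 1"
  shows "brw_op a p 1 g x \<le> walk_op a g x"
  unfolding brw_op_def walk_op_def
  using scaled_gen_integrable[of 1 g a "\<lambda>d. x + real_of_int d"] g
  by (intro integral_mono) (auto intro!: gen_le_self integrable_pmf_bounded[where B=1])

text \<open>Where the values are at most \<theta>, the quadratic loss v/2 g^2 is at most the
  fraction v\<theta>/2 of g. With \<theta> of order 1/n the loss over n generations is only a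
  constant factor, which \<open>brw_lower\<close> exploits.\<close>

lemma brw_op_ge_walk:
  assumes g: "\<And>x. 0 \<le> g x \<and> g x \<le> \<theta>" and th: "\<theta> \<le> 1"
  shows "brw_op a p 1 g x \<ge> (1 - v * \<theta> / 2) * walk_op a g x"
proof -
  have g1: "0 \<le> g x \<and> g x \<le> 1" for x using g[of x] th by linarith
  have "(1 - v * \<theta> / 2) * walk_op a g x = measure_pmf.expectation a (\<lambda>d. (1 - v * \<theta> / 2) * g (x + real_of_int d))"
    unfolding walk_op_def by simp
  also have "\<dots> \<le> brw_op a p 1 g x" unfolding brw_op_def
  proof (rule integral_mono)
    show "integrable (measure_pmf a) (\<lambda>d. (1 - v * \<theta> / 2) * g (x + real_of_int d))"
      using g1 by (intro integrable_mult_right integrable_pmf_bounded[where B=1]) auto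
    show "integrable (measure_pmf a) (\<lambda>d. 1 * gen_compl p (g (x + real_of_int d / sqrt 1) / 1))"
      using scaled_gen_integrable[of 1 g a "\<lambda>d. x + real_of_int d"] g1 by auto
    fix d
    let ?g = "g (x + real_of_int d)"
    have "v / 2 * ?g\<^sup>2 \<le> v / 2 * (\<theta> * ?g)"
      unfolding power2_eq_square using g[of "x + real_of_int d"] v_pos
      by (intro mult_left_mono mult_right_mono) auto
    then have "(1 - v * \<theta> / 2) * ?g \<le> ?g - v / 2 * ?g\<^sup>2" by (simp add: algebra_simps)
    also have "\<dots> \<le> gen_compl p ?g" using gen_ge[of ?g] g1 by auto
    finally show "(1 - v * \<theta> / 2) * ?g \<le> 1 * gen_compl p (g (x + real_of_int d / sqrt 1) / 1)" by simp
  qed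
  finally show ?thesis .
qed

subsection \<open>Survival probabilities\<close>

lemma gen_pos:
  assumes "0 < s" "s \<le> 1"
  shows "gen_compl p s > 0"
proof -
  \<comment> \<open>The lower bound t - v/2 t^2 is positive only for t < 2/v; larger arguments are
    reached by monotonicity.\<close>
  define t where "t = min s (1 / v)"
  have t: "0 < t" "t \<le> s" "t * v \<le> 1" using assms v_pos by (auto simp: t_def min_def field_simps)
  have "v / 2 * t\<^sup>2 \<le> t / 2" using t mult_left_mono[OF t(3), of t] by (simp add: power2_eq_square algebra_simps)
  then have "0 < t - v / 2 * t\<^sup>2" using t by simp
  also have "\<dots> \<le> gen_compl p t" using t assms by (intro gen_ge) auto
  also have "\<dots> \<le> gen_compl p s" using t assms by (intro gen_mono) auto
  finally show ?thesis .
qed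

lemma surv_pos_le: "0 < surv p n \<and> surv p n \<le> 1"
proof (induction n)
  case (Suc n)
  then have "gen_compl p (surv p n) > 0" "gen_compl p (surv p n) \<le> surv p n"
    by (auto intro: gen_pos gen_le_self)
  then show ?case using Suc by (auto simp: surv_def)
qed (simp add: surv_def)

lemma surv_Suc: "surv p (Suc n) = gen_compl p (surv p n)"
  by (simp add: surv_def)

text \<open>The reciprocal of the survival probability grows by at least \<open>p2\<close> per
  generation, since s - p2 s^2 <= 1 / (1/s + p2). Unlike the asymptotic statement below it holds for
  every n, as the induction in \<open>brw_tail\<close> requires.\<close>

lemma surv_upper: "surv p n \<le> 1 / (1 + p2 * real n)"
proof (induction n)
  case (Suc n)
  define s where "s = surv p n"
  define c where "c = 1 + p2 * real n"
  have c: "c \<ge> 1" using p2_pos by (simp add: c_def)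
  have s: "0 < s" "s \<le> 1" "s \<le> 1 / c" using surv_pos_le[of n] Suc by (auto simp: s_def c_def)
  have ps: "1 + p2 * s > 0" using s p2_pos by (simp add: add_pos_pos)
  have "surv p (Suc n) \<le> s - p2 * s\<^sup>2"
    unfolding surv_Suc s_def[symmetric] using s by (intro gen_le_quadratic) auto
  also have "\<dots> \<le> s / (1 + p2 * s)"
  proof -
    have "(s - p2 * s\<^sup>2) * (1 + p2 * s) = s - p2\<^sup>2 * s ^ 3"
      by (simp add: algebra_simps power2_eq_square power3_eq_cube)
    also have "\<dots> \<le> s" using s by simp
    finally show ?thesis using ps by (simp add: pos_le_divide_eq)
  qed
  also have "\<dots> \<le> 1 / (c + p2)"
  proof -
    have "s * c \<le> 1" using s c by (simp add: field_simps)
    then show ?thesis using ps c p2_pos by (simp add: field_simps add_pos_pos)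
  qed
  finally show ?case by (simp add: c_def algebra_simps)
qed (simp add: surv_def)

lemma surv_tendsto_0: "surv p \<longlonglongrightarrow> 0"
proof (rule tendsto_sandwich)
  show "\<forall>\<^sub>F n in sequentially. 0 \<le> surv p n" using surv_pos_le by (auto intro!: always_eventually less_imp_le)
  show "\<forall>\<^sub>F n in sequentially. surv p n \<le> 1 / (1 + p2 * real n)" using surv_upper by auto
  show "(\<lambda>n. 1 / (1 + p2 * real n)) \<longlonglongrightarrow> 0" using p2_pos by real_asymp
qed simp

end

text \<open>Stolz-Cesaro with the denominators n: from some index on the increments are within e/2
  of L, and the fixed initial part is negligible after division by n.\<close>

lemma increments_tendsto_imp_average:
  fixes r :: "nat \<Rightarrow> real"
  assumes "(\<lambda>n. r (Suc n) - r n) \<longlonglongrightarrow> L"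
  shows "(\<lambda>n. r n / real n) \<longlonglongrightarrow> L"
proof (rule LIMSEQ_I)
  fix e :: real assume e: "e > 0"
  obtain m where m: "\<And>n. n \<ge> m \<Longrightarrow> \<bar>r (Suc n) - r n - L\<bar> < e / 2"
    using LIMSEQ_D[OF assms, of "e/2"] e by auto
  have b: "\<bar>r (m + k) - r m - real k * L\<bar> \<le> real k * (e / 2)" for k
  proof (induction k)
    case (Suc k)
    then show ?case using m[of "m + k"] by (auto simp: algebra_simps abs_if split: if_splits)
  qed simp
  define c where "c = \<bar>r m\<bar> + real m * \<bar>L\<bar>"
  obtain k0 where k0: "real k0 > 2 * c / e" using reals_Archimedean2 by blast
  show "\<exists>no. \<forall>n\<ge>no. norm (r n / real n - L) < e"
  proof (intro exI allI impI)
    fix n assume n: "n \<ge> m + k0 + 1"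
    then obtain k where k: "n = m + k" "k \<ge> k0 + 1" by (metis add.commute add_le_imp_le_left le_iff_add group_cancel.add1 add.assoc)
    have n0: "real n > 0" using n by simp
    have "\<bar>r n - real n * L\<bar> \<le> real k * (e / 2) + c"
    proof -
      have "\<bar>real m * L\<bar> = real m * \<bar>L\<bar>" by (simp add: abs_mult)
      moreover have "r n - real n * L = (r (m + k) - r m - real k * L) + r m - real m * L"
        by (simp add: k algebra_simps)
      ultimately show ?thesis using b[of k] unfolding c_def by linarith
    qed
    also have "c < real k0 * (e / 2)" using k0 e by (simp add: field_simps)
    also have "real k0 * (e / 2) \<le> real n * (e / 2)" using n e by (intro mult_right_mono) auto
    also have "real k * (e / 2) + real n * (e / 2) \<le> real n * (e / 2) + real n * (e / 2)"
      using k e by (intro add_mono mult_right_mono) auto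
    finally have "\<bar>r n - real n * L\<bar> < real n * e" by (simp add: field_simps)
    moreover have "r n / real n - L = (r n - real n * L) / real n" using n0 by (simp add: field_simps)
    ultimately show "norm (r n / real n - L) < e" using n0 by (simp add: field_simps abs_mult)
  qed
qed

context critical_offspring
begin

text \<open>Kolmogorov's estimate. The increments of the reciprocal of \<open>surv p n\<close> are
  the quotient of a term tending to v/2, by the second-order expansion, and of the ratio of
  successive survival probabilities, which tends to 1. So the reciprocals grow like n v/2.\<close>

theorem surv_asymp: "(\<lambda>n. real n * surv p n) \<longlonglongrightarrow> 2 / v"
proof -
  let ?s = "surv p"
  have s: "0 < ?s n" "?s n \<le> 1" for n using surv_pos_le[of n] by auto
  have q: "(\<lambda>n. ?s (Suc n) / ?s n) \<longlonglongrightarrow> 1"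
  proof (rule tendsto_sandwich)
    have "1 - v / 2 * ?s n \<le> ?s (Suc n) / ?s n" for n
      using gen_ge[of "?s n"] s[of n] by (simp add: surv_Suc field_simps power2_eq_square)
    then show "\<forall>\<^sub>F n in sequentially. 1 - v / 2 * ?s n \<le> ?s (Suc n) / ?s n" by simp
    have "?s (Suc n) / ?s n \<le> 1" for n
      using gen_le_self[of "?s n"] s[of n] by (simp add: surv_Suc field_simps)
    then show "\<forall>\<^sub>F n in sequentially. ?s (Suc n) / ?s n \<le> 1" by simp
    show "(\<lambda>n. 1 - v / 2 * ?s n) \<longlonglongrightarrow> 1"
      by (auto intro!: tendsto_eq_intros surv_tendsto_0)
  qed simp
  have d: "(\<lambda>n. (?s n - ?s (Suc n)) / (?s n)\<^sup>2) \<longlonglongrightarrow> v / 2"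
  proof (rule tendsto_sandwich)
    have "v / 2 - m3 * ?s n \<le> (?s n - ?s (Suc n)) / (?s n)\<^sup>2" for n
      using gen_le[of "?s n"] s[of n] by (simp add: surv_Suc field_simps power2_eq_square power3_eq_cube)
    then show "\<forall>\<^sub>F n in sequentially. v / 2 - m3 * ?s n \<le> (?s n - ?s (Suc n)) / (?s n)\<^sup>2" by simp
    have "(?s n - ?s (Suc n)) / (?s n)\<^sup>2 \<le> v / 2" for n
      using gen_ge[of "?s n"] s[of n] by (simp add: surv_Suc field_simps power2_eq_square)
    then show "\<forall>\<^sub>F n in sequentially. (?s n - ?s (Suc n)) / (?s n)\<^sup>2 \<le> v / 2" by simp
    show "(\<lambda>n. v / 2 - m3 * ?s n) \<longlonglongrightarrow> v / 2"
      by (auto intro!: tendsto_eq_intros surv_tendsto_0)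
  qed simp
  have eq: "1 / ?s (Suc n) - 1 / ?s n = (?s n - ?s (Suc n)) / (?s n)\<^sup>2 / (?s (Suc n) / ?s n)" for n
    using s[of n] s[of "Suc n"] by (simp add: field_simps power2_eq_square)
  have "(\<lambda>n. 1 / ?s (Suc n) - 1 / ?s n) \<longlonglongrightarrow> v / 2 / 1"
    unfolding eq by (intro tendsto_divide q d) simp
  then have "(\<lambda>n. 1 / ?s n / real n) \<longlonglongrightarrow> v / 2"
    using increments_tendsto_imp_average[of "\<lambda>n. 1 / ?s n"] by simp
  then have "(\<lambda>n. inverse (1 / ?s n / real n)) \<longlonglongrightarrow> inverse (v / 2)"
    using v_pos by (intro tendsto_inverse) auto
  then show ?thesis by (simp add: field_simps)
qed

subsection \<open>The branching property\<close>

lemma prod_list_one_minus_bounds: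
  fixes g :: "'b \<Rightarrow> real"
  assumes "\<And>x. 0 \<le> g x \<and> g x \<le> 1"
  shows "0 \<le> (\<Prod>x\<leftarrow>xs. 1 - g x) \<and> (\<Prod>x\<leftarrow>xs. 1 - g x) \<le> 1"
  by (induction xs) (use assms in \<open>auto intro!: mult_nonneg_nonneg mult_le_one\<close>)

lemma expectation_brw_step:
  assumes g: "\<And>x. 0 \<le> g x \<and> g x \<le> 1"
  shows "measure_pmf.expectation (brw_step a p xs) (\<lambda>ys. \<Prod>y\<leftarrow>ys. 1 - g (real_of_int y))
    = (\<Prod>x\<leftarrow>xs. 1 - brw_op a p 1 g (real_of_int x))"
proof (induction xs)
  case (Cons x xs)
  let ?P = "\<lambda>ys. \<Prod>y\<leftarrow>ys. 1 - g (real_of_int y)"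
  have P: "\<bar>?P ys\<bar> \<le> 1" for ys
    using prod_list_one_minus_bounds[of "\<lambda>y. g (real_of_int y)" ys] g by auto
  have rep: "?P (replicate k z @ ys) = (1 - g (real_of_int z)) ^ k * ?P ys" for k z ys
    by (induction k) auto
  let ?E = "measure_pmf.expectation (brw_step a p xs) ?P"
  have i1: "integrable (measure_pmf p) (\<lambda>k. 1 - (1 - g z) ^ k)" for z
    using g by (intro integrable_gen) auto
  have gp: "measure_pmf.expectation p (\<lambda>k. (1 - g z) ^ k) = 1 - gen_compl p (g z)" for z
  proof -
    have "measure_pmf.expectation p (\<lambda>k. 1 - (1 - (1 - g z) ^ k)) = 1 - gen_compl p (g z)"
      unfolding gen_compl_def by (subst Bochner_Integration.integral_diff) (use i1 in auto)
    then show ?thesis by simp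
  qed
  have i2: "integrable (measure_pmf a) (\<lambda>d. gen_compl p (g (real_of_int x + real_of_int d)))"
    using scaled_gen_integrable[of 1 g a "\<lambda>d. real_of_int x + real_of_int d"] g by simp
  have "measure_pmf.expectation (brw_step a p (x # xs)) ?P =
    measure_pmf.expectation a (\<lambda>d. measure_pmf.expectation p (\<lambda>k.
      measure_pmf.expectation (brw_step a p xs) (\<lambda>ys. ?P (replicate k (x + d) @ ys))))"
    by (simp add: expectation_bind_pmf[where B=1 and f="?P", OF P] del: map_append prod_list.append)
  also have "\<dots> = measure_pmf.expectation a (\<lambda>d. measure_pmf.expectation p (\<lambda>k.
      (1 - g (real_of_int (x + d))) ^ k * ?E))"
    unfolding rep by simp
  also have "\<dots> = measure_pmf.expectation a (\<lambda>d. (1 - gen_compl p (g (real_of_int x + real_of_int d))) * ?E)"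
    by (simp add: gp)
  also have "\<dots> = (1 - brw_op a p 1 g (real_of_int x)) * ?E"
    unfolding brw_op_def using i2 by simp
  finally show ?case using Cons by simp
qed simp

text \<open>Independent particles turn expectations of products into products, so a generation maps
  the functional given by g to the one given by its image under \<open>brw_op\<close>. The last
  generation is integrated out first, which changes g; hence the induction is over all g.\<close>

lemma expectation_brw:
  assumes g: "\<And>x. 0 \<le> g x \<and> g x \<le> 1"
  shows "measure_pmf.expectation (brw a p n) (\<lambda>ys. \<Prod>y\<leftarrow>ys. 1 - g (real_of_int y))
    = 1 - (brw_op a p 1 ^^ n) g 0"
  using g
proof (induction n arbitrary: g)
  case (Suc n)
  let ?P = "\<lambda>ys. \<Prod>y\<leftarrow>ys. 1 - g (real_of_int y)"
  have P: "\<bar>?P ys\<bar> \<le> 1" for ys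
    using prod_list_one_minus_bounds[of "\<lambda>y. g (real_of_int y)" ys] Suc.prems by auto
  have "measure_pmf.expectation (brw a p (Suc n)) ?P
    = measure_pmf.expectation (brw a p n) (\<lambda>ys. \<Prod>y\<leftarrow>ys. 1 - brw_op a p 1 g (real_of_int y))"
    by (simp add: expectation_bind_pmf[where B=1 and f="?P", OF P] expectation_brw_step[where g=g, OF Suc.prems])
  also have "\<dots> = 1 - (brw_op a p 1 ^^ n) (brw_op a p 1 g) 0"
    by (intro Suc.IH brw_op_range) (use Suc.prems in auto)
  finally show ?case by (simp only: funpow_Suc_right o_apply)
qed simp

text \<open>For an indicator g the product in \<open>expectation_brw\<close> is 1 exactly when no
  particle satisfies R, and 0 otherwise.\<close>

lemma prob_brw_exists:
  "measure_pmf.prob (brw a p n) {xs. \<exists>y\<in>set xs. R (real_of_int y)}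
    = (brw_op a p 1 ^^ n) (\<lambda>y. if R y then 1 else 0) 0"
proof -
  let ?g = "\<lambda>y. if R y then 1 else 0 :: real"
  have pr: "(\<Prod>y\<leftarrow>xs. 1 - ?g (real_of_int y)) = 1 - indicator {xs. \<exists>y\<in>set xs. R (real_of_int y)} xs" for xs
    by (induction xs) (auto simp: indicator_def)
  have "1 - (brw_op a p 1 ^^ n) ?g 0
    = measure_pmf.expectation (brw a p n) (\<lambda>ys. \<Prod>y\<leftarrow>ys. 1 - ?g (real_of_int y))"
    by (rule expectation_brw[symmetric]) auto
  also have "\<dots> = 1 - measure_pmf.prob (brw a p n) {xs. \<exists>y\<in>set xs. R (real_of_int y)}"
    unfolding pr by (subst Bochner_Integration.integral_diff)
      (auto intro!: integrable_pmf_bounded[where B=1] simp: indicator_def)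
  finally show ?thesis by simp
qed

lemma prob_brw_ge:
  "measure_pmf.prob (brw a p n) {xs. \<exists>y\<in>set xs. t \<le> real_of_int y} = (brw_op a p 1 ^^ n) unit_step (- t)"
proof -
  have "(\<lambda>y. if t \<le> y then 1 else 0) = (\<lambda>y. unit_step (y + - t))"
    by (auto simp: unit_step_def)
  then show ?thesis unfolding prob_brw_exists by (simp only: brw_op_iter_shift) simp
qed

lemma prob_brw_survive: "measure_pmf.prob (brw a p n) {xs. length xs \<ge> 1} = surv p n"
proof -
  have "{xs :: int list. length xs \<ge> 1} = {xs. \<exists>y\<in>set xs. True}"
    by (auto simp: Suc_le_eq ex_in_conv)
  then show ?thesis using prob_brw_exists[of a n "\<lambda>_. True"] by (simp add: brw_op_iter_one)
qed

end

section \<open>Moments of the underlying random walk\<close>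

locale centered_step =
  fixes a :: "int pmf" and e :: real
  assumes fourth_moment: "integrable (measure_pmf a) (\<lambda>d. real_of_int d ^ 4)"
    and mean_zero: "measure_pmf.expectation a real_of_int = 0"
    and step_variance: "measure_pmf.variance a real_of_int = e"
    and e_pos: "e > 0"
begin

definition \<mu>3 :: real where "\<mu>3 = measure_pmf.expectation a (\<lambda>d. real_of_int d ^ 3)"
definition \<mu>4 :: real where "\<mu>4 = measure_pmf.expectation a (\<lambda>d. real_of_int d ^ 4)"

lemma integrable_power:
  assumes "i \<le> 4"
  shows "integrable (measure_pmf a) (\<lambda>d. \<bar>real_of_int d\<bar> ^ i)"
    and "integrable (measure_pmf a) (\<lambda>d. real_of_int d ^ i)"
proof -
  have b: "\<bar>real_of_int d\<bar> ^ i \<le> 1 + real_of_int d ^ 4" for d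
  proof (cases "d = 0")
    case True
    then show ?thesis by (simp add: power_0_left)
  next
    case False
    then have "\<bar>real_of_int d\<bar> \<ge> 1" by linarith
    then have "\<bar>real_of_int d\<bar> ^ i \<le> \<bar>real_of_int d\<bar> ^ 4" using assms by (intro power_increasing) auto
    then show ?thesis by simp
  qed
  have i: "integrable (measure_pmf a) (\<lambda>d. 1 + real_of_int d ^ 4)"
    using fourth_moment by simp
  show "integrable (measure_pmf a) (\<lambda>d. \<bar>real_of_int d\<bar> ^ i)"
    by (rule Bochner_Integration.integrable_bound[OF i]) (use b in auto)
  show "integrable (measure_pmf a) (\<lambda>d. real_of_int d ^ i)"
    by (rule Bochner_Integration.integrable_bound[OF i]) (use b in \<open>auto simp: power_abs\<close>)
qed

lemma second_moment: "measure_pmf.expectation a (\<lambda>d. (real_of_int d)\<^sup>2) = e"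
  using step_variance mean_zero by simp

lemma expectation_quartic:
  "integrable (measure_pmf a) (\<lambda>d. c0 + c1 * real_of_int d + c2 * real_of_int d ^ 2 + c3 * real_of_int d ^ 3 + c4 * real_of_int d ^ 4)"
  "measure_pmf.expectation a (\<lambda>d. c0 + c1 * real_of_int d + c2 * real_of_int d ^ 2 + c3 * real_of_int d ^ 3 + c4 * real_of_int d ^ 4)
    = c0 + c2 * e + c3 * \<mu>3 + c4 * \<mu>4"
proof -
  have i: "integrable (measure_pmf a) (\<lambda>d. real_of_int d)" 
    "integrable (measure_pmf a) (\<lambda>d. real_of_int d ^ 2)" "integrable (measure_pmf a) (\<lambda>d. real_of_int d ^ 3)"
    using integrable_power(2)[of 1] integrable_power(2)[of 2] integrable_power(2)[of 3] by auto
  show "integrable (measure_pmf a) (\<lambda>d. c0 + c1 * real_of_int d + c2 * real_of_int d ^ 2 + c3 * real_of_int d ^ 3 + c4 * real_of_int d ^ 4)"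
    using i fourth_moment by auto
  show "measure_pmf.expectation a (\<lambda>d. c0 + c1 * real_of_int d + c2 * real_of_int d ^ 2 + c3 * real_of_int d ^ 3 + c4 * real_of_int d ^ 4)
    = c0 + c2 * e + c3 * \<mu>3 + c4 * \<mu>4"
    using i fourth_moment by (simp add: mean_zero second_moment \<mu>3_def[symmetric] \<mu>4_def[symmetric])
qed

text \<open>\<open>quartic \<alpha> \<beta> \<gamma> \<kappa> j x\<close> is the expectation of \<open>\<alpha> y\<^sup>4 + \<beta> y\<^sup>2 + \<gamma> y + \<kappa>\<close> at the position \<open>y\<close>
  reached in \<open>j\<close> steps from \<open>x\<close>.\<close>

definition quartic :: "real \<Rightarrow> real \<Rightarrow> real \<Rightarrow> real \<Rightarrow> nat \<Rightarrow> real \<Rightarrow> real" where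
  "quartic \<alpha> \<beta> \<gamma> \<kappa> j x =
     \<alpha> * (x ^ 4 + 6 * real j * e * x ^ 2 + 4 * real j * \<mu>3 * x + real j * \<mu>4 + 3 * real j * (real j - 1) * e\<^sup>2)
     + \<beta> * (x ^ 2 + real j * e) + \<gamma> * x + \<kappa>"

lemma walk_quartic:
  "integrable (measure_pmf a) (\<lambda>d. quartic \<alpha> \<beta> \<gamma> \<kappa> j (x + real_of_int d))"
  "walk_op a (quartic \<alpha> \<beta> \<gamma> \<kappa> j) x = quartic \<alpha> \<beta> \<gamma> \<kappa> (Suc j) x"
proof -
  have ex: "quartic \<alpha> \<beta> \<gamma> \<kappa> j (x + real_of_int d) =
     quartic \<alpha> \<beta> \<gamma> \<kappa> j x
     + (\<alpha> * (4 * x ^ 3 + 12 * real j * e * x + 4 * real j * \<mu>3) + 2 * \<beta> * x + \<gamma>) * real_of_int d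
     + (\<alpha> * (6 * x ^ 2 + 6 * real j * e) + \<beta>) * real_of_int d ^ 2
     + (\<alpha> * 4 * x) * real_of_int d ^ 3 + \<alpha> * real_of_int d ^ 4" for d
    by (simp add: quartic_def algebra_simps power2_eq_square power3_eq_cube power4_eq_xxxx)
  show "integrable (measure_pmf a) (\<lambda>d. quartic \<alpha> \<beta> \<gamma> \<kappa> j (x + real_of_int d))"
    unfolding ex by (rule expectation_quartic)
  show "walk_op a (quartic \<alpha> \<beta> \<gamma> \<kappa> j) x = quartic \<alpha> \<beta> \<gamma> \<kappa> (Suc j) x"
    unfolding walk_op_def ex expectation_quartic
    by (simp add: quartic_def algebra_simps power2_eq_square power3_eq_cube power4_eq_xxxx)
qed

end

lemma walk_op_shift: "(walk_op a ^^ n) (\<lambda>y. g (y + s)) = (\<lambda>x. (walk_op a ^^ n) g (x + s))"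
proof (induction n)
  case (Suc n)
  then show ?case by (simp add: fun_eq_iff walk_op_def algebra_simps)
qed simp

lemma walk_op_cmult: "(walk_op a ^^ n) (\<lambda>y. c * g y) = (\<lambda>x. c * (walk_op a ^^ n) g x)"
proof (induction n)
  case (Suc n)
  then show ?case by (simp add: fun_eq_iff walk_op_def)
qed simp

lemma walk_op_iter_bounded:
  assumes "\<And>x. \<bar>g x\<bar> \<le> B"
  shows "\<bar>(walk_op a ^^ n) g x\<bar> \<le> B"
proof (induction n arbitrary: x)
  case (Suc n)
  let ?h = "(walk_op a ^^ n) g"
  have i: "integrable (measure_pmf a) (\<lambda>d. ?h (x + real_of_int d))"
    by (rule integrable_pmf_bounded[where B=B]) (rule Suc)
  have "\<bar>walk_op a ?h x\<bar> \<le> measure_pmf.expectation a (\<lambda>d. \<bar>?h (x + real_of_int d)\<bar>)"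
    unfolding walk_op_def by (rule integral_abs_bound)
  also have "\<dots> \<le> measure_pmf.expectation a (\<lambda>d. B)"
    using i Suc by (intro integral_mono) auto
  finally show ?case by simp
qed (use assms in auto)

lemma walk_op_iter_mono:
  assumes g: "\<And>x. \<bar>g x\<bar> \<le> B" and h: "\<And>x. \<bar>h x\<bar> \<le> C" and "\<And>x. g x \<le> h x"
  shows "(walk_op a ^^ n) g x \<le> (walk_op a ^^ n) h x"
proof (induction n arbitrary: x)
  case (Suc n)
  show ?case unfolding funpow.simps o_apply walk_op_def[of a "(walk_op a ^^ n) g"]
      walk_op_def[of a "(walk_op a ^^ n) h"]
    by (intro integral_mono Suc
          integrable_pmf_bounded[where B=B] integrable_pmf_bounded[where B=C])
       (rule walk_op_iter_bounded[OF g] walk_op_iter_bounded[OF h])+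
qed (use assms in auto)

lemma unit_step_bounds: "0 \<le> unit_step x \<and> unit_step x \<le> 1" "\<bar>unit_step x\<bar> \<le> 1"
  by (auto simp: unit_step_def)

lemma unit_step_mono: "x \<le> y \<Longrightarrow> unit_step x \<le> unit_step y"
  by (auto simp: unit_step_def)

lemma walk_op_unit_step_bounds:
  "0 \<le> (walk_op a ^^ n) unit_step x" "(walk_op a ^^ n) unit_step x \<le> 1"
proof -
  have "(walk_op a ^^ n) (\<lambda>_. 0) x \<le> (walk_op a ^^ n) unit_step x"
    by (rule walk_op_iter_mono[where B=0 and C=1]) (auto simp: unit_step_bounds)
  moreover have "(walk_op a ^^ n) (\<lambda>_. 0) x = 0"
    using walk_op_iter_bounded[of "\<lambda>_. 0" 0 n a x] by simp
  ultimately show "0 \<le> (walk_op a ^^ n) unit_step x" by simp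
  show "(walk_op a ^^ n) unit_step x \<le> 1"
    using walk_op_iter_bounded[of unit_step 1 n a x] unit_step_bounds(2) by simp
qed

lemma walk_op_unit_step_mono:
  assumes "x \<le> y"
  shows "(walk_op a ^^ n) unit_step x \<le> (walk_op a ^^ n) unit_step y"
proof -
  have "(walk_op a ^^ n) unit_step x \<le> (walk_op a ^^ n) (\<lambda>z. unit_step (z + (y - x))) x"
    by (rule walk_op_iter_mono[where B=1 and C=1]) (use assms unit_step_bounds in \<open>auto intro: unit_step_mono\<close>)
  then show ?thesis by (simp add: walk_op_shift)
qed

context centered_step
begin

text \<open>The moment method without the n-step law: a polynomial majorant at time 0 is transported
  exactly by \<open>walk_quartic\<close>, and the inequality survives each integration. Every walk
  estimate below reduces to comparing an indicator with a suitable polynomial.\<close>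

lemma walk_iter_le_quartic:
  assumes h: "\<And>x. \<bar>h x\<bar> \<le> B" and le: "\<And>x. h x \<le> quartic \<alpha> \<beta> \<gamma> \<kappa> 0 x"
  shows "(walk_op a ^^ n) h x \<le> quartic \<alpha> \<beta> \<gamma> \<kappa> n x"
proof (induction n arbitrary: x)
  case (Suc n)
  have "(walk_op a ^^ Suc n) h x \<le> walk_op a (quartic \<alpha> \<beta> \<gamma> \<kappa> n) x"
    unfolding funpow.simps o_apply walk_op_def[of a "(walk_op a ^^ n) h"]
      walk_op_def[of a "quartic \<alpha> \<beta> \<gamma> \<kappa> n"]
    by (intro integral_mono Suc walk_quartic integrable_pmf_bounded[where B=B] walk_op_iter_bounded h)
  then show ?case by (simp only: walk_quartic)
qed (use le in auto)

lemma walk_iter_ge_quartic: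
  assumes h: "\<And>x. \<bar>h x\<bar> \<le> B" and ge: "\<And>x. h x \<ge> quartic \<alpha> \<beta> \<gamma> \<kappa> 0 x"
  shows "(walk_op a ^^ n) h x \<ge> quartic \<alpha> \<beta> \<gamma> \<kappa> n x"
proof (induction n arbitrary: x)
  case (Suc n)
  have "(walk_op a ^^ Suc n) h x \<ge> walk_op a (quartic \<alpha> \<beta> \<gamma> \<kappa> n) x"
    unfolding funpow.simps o_apply walk_op_def[of a "(walk_op a ^^ n) h"]
      walk_op_def[of a "quartic \<alpha> \<beta> \<gamma> \<kappa> n"]
    by (intro integral_mono Suc walk_quartic integrable_pmf_bounded[where B=B] walk_op_iter_bounded h)
  then show ?case by (simp only: walk_quartic)
qed (use ge in auto)

definition walk_c :: real where "walk_c = \<mu>4 + 3 * e\<^sup>2"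

lemma \<mu>4_nonneg: "\<mu>4 \<ge> 0"
  unfolding \<mu>4_def by (rule integral_nonneg_AE) auto

lemma walk_c_pos: "walk_c > 0"
  using \<mu>4_nonneg e_pos by (simp add: walk_c_def add_nonneg_pos)

lemma fourth_moment_le: "real m * \<mu>4 + 3 * real m * (real m - 1) * e\<^sup>2 \<le> walk_c * (real m)\<^sup>2"
proof -
  have "real m \<le> (real m)\<^sup>2" by (cases "m = 0") (auto simp: power2_eq_square)
  then have "real m * \<mu>4 \<le> (real m)\<^sup>2 * \<mu>4" using \<mu>4_nonneg by (intro mult_right_mono) auto
  moreover have "3 * real m * (real m - 1) * e\<^sup>2 \<le> 3 * (real m)\<^sup>2 * e\<^sup>2"
    by (intro mult_right_mono) (auto simp: power2_eq_square algebra_simps)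
  ultimately show ?thesis by (simp add: walk_c_def algebra_simps)
qed

text \<open>Markov's inequality for the fourth power, with (x/t)^4 as the majorant of the
  indicator.\<close>

lemma walk_tail:
  assumes "t > 0"
  shows "(walk_op a ^^ m) unit_step (- t) \<le> walk_c * (real m)\<^sup>2 / t ^ 4"
proof -
  have "(walk_op a ^^ m) unit_step (- t) = (walk_op a ^^ m) (\<lambda>y. unit_step (y + - t)) 0"
    by (simp only: walk_op_shift) simp
  also have "\<dots> \<le> quartic (1 / t ^ 4) 0 0 0 m 0"
  proof (rule walk_iter_le_quartic[where B=1])
    fix x
    show "unit_step (x + - t) \<le> quartic (1 / t ^ 4) 0 0 0 0 x"
    proof (cases "x \<ge> t")
      case True
      then have "t ^ 4 \<le> x ^ 4" using assms by (intro power_mono) auto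
      then show ?thesis using assms by (simp add: quartic_def unit_step_def)
    qed (auto simp: quartic_def unit_step_def)
  qed (rule unit_step_bounds)
  also have "\<dots> \<le> walk_c * (real m)\<^sup>2 / t ^ 4"
    using fourth_moment_le[of m] assms by (simp add: quartic_def divide_right_mono)
  finally show ?thesis .
qed

text \<open>An argument of Paley-Zygmund type, carried out with a single quartic minorant of the
  indicator. The variance and the fourth moment bound the mean of the positive part of S_m / sqrt m
  from below, and a small multiple of the square is subtracted to keep the minorant bounded
  above.\<close>

lemma walk_block_lower:
  "\<exists>\<theta>>0. \<exists>q>0. \<forall>m\<ge>1. q \<le> (walk_op a ^^ m) unit_step (- (\<theta> * sqrt (real m)))"
proof -
  \<comment> \<open>Let t be S_m / sqrt m. K is so large that \<open>walk_c / K ^ 2\<close> is at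
    most e/2; then (t + t^2/K - t^4/K^3)/2, which lies below the positive part of t, has mean at
    least b = e/(4K). B and \<theta> are chosen so that the two losses e/B and \<theta> are b/4
    each, which leaves b/2.\<close>
  define K where "K = 1 + 2 * walk_c / e"
  define b where "b = e / (4 * K)"
  define B where "B = 4 * e / b"
  define \<theta> where "\<theta> = b / 4"
  have K: "K > 0" "walk_c / K ^ 2 \<le> e / 2"
  proof -
    have u: "2 * walk_c / e > 0" using walk_c_pos e_pos by simp
    then show "K > 0" by (simp add: K_def)
    have "w \<le> (1 + w)\<^sup>2" if "w > 0" for w :: real
      using that by (simp add: power2_eq_square algebra_simps)
    then have "2 * walk_c / e \<le> K ^ 2" using u unfolding K_def by blast
    then show "walk_c / K ^ 2 \<le> e / 2" using \<open>K > 0\<close> e_pos by (simp add: field_simps)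
  qed
  have b: "b > 0" using K e_pos by (simp add: b_def)
  have B: "B > 0" using b e_pos by (simp add: B_def)
  have th: "\<theta> > 0" using b by (simp add: \<theta>_def)
  have "b / (2 * B) \<le> (walk_op a ^^ m) unit_step (- (\<theta> * sqrt (real m)))" if m: "m \<ge> 1" for m
  proof -
    define r where "r = sqrt (real m)"
    have r: "r > 0" "r ^ 2 = real m" using m by (auto simp: r_def)
    have r4: "r ^ 4 = (real m)\<^sup>2" using r(2) by (simp add: power2_eq_square power4_eq_xxxx mult.assoc)
    define \<alpha> where "\<alpha> = - 1 / (2 * B * K ^ 3 * r ^ 4)"
    define \<beta> where "\<beta> = (- 1 / B + 1 / (2 * K)) / (B * r ^ 2)"
    define \<gamma> where "\<gamma> = 1 / (2 * B * r)"
    define \<kappa> where "\<kappa> = - \<theta> / B"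
    have q: "quartic \<alpha> \<beta> \<gamma> \<kappa> 0 y = (- \<theta> - (y / r)\<^sup>2 / B + ((y / r) + (y / r)\<^sup>2 / K - (y / r) ^ 4 / K ^ 3) / 2) / B" for y
      using K b B r(1) by (simp add: quartic_def \<alpha>_def \<beta>_def \<gamma>_def \<kappa>_def field_simps power2_eq_square power3_eq_cube power4_eq_xxxx)
    \<comment> \<open>In terms of t = y/r: since t^2/K - t^4/K^3 <= |t|, the polynomial is at most
      (max t 0 - \<theta> - t^2/B)/B. For t < \<theta> this is not positive, and it never exceeds 1
      because t <= t^2/B + B.\<close>
    have min: "quartic \<alpha> \<beta> \<gamma> \<kappa> 0 y \<le> unit_step (y + - (\<theta> * r))" for y
    proof -
      define t where "t = y / r"
      have s: "t\<^sup>2 / K - t ^ 4 / K ^ 3 \<le> \<bar>t\<bar>"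
      proof -
        define w where "w = \<bar>t\<bar> / K"
        have w: "w \<ge> 0" using K by (simp add: w_def)
        have "w ^ 2 - w ^ 4 \<le> w"
        proof (cases "w \<le> 1")
          case True
          have "w\<^sup>2 \<le> w" using True w by (simp add: power2_eq_square mult_left_le)
          moreover have "w ^ 4 \<ge> 0" by simp
          ultimately show ?thesis by linarith
        next
          case False
          then have "w ^ 2 \<le> w ^ 4" by (intro power_increasing) auto
          then show ?thesis using w by linarith
        qed
        then have "K * (w ^ 2 - w ^ 4) \<le> K * w" using K by (intro mult_left_mono) auto
        moreover have "K * w = \<bar>t\<bar>" "K * (w ^ 2 - w ^ 4) = t\<^sup>2 / K - t ^ 4 / K ^ 3"
          using K by (auto simp: w_def power_divide field_simps power2_eq_square power3_eq_cube power4_eq_xxxx)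
        ultimately show ?thesis by simp
      qed
      then have h: "(t + t\<^sup>2 / K - t ^ 4 / K ^ 3) / 2 \<le> max t 0" by (auto simp: max_def)
      have tB: "max t 0 \<le> t\<^sup>2 / B + B"
      proof -
        have "0 \<le> (t - B)\<^sup>2" by simp
        then have "2 * (t * B) \<le> t\<^sup>2 + B * B" by (simp add: power2_eq_square algebra_simps)
        moreover have "t * B \<le> \<bar>t * B\<bar>" by simp
        moreover have "0 \<le> t\<^sup>2 + B * B" by simp
        ultimately have "t * B \<le> t\<^sup>2 + B * B" by linarith
        then have "t \<le> (t\<^sup>2 + B * B) / B" using B by (simp add: pos_le_divide_eq)
        moreover have "(t\<^sup>2 + B * B) / B = t\<^sup>2 / B + B" using B by (simp add: add_divide_distrib)
        moreover have "0 \<le> t\<^sup>2 / B + B" using B by (simp add: add_nonneg_nonneg)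
        ultimately show ?thesis by simp
      qed
      show ?thesis
      proof (cases "y \<ge> \<theta> * r")
        case True
        have "(- \<theta> - t\<^sup>2 / B + (t + t\<^sup>2 / K - t ^ 4 / K ^ 3) / 2) \<le> B"
          using h tB th by linarith
        then have "quartic \<alpha> \<beta> \<gamma> \<kappa> 0 y \<le> 1" unfolding q t_def[symmetric] using B by simp
        then show ?thesis using True by (simp add: unit_step_def)
      next
        case False
        then have "t < \<theta>" using r by (simp add: t_def field_simps)
        then have "max t 0 \<le> \<theta>" using th by simp
        moreover have "t\<^sup>2 / B \<ge> 0" using B by simp
        ultimately have "(- \<theta> - t\<^sup>2 / B + (t + t\<^sup>2 / K - t ^ 4 / K ^ 3) / 2) \<le> 0"
          using h by linarith
        then have "quartic \<alpha> \<beta> \<gamma> \<kappa> 0 y \<le> 0" unfolding q t_def[symmetric] using B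
          by (simp add: divide_nonpos_pos)
        then show ?thesis using unit_step_bounds(1)[of "y + - (\<theta> * r)"] by linarith
      qed
    qed
    have "b / (2 * B) \<le> quartic \<alpha> \<beta> \<gamma> \<kappa> m 0"
    proof -
      have "quartic \<alpha> \<beta> \<gamma> \<kappa> m 0 = \<alpha> * (real m * \<mu>4 + 3 * real m * (real m - 1) * e\<^sup>2) + \<beta> * (real m * e) + \<kappa>"
        by (simp add: quartic_def)
      moreover have "\<alpha> * (real m * \<mu>4 + 3 * real m * (real m - 1) * e\<^sup>2) \<ge> \<alpha> * (walk_c * r ^ 4)"
        unfolding r4 using B K by (intro mult_left_mono_neg fourth_moment_le) (auto simp: \<alpha>_def)
      moreover have "\<alpha> * (walk_c * r ^ 4) = - ((walk_c / K ^ 2) / (2 * K)) / B"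
        using r(1) K B by (simp add: \<alpha>_def field_simps power2_eq_square power3_eq_cube)
      moreover have "- ((e / 2) / (2 * K)) / B \<le> - ((walk_c / K ^ 2) / (2 * K)) / B"
      proof -
        have "(walk_c / K ^ 2) / (2 * K) \<le> (e / 2) / (2 * K)"
          using K by (intro divide_right_mono) auto
        then show ?thesis using B by (intro divide_right_mono) linarith+
      qed
      moreover have "\<beta> * (real m * e) = (- (e / B) + e / (2 * K)) / B"
      proof -
        have "X / (B * r\<^sup>2) * (r\<^sup>2 * e) = X * e / B" for X using r(1) B by simp
        moreover have "(- 1 / B + 1 / (2 * K)) * e = - (e / B) + e / (2 * K)" by (simp add: algebra_simps)
        ultimately show ?thesis unfolding r(2)[symmetric] \<beta>_def by metis
      qed
      moreover have "- ((e / 2) / (2 * K)) / B + (- (e / B) + e / (2 * K)) / B + \<kappa> = b / (2 * B)"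
      proof -
        have 1: "e / B = b / 4" using e_pos b by (simp add: B_def)
        have 2: "e / (2 * K) = 2 * b" "(e / 2) / (2 * K) = b" using K by (auto simp: b_def)
        show ?thesis unfolding 1 2 \<kappa>_def \<theta>_def using B by (simp add: field_simps)
      qed
      ultimately show ?thesis by linarith
    qed
    also have "\<dots> \<le> (walk_op a ^^ m) (\<lambda>y. unit_step (y + - (\<theta> * r))) 0"
      by (rule walk_iter_ge_quartic[where B=1]) (use min unit_step_bounds in auto)
    also have "\<dots> = (walk_op a ^^ m) unit_step (- (\<theta> * sqrt (real m)))"
      unfolding walk_op_shift r_def by simp
    finally show ?thesis .
  qed
  then show ?thesis using th b B by (intro exI[of _ \<theta>] conjI exI[of _ "b / (2 * B)"]) auto
qed

text \<open>Climbing s in i steps and then t in j further steps is one way of climbing s + t;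
  composition of the iterates plays the part of the Markov property.\<close>

lemma walk_superadd:
  "(walk_op a ^^ (i + j)) unit_step (- (s + t))
    \<ge> (walk_op a ^^ i) unit_step (- s) * (walk_op a ^^ j) unit_step (- t)"
proof -
  let ?q = "(walk_op a ^^ j) unit_step (- t)"
  have le: "?q * unit_step (y + t) \<le> (walk_op a ^^ j) unit_step y" for y
  proof (cases "y + t \<ge> 0")
    case True
    then show ?thesis using walk_op_unit_step_mono[of "- t" y] by (simp add: unit_step_def)
  qed (simp add: unit_step_def walk_op_unit_step_bounds)
  have "?q * (walk_op a ^^ i) unit_step (- s) = (walk_op a ^^ i) (\<lambda>y. ?q * unit_step (y + t)) (- (s + t))"
    unfolding walk_op_cmult walk_op_shift by simp
  also have "\<dots> \<le> (walk_op a ^^ i) ((walk_op a ^^ j) unit_step) (- (s + t))"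
  proof (rule walk_op_iter_mono[where B=1 and C=1])
    fix x
    show "\<bar>?q * unit_step (x + t)\<bar> \<le> 1"
      using walk_op_unit_step_bounds[of j a "- t"] unit_step_bounds(1)[of "x + t"]
      by (auto simp: abs_mult intro!: mult_le_one)
    show "\<bar>(walk_op a ^^ j) unit_step x\<bar> \<le> 1"
      using walk_op_unit_step_bounds[of j a x] by auto
  qed (rule le)
  finally show ?thesis by (simp add: funpow_add mult.commute)
qed

lemma walk_lower:
  "\<exists>q>0. \<exists>n0. \<forall>n\<ge>n0. q \<le> (walk_op a ^^ n) unit_step (- (x * sqrt (real n)))"
proof -
  obtain \<theta> q where th: "\<theta> > 0" and q: "q > 0"
    and blk: "\<And>m. m \<ge> 1 \<Longrightarrow> q \<le> (walk_op a ^^ m) unit_step (- (\<theta> * sqrt (real m)))"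
    using walk_block_lower by blast
  \<comment> \<open>The remainder r of the division of n into blocks is absorbed by one block of
    length m + r, for which \<open>blk\<close> even yields a higher level.\<close>
  have step: "q ^ Suc j \<le> (walk_op a ^^ (j * m + (m + r))) unit_step (- (real (Suc j) * (\<theta> * sqrt (real m))))"
    if m: "m \<ge> 1" for j m r
  proof (induction j)
    case 0
    have "q \<le> (walk_op a ^^ (m + r)) unit_step (- (\<theta> * sqrt (real (m + r))))"
      using m by (intro blk) auto
    also have "\<dots> \<le> (walk_op a ^^ (m + r)) unit_step (- (\<theta> * sqrt (real m)))"
      using th by (intro walk_op_unit_step_mono) auto
    finally show ?case by simp
  next
    case (Suc j)
    let ?A = "(walk_op a ^^ m) unit_step (- (\<theta> * sqrt (real m)))"
    let ?B = "(walk_op a ^^ (j * m + (m + r))) unit_step (- (real (Suc j) * (\<theta> * sqrt (real m))))"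
    have "q ^ Suc (Suc j) = q * q ^ Suc j" by simp
    also have "\<dots> \<le> ?A * ?B"
      by (intro mult_mono blk m Suc) (use q in \<open>auto intro: walk_op_unit_step_bounds\<close>)
    also have "\<dots> \<le> (walk_op a ^^ (m + (j * m + (m + r)))) unit_step
        (- (\<theta> * sqrt (real m) + real (Suc j) * (\<theta> * sqrt (real m))))"
      by (rule walk_superadd)
    also have "m + (j * m + (m + r)) = Suc j * m + (m + r)" by simp
    also have "\<theta> * sqrt (real m) + real (Suc j) * (\<theta> * sqrt (real m)) = real (Suc (Suc j)) * (\<theta> * sqrt (real m))"
      by (simp add: algebra_simps)
    finally show ?case .
  qed
  \<comment> \<open>With k blocks of length m = n div k one has n <= 2 k m, so k climbs of height
    \<theta> sqrt m reach x sqrt n as soon as 2 x^2 <= k \<theta>^2. The number of blocks thus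
    depends on x only, and so does the bound \<open>q ^ k\<close>.\<close>
  obtain j :: nat where j: "real j \<ge> 2 * x\<^sup>2 / \<theta>\<^sup>2" using real_arch_simple by blast
  define k where "k = Suc j"
  have k: "2 * x\<^sup>2 \<le> real k * \<theta>\<^sup>2" using j th by (simp add: k_def field_simps add_increasing)
  have "q ^ k \<le> (walk_op a ^^ n) unit_step (- (x * sqrt (real n)))" if n: "n \<ge> k" for n
  proof -
    define m where "m = n div k"
    define r where "r = n mod k"
    have m: "m \<ge> 1" using n by (simp add: m_def k_def div_greater_zero_iff Suc_le_eq)
    have nk: "n = j * m + (m + r)" using mult_div_mod_eq[of k n] by (simp add: m_def r_def k_def algebra_simps)
    have "r < k" by (simp add: r_def k_def)
    then have "r \<le> k * m" using m by (metis le_trans less_imp_le mult.right_neutral mult_le_mono2)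
    moreover have "n = k * m + r" using nk by (simp add: k_def)
    ultimately have n2: "real n \<le> 2 * real k * real m"
      by (metis add_left_mono mult.assoc mult_2 of_nat_le_iff of_nat_mult of_nat_numeral)
    have "(x * sqrt (real n))\<^sup>2 \<le> (real k * (\<theta> * sqrt (real m)))\<^sup>2"
    proof -
      have "(x * sqrt (real n))\<^sup>2 = x\<^sup>2 * real n" by (simp add: power_mult_distrib)
      also have "\<dots> \<le> x\<^sup>2 * (2 * real k * real m)" using n2 by (intro mult_left_mono) auto
      also have "\<dots> = (2 * x\<^sup>2) * (real k * real m)" by simp
      also have "\<dots> \<le> (real k * \<theta>\<^sup>2) * (real k * real m)" using k by (intro mult_right_mono) auto
      also have "\<dots> = (real k * (\<theta> * sqrt (real m)))\<^sup>2" by (simp add: power_mult_distrib power2_eq_square)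
      finally show ?thesis .
    qed
    then have le: "x * sqrt (real n) \<le> real k * (\<theta> * sqrt (real m))"
      by (rule power2_le_imp_le) (use th in auto)
    have "q ^ k \<le> (walk_op a ^^ n) unit_step (- (real k * (\<theta> * sqrt (real m))))"
      using step[OF m, of j r] unfolding nk[symmetric] k_def .
    also have "\<dots> \<le> (walk_op a ^^ n) unit_step (- (x * sqrt (real n)))"
      using le by (intro walk_op_unit_step_mono) auto
    finally show ?thesis .
  qed
  then show ?thesis using q by (intro exI[of _ "q ^ k"]) auto
qed

lemma reflected: "centered_step (map_pmf uminus a) e"
proof
  show "integrable (measure_pmf (map_pmf uminus a)) (\<lambda>d. real_of_int d ^ 4)"
    using fourth_moment by simp
  show m: "measure_pmf.expectation (map_pmf uminus a) real_of_int = 0"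
    using mean_zero by simp
  show "measure_pmf.variance (map_pmf uminus a) real_of_int = e"
    using step_variance unfolding m mean_zero by simp
qed (rule e_pos)

end

lemma brw_op_reflect:
  "(brw_op (map_pmf uminus a) p N ^^ n) (\<lambda>y. g (- y)) = (\<lambda>x. (brw_op a p N ^^ n) g (- x))"
proof (induction n)
  case (Suc n)
  then show ?case by (simp add: fun_eq_iff brw_op_def)
qed simp

section \<open>Tail bounds for the rightmost particle\<close>

locale branching_walk = critical_offspring p v + centered_step a e
  for p :: "nat pmf" and v :: real and a :: "int pmf" and e :: real
begin

lemma brw_iter_le_walk_iter:
  assumes g: "\<And>x. 0 \<le> g x \<and> g x \<le> 1"
  shows "(brw_op a p 1 ^^ n) g x \<le> (walk_op a ^^ n) g x"
proof (induction n arbitrary: x)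
  case (Suc n)
  let ?g = "(brw_op a p 1 ^^ n) g"
  have r: "0 \<le> ?g x \<and> ?g x \<le> 1" for x using brw_op_iter_range[of 1 g 1] g by auto
  have "(brw_op a p 1 ^^ Suc n) g x \<le> walk_op a ?g x"
    using brw_op_le_walk[of ?g a x] r by simp
  also have "\<dots> \<le> walk_op a ((walk_op a ^^ n) g) x"
    using walk_op_iter_mono[of ?g 1 "(walk_op a ^^ n) g" 1 1 a x] r Suc
      walk_op_iter_bounded[of g 1 n a] g by simp
  finally show ?case by simp
qed simp

text \<open>Chosen so that the induction in \<open>brw_tail\<close> closes. Halving the time and
  lowering the level to 9z/10 reproduces the bound with the factor (10/9)^4 / 2 < 4/5; the remaining
  fifth pays for the new term with constant \<open>20000 * walk_c / p2\<close>. The summand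
  \<open>walk_c\<close> makes m = 1 immediate.\<close>

definition tail_const :: real where
  "tail_const = 100000 * walk_c / p2 + walk_c"

lemma tail_const_pos: "tail_const > 0"
  using walk_c_pos p2_pos by (simp add: tail_const_def add_pos_pos)

text \<open>The first-moment bound has m^2 where this has m; the gain comes from survival. A
  particle at height z in generation m either descends from a particle above z/10 at about half time
  that still has descendants, which costs the walk tail times a survival probability of order 1/m,
  or some line climbs 9z/10 in the remaining half, which is the induction hypothesis.\<close>

lemma brw_tail:
  assumes "z > 0"
  shows "(brw_op a p 1 ^^ m) unit_step (- z) \<le> tail_const * real m / z ^ 4"
  using assms
proof (induction m arbitrary: z rule: less_induct)
  case (less m)
  note z = less.prems
  let ?T = "brw_op a p 1"
  consider "m = 0" | "m = 1" | "m \<ge> 2" by linarith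
  then show ?case
  proof cases
    case 1
    then show ?thesis using z by (simp add: unit_step_def)
  next
    case 2
    have "(?T ^^ m) unit_step (- z) \<le> walk_c * (real m)\<^sup>2 / z ^ 4"
      using brw_iter_le_walk_iter[of unit_step m "- z"] walk_tail[OF z, of m] unit_step_bounds by force
    also have "\<dots> \<le> tail_const * real m / z ^ 4"
      using 2 walk_c_pos p2_pos by (intro divide_right_mono) (auto simp: tail_const_def)
    finally show ?thesis .
  next
    case 3
    \<comment> \<open>The inner i iterations are the last i generations of the population. Their
      function W is bounded by s, the chance to survive them, and below the level -9z/10 by the
      small constant k, which passes through the outer j iterations unchanged by
      contraction.\<close>
    define i where "i = m div 2"
    define j where "j = m - i"
    have ij: "i \<ge> 1" "i < m" "j \<le> 2 * i" "m = j + i" "2 * i \<le> m" "j \<le> m"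
      using 3 by (auto simp: i_def j_def)
    define W where "W = (?T ^^ i) unit_step"
    define s where "s = surv p i"
    have s: "0 < s" "s \<le> 1" using surv_pos_le[of i] by (auto simp: s_def)
    have W: "0 \<le> W y" "W y \<le> s" for y
    proof -
      show "0 \<le> W y" using brw_op_iter_range[of 1 unit_step 1 i a y] unit_step_bounds by (simp add: W_def)
      have "W y \<le> (?T ^^ i) (\<lambda>_. 1) y" unfolding W_def
        by (intro brw_op_iter_mono) (use unit_step_bounds in auto)
      then show "W y \<le> s" by (simp add: brw_op_iter_one s_def)
    qed
    have Wm: "W x \<le> W y" if "x \<le> y" for x y
      unfolding W_def by (intro brw_op_iter_monotone) (use that unit_step_bounds in \<open>auto intro: unit_step_mono\<close>)
    define k where "k = W (- (9 / 10 * z))"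
    have k: "0 \<le> k" "k \<le> tail_const * real i / (9 / 10 * z) ^ 4"
      using W less.IH[of i "9 / 10 * z"] z ij by (auto simp: k_def W_def)
    have le: "W y \<le> s * unit_step (y + 9 / 10 * z) + k" for y
    proof (cases "y + 9 / 10 * z \<ge> 0")
      case True
      then show ?thesis using W[of y] k by (simp add: unit_step_def)
    next
      case False
      then show ?thesis using Wm[of y "- (9 / 10 * z)"] by (simp add: unit_step_def k_def)
    qed
    have ru: "0 \<le> s * unit_step y \<and> s * unit_step y \<le> 1" for y
      using s unit_step_bounds(1)[of y] by (auto intro!: mult_le_one)
    have "(?T ^^ m) unit_step (- z) = (?T ^^ j) W (- z)"
      by (simp add: ij(4) funpow_add W_def)
    also have "\<dots> \<le> (?T ^^ j) (\<lambda>y. s * unit_step (y + 9 / 10 * z)) (- z) + k"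
    proof (rule brw_op_iter_mono_add)
      show "0 \<le> W x \<and> W x \<le> 1" for x using W[of x] s by auto
    qed (use ru k le in auto)
    also have "(?T ^^ j) (\<lambda>y. s * unit_step (y + 9 / 10 * z)) (- z) \<le>
        (walk_op a ^^ j) (\<lambda>y. s * unit_step (y + 9 / 10 * z)) (- z)"
      by (rule brw_iter_le_walk_iter) (rule ru)
    also have "\<dots> = s * (walk_op a ^^ j) unit_step (- (z / 10))"
      unfolding walk_op_cmult walk_op_shift by simp
    also have "\<dots> \<le> s * (walk_c * (real j)\<^sup>2 / (z / 10) ^ 4)"
      using walk_tail[of "z / 10" j] z s by (intro mult_left_mono) auto
    also have "\<dots> \<le> (20000 * walk_c / p2) * real m / z ^ 4"
    proof -
      have "s \<le> 1 / (1 + p2 * real i)" unfolding s_def by (rule surv_upper)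
      also have "\<dots> \<le> 1 / (p2 * real i)" using p2_pos ij by (intro divide_left_mono) (auto intro!: mult_pos_pos add_pos_nonneg)
      finally have "s * (real j)\<^sup>2 \<le> 1 / (p2 * real i) * (real j)\<^sup>2" by (intro mult_right_mono) auto
      also have "\<dots> \<le> 1 / (p2 * real i) * (2 * real i * real m)"
      proof -
        have "real j \<le> 2 * real i" "real j \<le> real m" using ij by linarith+
        then have "(real j)\<^sup>2 \<le> 2 * real i * real m"
          unfolding power2_eq_square by (intro mult_mono) auto
        then show ?thesis using p2_pos by (intro mult_left_mono) auto
      qed
      also have "\<dots> = 2 * real m / p2" using ij p2_pos by (simp add: field_simps)
      finally have "walk_c * 10000 / z ^ 4 * (s * (real j)\<^sup>2) \<le> walk_c * 10000 / z ^ 4 * (2 * real m / p2)"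
        using walk_c_pos z by (intro mult_left_mono) auto
      then show ?thesis using z by (simp add: field_simps)
    qed
    also have "k \<le> (4 / 5 * tail_const) * real m / z ^ 4"
    proof -
      have "tail_const * real i / (9 / 10 * z) ^ 4 \<le> (4 / 5 * tail_const) * real m / z ^ 4"
      proof -
        have "tail_const * real i / (9 / 10 * z) ^ 4 = (tail_const * real i * 10000 / 6561) / z ^ 4"
          by (simp add: power_divide power_mult_distrib)
        also have "\<dots> \<le> (tail_const * (real m / 2) * 10000 / 6561) / z ^ 4"
          using ij tail_const_pos z by (intro divide_right_mono mult_right_mono mult_left_mono) auto
        also have "\<dots> \<le> (4 / 5 * tail_const) * real m / z ^ 4"
          using tail_const_pos z by (intro divide_right_mono) auto
        finally show ?thesis .
      qed
      then show ?thesis using k by linarith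
    qed
    also have "(20000 * walk_c / p2) * real m / z ^ 4 + (4 / 5 * tail_const) * real m / z ^ 4
      = (20000 * walk_c / p2 + 4 / 5 * tail_const) * real m / z ^ 4"
      by (simp add: add_divide_distrib ring_distribs)
    also have "\<dots> \<le> tail_const * real m / z ^ 4"
    proof (intro divide_right_mono mult_right_mono)
      have "20000 * walk_c / p2 = 20000 * (walk_c / p2)" "tail_const = 100000 * (walk_c / p2) + walk_c"
        by (simp_all add: tail_const_def)
      then show "20000 * walk_c / p2 + 4 / 5 * tail_const \<le> tail_const"
        using walk_c_pos by linarith
    qed auto
    finally show ?thesis by simp
  qed
qed

lemma reflected_branching_walk: "branching_walk p v (map_pmf uminus a) e"
  by (intro branching_walk.intro reflected critical_offspring_axioms)

lemma brw_tail_left: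
  "\<exists>K>0. \<forall>z>0. \<forall>m. (brw_op a p 1 ^^ m) (\<lambda>y. if y \<le> 0 then 1 else 0) z \<le> K * real m / z ^ 4"
proof -
  interpret R: branching_walk p v "map_pmf uminus a" e by (rule reflected_branching_walk)
  have "(brw_op a p 1 ^^ m) (\<lambda>y. if y \<le> 0 then 1 else 0) z \<le> R.tail_const * real m / z ^ 4"
    if z: "z > 0" for z m
  proof -
    have "unit_step = (\<lambda>y. if - y \<le> 0 then 1 else 0)" by (auto simp: unit_step_def)
    then have "(brw_op (map_pmf uminus a) p 1 ^^ m) unit_step (- z)
      = (brw_op a p 1 ^^ m) (\<lambda>y. if y \<le> 0 then 1 else 0) z"
      using fun_cong[OF brw_op_reflect[where g="\<lambda>y. if y \<le> 0 then 1 else 0"], of m a p 1 "- z"]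
      by simp
    then show ?thesis using R.brw_tail[OF z, of m] by simp
  qed
  then show ?thesis using R.tail_const_pos by blast
qed

text \<open>Lowering the initial indicator to height \<theta> of order 1/n makes the branching
  operator nearly linear over the whole time span, so that the random-walk probability is lost only
  up to a constant factor and the factor \<theta>.\<close>

lemma brw_lower:
  "\<exists>q>0. \<exists>n0\<ge>1. \<forall>n\<ge>n0. q / real n \<le> (brw_op a p 1 ^^ n) unit_step (- (x * sqrt (real n)))"
proof -
  obtain q n0 where q: "q > 0" and n0: "\<And>n. n \<ge> n0 \<Longrightarrow> q \<le> (walk_op a ^^ n) unit_step (- (x * sqrt (real n)))"
    using walk_lower by blast
  obtain n1 :: nat where n1: "real n1 \<ge> 1 / v" using real_arch_simple by blast
  let ?T = "brw_op a p 1"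
  have "q / (2 * v) / real n \<le> (?T ^^ n) unit_step (- (x * sqrt (real n)))" if n: "n \<ge> n0 + n1 + 1" for n
  proof -
    \<comment> \<open>With this height each generation costs a factor c = 1 - 1/(2n), and
      \<open>c ^ n\<close> is at least 1/2 by Bernoulli's inequality.\<close>
    define \<theta> where "\<theta> = 1 / (v * real n)"
    have n': "real n \<ge> 1" "real n \<ge> 1 / v" using n n1 by auto
    have th: "0 < \<theta>" "\<theta> \<le> 1" using n' v_pos by (auto simp: \<theta>_def field_simps)
    define c where "c = 1 - v * \<theta> / 2"
    have c: "c = 1 - 1 / (2 * real n)" using v_pos n' by (simp add: c_def \<theta>_def)
    have c0: "c \<ge> 0" using n' by (simp add: c field_simps)
    have cn: "c ^ n \<ge> 1 / 2"
    proof -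
      have "1 + real n * (- (1 / (2 * real n))) \<le> (1 + (- (1 / (2 * real n)))) ^ n"
        using n' by (intro Bernoulli_inequality) (simp add: field_simps)
      then show ?thesis using n' by (simp add: c)
    qed
    define h where "h y = \<theta> * unit_step y" for y
    have h: "0 \<le> h y \<and> h y \<le> \<theta>" for y using th unit_step_bounds(1)[of y] by (auto simp: h_def mult_left_le)
    have it: "c ^ i * (walk_op a ^^ i) h y \<le> (?T ^^ i) h y" for i y
    proof (induction i arbitrary: y)
      case (Suc i)
      have r: "0 \<le> (?T ^^ i) h y \<and> (?T ^^ i) h y \<le> \<theta>" for y
        using brw_op_iter_range[of 1 h \<theta>] h th by auto
      have "c ^ Suc i * (walk_op a ^^ Suc i) h y = c * walk_op a (\<lambda>y. c ^ i * (walk_op a ^^ i) h y) y"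
        using walk_op_cmult[of 1 a "c ^ i" "(walk_op a ^^ i) h"] by (simp add: fun_eq_iff)
      also have "\<dots> \<le> c * walk_op a ((?T ^^ i) h) y"
      proof (intro mult_left_mono c0)
        have b: "\<bar>(walk_op a ^^ i) h y\<bar> \<le> \<theta>" for y using walk_op_iter_bounded[of h \<theta> i a y] h by simp
        show "walk_op a (\<lambda>y. c ^ i * (walk_op a ^^ i) h y) y \<le> walk_op a ((?T ^^ i) h) y"
          using walk_op_iter_mono[of "\<lambda>y. c ^ i * (walk_op a ^^ i) h y" "c ^ i * \<theta>" "(?T ^^ i) h" \<theta> 1 a y] b r Suc c0
          by (simp add: abs_mult mult_left_mono)
      qed
      also have "\<dots> \<le> (?T ^^ Suc i) h y"
        using brw_op_ge_walk[of "(?T ^^ i) h" \<theta> a y] r th by (simp add: c_def)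
      finally show ?case .
    qed simp
    have "q / (2 * v) / real n = 1 / 2 * (\<theta> * q)" by (simp add: \<theta>_def)
    also have "\<dots> \<le> c ^ n * (\<theta> * (walk_op a ^^ n) unit_step (- (x * sqrt (real n))))"
      using cn n0[of n] n th q by (intro mult_mono) auto
    also have "\<dots> = c ^ n * (walk_op a ^^ n) h (- (x * sqrt (real n)))"
      unfolding h_def walk_op_cmult by simp
    also have "\<dots> \<le> (?T ^^ n) h (- (x * sqrt (real n)))" by (rule it)
    also have "\<dots> \<le> (?T ^^ n) unit_step (- (x * sqrt (real n)))"
    proof (intro brw_op_iter_mono)
      show "0 \<le> h y \<and> h y \<le> 1" for y using h[of y] th by auto
    qed (use th unit_step_bounds in \<open>auto simp: h_def mult_left_le_one_le\<close>)
    finally show ?thesis .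
  qed
  then show ?thesis using q v_pos by (intro exI[of _ "q / (2 * v)"] conjI exI[of _ "n0 + n1 + 1"]) auto
qed

end

section \<open>A deterministic reference scheme\<close>

lemma taylor_bound:
  fixes g :: "nat \<Rightarrow> real \<Rightarrow> real"
  assumes d: "\<And>i t. i < n \<Longrightarrow> (g i has_real_derivative g (Suc i) t) (at t)"
    and b: "\<And>t. \<bar>g n t\<bar> \<le> B"
  shows "\<bar>g 0 (x + y) - (\<Sum>i<n. g i x / fact i * y ^ i)\<bar> \<le> B / fact n * \<bar>y\<bar> ^ n"
proof -
  have "\<exists>t. \<bar>t\<bar> \<le> \<bar>y\<bar> \<and> g 0 (x + y) = (\<Sum>i<n. (\<lambda>t. g i (x + t)) 0 / fact i * y ^ i) + (\<lambda>t. g n (x + t)) t / fact n * y ^ n"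
  proof (rule Maclaurin_bi_le[where diff="\<lambda>i t. g i (x + t)" and f="\<lambda>t. g 0 (x + t)"])
    show "\<forall>m t. m < n \<and> \<bar>t\<bar> \<le> \<bar>y\<bar> \<longrightarrow> ((\<lambda>t. g m (x + t)) has_real_derivative g (Suc m) (x + t)) (at t)"
    proof (intro allI impI)
      fix m t assume "m < n \<and> \<bar>t\<bar> \<le> \<bar>y\<bar>"
      then have "((\<lambda>t. g m (x + t)) has_real_derivative g (Suc m) (x + t) * 1) (at t)"
        by (intro DERIV_chain2[OF d]) (auto intro!: derivative_eq_intros)
      then show "((\<lambda>t. g m (x + t)) has_real_derivative g (Suc m) (x + t)) (at t)" by simp
    qed
  qed simp
  then obtain t where "g 0 (x + y) = (\<Sum>i<n. g i x / fact i * y ^ i) + g n (x + t) / fact n * y ^ n"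
    by auto
  then have "\<bar>g 0 (x + y) - (\<Sum>i<n. g i x / fact i * y ^ i)\<bar> = \<bar>g n (x + t)\<bar> / fact n * \<bar>y\<bar> ^ n"
    by (simp add: abs_mult power_abs)
  also have "\<dots> \<le> B / fact n * \<bar>y\<bar> ^ n"
    by (intro mult_right_mono divide_right_mono b) auto
  finally show ?thesis .
qed

lemma avg_abs_bound:
  fixes P Q A b c :: real
  assumes "\<bar>P - (A + b)\<bar> \<le> c" "\<bar>Q - (A - b)\<bar> \<le> c"
  shows "\<bar>(P + Q) / 2 - A\<bar> \<le> c"
proof -
  have "\<bar>P + Q - 2 * A\<bar> \<le> 2 * c" using assms by linarith
  moreover have "(P + Q) / 2 - A = (P + Q - 2 * A) / 2" by simp
  ultimately show ?thesis by (simp only: abs_divide) simp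
qed

definition sym_avg :: "real \<Rightarrow> (real \<Rightarrow> real) \<Rightarrow> real \<Rightarrow> real" where
  "sym_avg s f x = (f (x + s) + f (x - s)) / 2"

lemma sym_avg_has_derivative:
  assumes "\<And>y. (f has_real_derivative f' y) (at y)"
  shows "(sym_avg s f has_real_derivative sym_avg s f' x) (at x)"
  unfolding sym_avg_def by (auto intro!: derivative_eq_intros DERIV_chain2[OF assms])

lemma sym_avg_abs_le:
  assumes "\<And>y. \<bar>f y\<bar> \<le> B"
  shows "\<bar>sym_avg s f x\<bar> \<le> B"
proof -
  have "\<bar>f (x + s) + f (x - s)\<bar> \<le> 2 * B"
    using assms[of "x + s"] assms[of "x - s"] by linarith
  then show ?thesis by (simp add: sym_avg_def)
qed

lemma sym_avg_taylor2:
  assumes "\<And>t. (f has_real_derivative f1 t) (at t)" "\<And>t. (f1 has_real_derivative f2 t) (at t)"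
    and "\<And>t. \<bar>f2 t\<bar> \<le> B"
  shows "\<bar>sym_avg s f x - f x\<bar> \<le> B / 2 * s\<^sup>2"
proof -
  define g where "g i = (if i = 0 then f else if i = 1 then f1 else f2)" for i :: nat
  have g: "g 0 = f" "g 1 = f1" "g 2 = f2" by (auto simp: g_def)
  have d: "(g i has_real_derivative g (Suc i) t) (at t)" if "i < 2" for i t
    using that assms by (auto simp: g_def)
  have "\<bar>g 0 (x + y) - (\<Sum>i<2. g i x / fact i * y ^ i)\<bar> \<le> B / fact 2 * \<bar>y\<bar> ^ 2" for y
    by (rule taylor_bound) (use d assms(3) in \<open>auto simp: g\<close>)
  then have "\<bar>f (x + y) - (f x + f1 x * y)\<bar> \<le> B / 2 * y\<^sup>2" for y
    by (simp add: numeral_2_eq_2 g g(2)[unfolded One_nat_def])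
  from this[of s] this[of "- s"]
  have "\<bar>f (x + s) - (f x + f1 x * s)\<bar> \<le> B / 2 * s\<^sup>2" "\<bar>f (x - s) - (f x - f1 x * s)\<bar> \<le> B / 2 * s\<^sup>2"
    by simp_all
  then show ?thesis unfolding sym_avg_def by (rule avg_abs_bound)
qed

lemma sym_avg_taylor4:
  assumes d: "\<And>i t. i < 4 \<Longrightarrow> (g i has_real_derivative g (Suc i) t) (at t)"
    and b: "\<And>t. \<bar>g 4 t\<bar> \<le> B"
  shows "\<bar>sym_avg s (g 0) x - g 0 x - s\<^sup>2 / 2 * g 2 x\<bar> \<le> B / 24 * s ^ 4"
proof -
  have "\<bar>g 0 (x + y) - (\<Sum>i<4. g i x / fact i * y ^ i)\<bar> \<le> B / fact 4 * \<bar>y\<bar> ^ 4" for y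
    by (rule taylor_bound) (use d b in auto)
  moreover have "(\<Sum>i<4. g i x / fact i * y ^ i) = g 0 x + g 1 x * y + g 2 x / 2 * y\<^sup>2 + g 3 x / 6 * y ^ 3" for y
    by (simp add: eval_nat_numeral)
  moreover have "fact 4 = (24 :: real)" by (simp add: fact_numeral)
  ultimately have t: "\<bar>g 0 (x + y) - (g 0 x + g 1 x * y + g 2 x / 2 * y\<^sup>2 + g 3 x / 6 * y ^ 3)\<bar> \<le> B / 24 * y ^ 4" for y
    by simp
  have "\<bar>g 0 (x + s) - ((g 0 x + s\<^sup>2 / 2 * g 2 x) + (g 1 x * s + g 3 x / 6 * s ^ 3))\<bar> \<le> B / 24 * s ^ 4"
    using t[of s] by (simp add: algebra_simps)
  moreover have "\<bar>g 0 (x - s) - ((g 0 x + s\<^sup>2 / 2 * g 2 x) - (g 1 x * s + g 3 x / 6 * s ^ 3))\<bar> \<le> B / 24 * s ^ 4"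
    using t[of "- s"] by (simp add: algebra_simps)
  ultimately have "\<bar>(g 0 (x + s) + g 0 (x - s)) / 2 - (g 0 x + s\<^sup>2 / 2 * g 2 x)\<bar> \<le> B / 24 * s ^ 4"
    by (rule avg_abs_bound)
  then show ?thesis unfolding sym_avg_def by (simp only: diff_diff_eq)
qed

section \<open>The reference scheme and the growth of its derivatives\<close>

definition react :: "real \<Rightarrow> real \<Rightarrow> real \<Rightarrow> real" where
  "react v h u = u - v * h / 2 * u\<^sup>2"

text \<open>The step of length h of an explicit scheme for the limiting equation. It has the shape
  of \<open>brw_op\<close> with a fair coin flip of variance e h as displacement and the exact
  quadratic in place of \<open>gen_compl\<close>.\<close>

definition ref_op :: "real \<Rightarrow> real \<Rightarrow> real \<Rightarrow> (real \<Rightarrow> real) \<Rightarrow> real \<Rightarrow> real" where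
  "ref_op v e h g = sym_avg (sqrt (e * h)) (\<lambda>y. react v h (g y))"

text \<open>A function together with its derivatives: \<open>g i\<close> is the i-th derivative of
  \<open>g 0\<close>. Carrying the whole tower lets each step of the scheme produce explicit
  derivatives with explicit bounds. Order four is what the error of a symmetric average
  requires.\<close>

definition smooth4 :: "(nat \<Rightarrow> real) \<Rightarrow> (nat \<Rightarrow> real \<Rightarrow> real) \<Rightarrow> bool" where
  "smooth4 b g \<longleftrightarrow> (\<forall>i<4. \<forall>x. (g i has_real_derivative g (Suc i) x) (at x))
     \<and> (\<forall>i\<le>4. \<forall>x. \<bar>g i x\<bar> \<le> b i) \<and> (\<forall>x. 0 \<le> g 0 x)"

lemma smooth4D:
  assumes "smooth4 b g"
  shows "i < 4 \<Longrightarrow> (g i has_real_derivative g (Suc i) x) (at x)"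
    and "i \<le> 4 \<Longrightarrow> \<bar>g i x\<bar> \<le> b i" and "0 \<le> g 0 x" and "g 0 x \<le> b 0" and "i \<le> 4 \<Longrightarrow> 0 \<le> b i"
proof -
  show "i < 4 \<Longrightarrow> (g i has_real_derivative g (Suc i) x) (at x)" "0 \<le> g 0 x" 
    using assms by (auto simp: smooth4_def)
  show b: "i \<le> 4 \<Longrightarrow> \<bar>g i x\<bar> \<le> b i" for i using assms by (auto simp: smooth4_def)
  show "g 0 x \<le> b 0" using b[of 0] by auto
  show "i \<le> 4 \<Longrightarrow> 0 \<le> b i" using b[of i] by auto
qed

lemma smooth4_mono:
  assumes "smooth4 b g" "\<And>i. i \<le> 4 \<Longrightarrow> b i \<le> c i"
  shows "smooth4 c g"
  using assms unfolding smooth4_def by (meson order_trans)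

definition react_derivs :: "real \<Rightarrow> real \<Rightarrow> (nat \<Rightarrow> real \<Rightarrow> real) \<Rightarrow> nat \<Rightarrow> real \<Rightarrow> real" where
  "react_derivs v h g i x =
     (if i = 0 then react v h (g 0 x)
      else if i = 1 then g 1 x * (1 - v * h * g 0 x)
      else if i = 2 then g 2 x * (1 - v * h * g 0 x) - v * h * (g 1 x)\<^sup>2
      else if i = 3 then g 3 x * (1 - v * h * g 0 x) - 3 * v * h * (g 1 x * g 2 x)
      else g 4 x * (1 - v * h * g 0 x) - v * h * (4 * (g 1 x * g 3 x) + 3 * (g 2 x)\<^sup>2))"

lemma react_derivs_has_derivative:
  assumes "smooth4 b g" "i < 4"
  shows "(react_derivs v h g i has_real_derivative react_derivs v h g (Suc i) x) (at x)"
proof -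
  define G0 G1 G2 G3 G4 where G: "G0 = g 0" "G1 = g 1" "G2 = g 2" "G3 = g 3" "G4 = g 4"
  have d: "(G0 has_real_derivative G1 x) (at x)" "(G1 has_real_derivative G2 x) (at x)"
    "(G2 has_real_derivative G3 x) (at x)" "(G3 has_real_derivative G4 x) (at x)"
    using smooth4D(1)[OF assms(1), of 0 x] smooth4D(1)[OF assms(1), of 1 x]
      smooth4D(1)[OF assms(1), of 2 x] smooth4D(1)[OF assms(1), of 3 x]
    by (simp_all add: G eval_nat_numeral)
  have r: "react_derivs v h g 0 = (\<lambda>x. G0 x - v * h / 2 * (G0 x)\<^sup>2)"
    "react_derivs v h g 1 = (\<lambda>x. G1 x * (1 - v * h * G0 x))"
    "react_derivs v h g 2 = (\<lambda>x. G2 x * (1 - v * h * G0 x) - v * h * (G1 x)\<^sup>2)"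
    "react_derivs v h g 3 = (\<lambda>x. G3 x * (1 - v * h * G0 x) - 3 * v * h * (G1 x * G2 x))"
    "react_derivs v h g 4 = (\<lambda>x. G4 x * (1 - v * h * G0 x) - v * h * (4 * (G1 x * G3 x) + 3 * (G2 x)\<^sup>2))"
    by (auto simp: react_derivs_def react_def G)
  have "(react_derivs v h g 0 has_real_derivative react_derivs v h g 1 x) (at x)"
    unfolding r by (auto intro!: derivative_eq_intros d simp: power2_eq_square algebra_simps)
  moreover have "(react_derivs v h g 1 has_real_derivative react_derivs v h g 2 x) (at x)"
    unfolding r by (auto intro!: derivative_eq_intros d simp: power2_eq_square algebra_simps)
  moreover have "(react_derivs v h g 2 has_real_derivative react_derivs v h g 3 x) (at x)"
    unfolding r by (auto intro!: derivative_eq_intros d simp: power2_eq_square algebra_simps)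
  moreover have "(react_derivs v h g 3 has_real_derivative react_derivs v h g 4 x) (at x)"
    unfolding r by (auto intro!: derivative_eq_intros d simp: power2_eq_square algebra_simps)
  moreover have "i = 0 \<or> i = 1 \<or> i = 2 \<or> i = 3" using assms(2) by linarith
  ultimately show ?thesis by (auto simp: eval_nat_numeral)
qed

text \<open>The assumption v h b_0 <= 1 keeps the factor 1 - v h g_0 in [0,1], so the derivative of
  order i does not amplify itself. Its bound grows only by v h times products of derivatives of
  orders 1 to i - 1; the bounds of orders 0 and 1 do not grow at all.\<close>

lemma react_derivs_bounds:
  assumes g: "smooth4 b g" and vh: "v * h \<ge> 0" "v * h * b 0 \<le> 1"
  shows "0 \<le> react_derivs v h g 0 x" "react_derivs v h g 0 x \<le> b 0"
    "\<bar>react_derivs v h g 1 x\<bar> \<le> b 1"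
    "\<bar>react_derivs v h g 2 x\<bar> \<le> b 2 + v * h * (b 1)\<^sup>2"
    "\<bar>react_derivs v h g 3 x\<bar> \<le> b 3 + 3 * v * h * (b 1 * b 2)"
    "\<bar>react_derivs v h g 4 x\<bar> \<le> b 4 + v * h * (4 * (b 1 * b 3) + 3 * (b 2)\<^sup>2)"
proof -
  define w where "w = 1 - v * h * g 0 x"
  have g0: "0 \<le> g 0 x" "g 0 x \<le> b 0" using smooth4D[OF g] by auto
  have w: "0 \<le> w" "w \<le> 1"
    using mult_left_mono[OF g0(2) vh(1)] vh g0 by (auto simp: w_def)
  have r: "react_derivs v h g 0 x = g 0 x * (1 + w) / 2"
    by (simp add: react_derivs_def react_def w_def power2_eq_square algebra_simps)
  show "0 \<le> react_derivs v h g 0 x" using g0 w by (simp add: r)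
  have "g 0 x * (1 + w) \<le> g 0 x * 2" using g0 w by (intro mult_left_mono) auto
  then show "react_derivs v h g 0 x \<le> b 0" using g0 by (simp add: r)
  have b: "\<bar>g i x\<bar> \<le> b i" if "i \<le> 4" for i using smooth4D(2)[OF g that] .
  have lin: "\<bar>g i x * w\<bar> \<le> b i" if "i \<le> 4" for i
    using mult_mono[OF b[OF that] w(2)] smooth4D(5)[OF g that] w by (simp add: abs_mult)
  have pr: "\<bar>g i x * g j x\<bar> \<le> b i * b j" if "i \<le> 4" "j \<le> 4" for i j
    unfolding abs_mult using b[OF that(1)] b[OF that(2)] smooth4D(5)[OF g that(1)] by (intro mult_mono) auto
  have pr': "\<bar>v * h * (g i x * g j x)\<bar> \<le> v * h * (b i * b j)" if "i \<le> 4" "j \<le> 4" for i j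
  proof -
    have "\<bar>v * h * (g i x * g j x)\<bar> = v * h * \<bar>g i x * g j x\<bar>"
      using vh by (simp only: abs_mult[of "v * h"] abs_of_nonneg)
    then show ?thesis using mult_left_mono[OF pr[OF that] vh(1)] by linarith
  qed
  show "\<bar>react_derivs v h g 1 x\<bar> \<le> b 1"
    using lin[of 1] by (simp add: react_derivs_def w_def)
  have "react_derivs v h g 2 x = g 2 x * w - v * h * (g 1 x * g 1 x)"
    by (simp add: react_derivs_def w_def power2_eq_square)
  then show "\<bar>react_derivs v h g 2 x\<bar> \<le> b 2 + v * h * (b 1)\<^sup>2"
    using lin[of 2] pr'[of 1 1] unfolding power2_eq_square by linarith
  have "react_derivs v h g 3 x = g 3 x * w - 3 * (v * h * (g 1 x * g 2 x))"
    by (simp add: react_derivs_def w_def)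
  moreover have "b 3 + 3 * v * h * (b 1 * b 2) = b 3 + 3 * (v * h * (b 1 * b 2))" by simp
  ultimately show "\<bar>react_derivs v h g 3 x\<bar> \<le> b 3 + 3 * v * h * (b 1 * b 2)"
    using lin[of 3] pr'[of 1 2] by linarith
  have "react_derivs v h g 4 x = g 4 x * w - (4 * (v * h * (g 1 x * g 3 x)) + 3 * (v * h * (g 2 x * g 2 x)))"
    by (simp add: react_derivs_def w_def power2_eq_square algebra_simps)
  moreover have "b 4 + v * h * (4 * (b 1 * b 3) + 3 * (b 2)\<^sup>2) = b 4 + 4 * (v * h * (b 1 * b 3)) + 3 * (v * h * (b 2 * b 2))"
    by (simp add: power2_eq_square algebra_simps)
  ultimately show "\<bar>react_derivs v h g 4 x\<bar> \<le> b 4 + v * h * (4 * (b 1 * b 3) + 3 * (b 2)\<^sup>2)"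
    using lin[of 4] pr'[of 1 3] pr'[of 2 2] by linarith
qed

definition ref_tower :: "real \<Rightarrow> real \<Rightarrow> real \<Rightarrow> (nat \<Rightarrow> real \<Rightarrow> real) \<Rightarrow> nat \<Rightarrow> real \<Rightarrow> real" where
  "ref_tower v e h g i = sym_avg (sqrt (e * h)) (react_derivs v h g i)"

definition ref_bound :: "real \<Rightarrow> (nat \<Rightarrow> real) \<Rightarrow> nat \<Rightarrow> real" where
  "ref_bound w b i = (if i = 2 then b 2 + w * (b 1)\<^sup>2
     else if i = 3 then b 3 + 3 * w * (b 1 * b 2)
     else if i = 4 then b 4 + w * (4 * (b 1 * b 3) + 3 * (b 2)\<^sup>2) else b i)"

lemma ref_tower_0: "ref_tower v e h g 0 = ref_op v e h (g 0)"
  by (simp add: fun_eq_iff ref_tower_def ref_op_def react_derivs_def sym_avg_def)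

lemma smooth4_ref_tower:
  assumes g: "smooth4 b g" and vh: "v * h \<ge> 0" "v * h * b 0 \<le> 1"
  shows "smooth4 (ref_bound (v * h) b) (ref_tower v e h g)"
proof -
  note rb = react_derivs_bounds[OF g vh]
  have "\<bar>react_derivs v h g i x\<bar> \<le> ref_bound (v * h) b i" if i: "i \<le> 4" for i x
  proof -
    consider "i = 0" | "i = 1" | "i = 2" | "i = 3" | "i = 4" using i by linarith
    then show ?thesis by cases (use rb[of x] in \<open>auto simp: ref_bound_def mult.assoc\<close>)
  qed
  then show ?thesis
    unfolding smooth4_def ref_tower_def
    by (auto intro!: sym_avg_has_derivative sym_avg_abs_le react_derivs_has_derivative[OF g])
       (use rb(1) in \<open>auto simp: sym_avg_def\<close>)
qed

definition limit_gen :: "real \<Rightarrow> real \<Rightarrow> (nat \<Rightarrow> real \<Rightarrow> real) \<Rightarrow> real \<Rightarrow> real" where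
  "limit_gen v e g x = e / 2 * g 2 x - v / 2 * (g 0 x)\<^sup>2"

text \<open>The three groups of summands serve the three estimates of \<open>ref_tower_step\<close>
  in turn; one common constant spares separate bookkeeping.\<close>

definition step_const :: "real \<Rightarrow> real \<Rightarrow> (nat \<Rightarrow> real) \<Rightarrow> real" where
  "step_const v e b = (e / 2 * b 2 + v / 2 * (b 0)\<^sup>2) + (v * (b 0 * b 2 + (b 1)\<^sup>2) + e / 2 * b 4)
     + (e\<^sup>2 / 24 * b 4 + v * e / 2 * ((b 1)\<^sup>2 + b 0 * b 2))"

text \<open>Odd Taylor terms cancel in the symmetric average, so its leading term is e h/2 times the
  second derivative, with an error of order h^2. The increment of \<open>g 2\<close> is estimated as
  well, because \<open>limit_gen\<close> contains the second derivative and has to be controlled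
  along several steps.\<close>

lemma ref_tower_step:
  assumes g: "smooth4 b g" and v: "v \<ge> 0" and e: "e \<ge> 0" and h: "h \<ge> 0"
  shows "\<bar>ref_tower v e h g 0 x - g 0 x\<bar> \<le> h * step_const v e b" (is ?A)
    and "\<bar>ref_tower v e h g 2 x - g 2 x\<bar> \<le> h * step_const v e b" (is ?B)
    and "\<bar>ref_tower v e h g 0 x - g 0 x - h * limit_gen v e g x\<bar> \<le> h\<^sup>2 * step_const v e b" (is ?C)
proof -
  define s where "s = sqrt (e * h)"
  have s2: "s\<^sup>2 = e * h" using e h by (simp add: s_def)
  have s4: "s ^ 4 = e\<^sup>2 * h\<^sup>2"
    using s2 by (metis (no_types, opaque_lifting) mult_2 numeral_Bit0 power_add power2_eq_square power_mult_distrib)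
  have b: "\<bar>g i x\<bar> \<le> b i" if "i \<le> 4" for i x using smooth4D(2)[OF g that] .
  have b0: "0 \<le> b i" if "i \<le> 4" for i using smooth4D(5)[OF g that] .
  have d: "(g 0 has_real_derivative g 1 x) (at x)" "(g 1 has_real_derivative g 2 x) (at x)"
    "(g 2 has_real_derivative g 3 x) (at x)" "(g 3 has_real_derivative g 4 x) (at x)" for x
    using smooth4D(1)[OF g, of 0 x] smooth4D(1)[OF g, of 1 x]
      smooth4D(1)[OF g, of 2 x] smooth4D(1)[OF g, of 3 x]
    by (simp_all add: eval_nat_numeral)
  have pr: "\<bar>g i x * g j x\<bar> \<le> b i * b j" if "i \<le> 4" "j \<le> 4" for i j x
    unfolding abs_mult using b[OF that(1)] b[OF that(2)] b0[OF that(1)] by (intro mult_mono) auto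
  define P where "P = v * (b 0 * b 2 + (b 1)\<^sup>2)"
  define R where "R = e\<^sup>2 / 24 * b 4 + v * e / 2 * ((b 1)\<^sup>2 + b 0 * b 2)"
  have pos: "0 \<le> e / 2 * b 2" "0 \<le> v / 2 * (b 0)\<^sup>2" "0 \<le> P" "0 \<le> e / 2 * b 4" "0 \<le> R"
    using v e b0 by (auto simp: P_def R_def intro!: add_nonneg_nonneg mult_nonneg_nonneg)
  have sc: "step_const v e b = (e / 2 * b 2 + v / 2 * (b 0)\<^sup>2) + (P + e / 2 * b 4) + R"
    by (simp add: step_const_def P_def R_def)
  have lin: "sym_avg s (\<lambda>y. f1 y - c * f2 y) x = sym_avg s f1 x - c * sym_avg s f2 x" for f1 f2 c
    by (simp add: sym_avg_def field_simps)
  let ?q = "\<lambda>y. (g 0 y)\<^sup>2"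
  have q: "\<bar>sym_avg s ?q x\<bar> \<le> (b 0)\<^sup>2"
    by (rule sym_avg_abs_le) (use pr[of 0 0] in \<open>auto simp: power2_eq_square\<close>)
  have t0: "ref_tower v e h g 0 x = sym_avg s (g 0) x - v * h / 2 * sym_avg s ?q x"
    unfolding ref_tower_def s_def[symmetric] react_derivs_def react_def using lin[of "g 0" "v * h / 2" ?q] by simp
  have a2: "\<bar>sym_avg s (g 0) x - g 0 x\<bar> \<le> b 2 / 2 * s\<^sup>2"
    by (rule sym_avg_taylor2[OF d(1) d(2) b]) simp
  have vq: "\<bar>v * h / 2 * sym_avg s ?q x\<bar> \<le> v * h / 2 * (b 0)\<^sup>2"
    unfolding abs_mult using v h q by (intro mult_mono) auto
  have "\<bar>ref_tower v e h g 0 x - g 0 x\<bar> \<le> b 2 / 2 * s\<^sup>2 + v * h / 2 * (b 0)\<^sup>2"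
    unfolding t0 using a2 vq by linarith
  also have "\<dots> = h * (e / 2 * b 2 + v / 2 * (b 0)\<^sup>2)" by (simp add: s2 algebra_simps)
  also have "\<dots> \<le> h * step_const v e b" unfolding sc using pos by (intro mult_left_mono h) linarith
  finally show ?A .
  let ?r = "\<lambda>y. g 0 y * g 2 y + (g 1 y)\<^sup>2"
  have rb: "\<bar>?r y\<bar> \<le> b 0 * b 2 + (b 1)\<^sup>2" for y
    using pr[of 0 2 y] pr[of 1 1 y] unfolding power2_eq_square by linarith
  have "ref_tower v e h g 2 x = sym_avg s (\<lambda>y. g 2 y - v * h * ?r y) x"
    unfolding ref_tower_def s_def[symmetric] by (simp add: react_derivs_def sym_avg_def algebra_simps)
  then have t2: "ref_tower v e h g 2 x = sym_avg s (g 2) x - v * h * sym_avg s ?r x"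
    unfolding lin .
  have a2: "\<bar>sym_avg s (g 2) x - g 2 x\<bar> \<le> b 4 / 2 * s\<^sup>2"
    by (rule sym_avg_taylor2[OF d(3) d(4) b]) simp
  have "\<bar>v * h * sym_avg s ?r x\<bar> \<le> v * h * (b 0 * b 2 + (b 1)\<^sup>2)"
    unfolding abs_mult[of "v * h"] using v h sym_avg_abs_le[where f="?r", OF rb] by (intro mult_mono) auto
  then have "\<bar>ref_tower v e h g 2 x - g 2 x\<bar> \<le> b 4 / 2 * s\<^sup>2 + v * h * (b 0 * b 2 + (b 1)\<^sup>2)"
    unfolding t2 using a2 by linarith
  also have "\<dots> = h * (P + e / 2 * b 4)" by (simp add: s2 P_def algebra_simps)
  also have "\<dots> \<le> h * step_const v e b" unfolding sc using pos by (intro mult_left_mono h) linarith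
  finally show ?B .
  have a4: "\<bar>sym_avg s (g 0) x - g 0 x - s\<^sup>2 / 2 * g 2 x\<bar> \<le> b 4 / 24 * s ^ 4"
    by (rule sym_avg_taylor4) (use smooth4D[OF g] in auto)
  have qq: "\<bar>sym_avg s ?q x - ?q x\<bar> \<le> (2 * ((b 1)\<^sup>2 + b 0 * b 2)) / 2 * s\<^sup>2"
  proof (rule sym_avg_taylor2)
    show "(?q has_real_derivative 2 * g 0 t * g 1 t) (at t)" for t
      by (auto intro!: derivative_eq_intros d d[unfolded One_nat_def])
    show "((\<lambda>t. 2 * g 0 t * g 1 t) has_real_derivative 2 * ((g 1 t)\<^sup>2 + g 0 t * g 2 t)) (at t)" for t
      by (auto intro!: derivative_eq_intros d d[unfolded One_nat_def] simp: power2_eq_square)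
    show "\<bar>2 * ((g 1 t)\<^sup>2 + g 0 t * g 2 t)\<bar> \<le> 2 * ((b 1)\<^sup>2 + b 0 * b 2)" for t
      using rb[of t] by (simp add: add.commute abs_mult)
  qed
  have "2 * X / 2 * s\<^sup>2 = X * s\<^sup>2" for X by simp
  then have qq': "\<bar>sym_avg s ?q x - ?q x\<bar> \<le> ((b 1)\<^sup>2 + b 0 * b 2) * s\<^sup>2"
    using qq by metis
  have vq: "\<bar>v * h / 2 * (sym_avg s ?q x - ?q x)\<bar> \<le> v * h / 2 * (((b 1)\<^sup>2 + b 0 * b 2) * s\<^sup>2)"
    unfolding abs_mult[of "v * h / 2"] using v h qq' by (intro mult_mono) auto
  have "ref_tower v e h g 0 x - g 0 x - h * limit_gen v e g x =
     (sym_avg s (g 0) x - g 0 x - s\<^sup>2 / 2 * g 2 x) - v * h / 2 * (sym_avg s ?q x - ?q x)"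
    unfolding t0 limit_gen_def s2 by (simp add: algebra_simps)
  then have "\<bar>ref_tower v e h g 0 x - g 0 x - h * limit_gen v e g x\<bar> \<le>
     b 4 / 24 * s ^ 4 + v * h / 2 * (((b 1)\<^sup>2 + b 0 * b 2) * s\<^sup>2)"
    using a4 vq by linarith
  also have "\<dots> = h\<^sup>2 * R" unfolding s2 s4 R_def by (simp add: power2_eq_square algebra_simps)
  also have "\<dots> \<le> h\<^sup>2 * step_const v e b" unfolding sc using pos by (intro mult_left_mono) auto
  finally show ?C .
qed

text \<open>The growth of each derivative along the scheme is driven by the lower ones only, so the bounds
  grow at most linearly up to time one.\<close>

definition time_bound :: "real \<Rightarrow> (nat \<Rightarrow> real) \<Rightarrow> nat \<Rightarrow> real" where
  "time_bound v b i = (let c2 = b 2 + v * (b 1)\<^sup>2; c3 = b 3 + 3 * v * (b 1 * c2) in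
     if i = 2 then c2 else if i = 3 then c3
     else if i = 4 then b 4 + v * (4 * (b 1 * c3) + 3 * c2\<^sup>2) else b i)"

definition interp_bound :: "real \<Rightarrow> (nat \<Rightarrow> real) \<Rightarrow> real \<Rightarrow> nat \<Rightarrow> real" where
  "interp_bound v b t i = b i + t * (time_bound v b i - b i)"

lemma time_bound_ge:
  assumes "\<And>i. i \<le> 4 \<Longrightarrow> 0 \<le> b i" "v \<ge> 0" "i \<le> 4"
  shows "b i \<le> time_bound v b i"
  using assms by (auto simp: time_bound_def Let_def intro!: mult_nonneg_nonneg add_nonneg_nonneg)

lemma ref_iter_smooth:
  assumes g: "smooth4 b g" and v: "v \<ge> 0" and e: "e \<ge> 0" and h: "h \<ge> 0" and vhb: "v * h * b 0 \<le> 1"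
    and j: "real j * h \<le> 1"
  shows "\<exists>f. f 0 = (ref_op v e h ^^ j) (g 0) \<and> smooth4 (time_bound v b) f
    \<and> (\<forall>x. \<bar>f 0 x - g 0 x\<bar> \<le> real j * h * step_const v e (time_bound v b))
    \<and> (\<forall>x. \<bar>f 2 x - g 2 x\<bar> \<le> real j * h * step_const v e (time_bound v b))"
proof -
  let ?c = "time_bound v b"
  let ?C = "step_const v e ?c"
  have b0: "0 \<le> b i" if "i \<le> 4" for i using smooth4D(5)[OF g that] .
  have bc: "b i \<le> ?c i" if "i \<le> 4" for i using time_bound_ge[of b v i] b0 v that by auto
  have ib: "interp_bound v b t i \<le> ?c i" if "t \<le> 1" "i \<le> 4" for t i
    using mult_right_mono[OF that(1), of "?c i - b i"] bc[OF that(2)] by (simp add: interp_bound_def)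
  \<comment> \<open>One step of length h stays below the linear interpolation: the growth rate at
    order i involves only bounds of lower order, and these are replaced by their larger values
    \<open>?c\<close> at time one.\<close>
  have key: "ref_bound (v * h) (interp_bound v b t) i \<le> interp_bound v b (t + h) i"
    if t: "0 \<le> t" "t \<le> 1" and i: "i \<le> 4" for t i
  proof -
    let ?B = "interp_bound v b t"
    have B: "0 \<le> ?B i" "?B i \<le> ?c i" if "i \<le> 4" for i
      using ib[of t i] t b0[OF that] bc[OF that] that by (auto simp: interp_bound_def intro!: add_nonneg_nonneg mult_nonneg_nonneg)
    have B1: "?B 0 = b 0" "?B 1 = b 1" by (auto simp: interp_bound_def time_bound_def)
    have c: "?c 2 = b 2 + v * (b 1)\<^sup>2" "?c 3 = b 3 + 3 * v * (b 1 * ?c 2)"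
       "?c 4 = b 4 + v * (4 * (b 1 * ?c 3) + 3 * (?c 2)\<^sup>2)"
      by (auto simp: time_bound_def Let_def)
    consider "i = 0" | "i = 1" | "i = 2" | "i = 3" | "i = 4" using i by linarith
    then show ?thesis
    proof cases
      case 3
      then show ?thesis by (simp add: ref_bound_def B1[unfolded One_nat_def]) (simp add: interp_bound_def c algebra_simps)
    next
      case 4
      have "v * h * (b 1 * ?B 2) \<le> v * h * (b 1 * ?c 2)"
        using v h b0[of 1] B[of 2] by (intro mult_left_mono) auto
      moreover have "ref_bound (v * h) ?B i = ?B 3 + 3 * (v * h * (b 1 * ?B 2))"
        using 4 B1 by (simp add: ref_bound_def)
      moreover have "interp_bound v b (t + h) i = ?B 3 + 3 * (v * h * (b 1 * ?c 2))"
        using 4 c(2) by (simp add: interp_bound_def algebra_simps)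
      ultimately show ?thesis by linarith
    next
      case 5
      have "v * h * (4 * (b 1 * ?B 3) + 3 * (?B 2)\<^sup>2) \<le> v * h * (4 * (b 1 * ?c 3) + 3 * (?c 2)\<^sup>2)"
        using v h b0[of 1] B[of 2] B[of 3] by (intro mult_left_mono add_mono power_mono) auto
      moreover have "ref_bound (v * h) ?B i = ?B 4 + v * h * (4 * (b 1 * ?B 3) + 3 * (?B 2)\<^sup>2)"
        using 5 B1 by (simp add: ref_bound_def)
      moreover have "interp_bound v b (t + h) i = ?B 4 + v * h * (4 * (b 1 * ?c 3) + 3 * (?c 2)\<^sup>2)"
        using 5 c(3) by (simp add: interp_bound_def algebra_simps)
      ultimately show ?thesis by linarith
    qed (auto simp: ref_bound_def interp_bound_def time_bound_def)
  qed
  have "\<exists>f. f 0 = (ref_op v e h ^^ j) (g 0) \<and> smooth4 (interp_bound v b (real j * h)) f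
    \<and> (\<forall>x. \<bar>f 0 x - g 0 x\<bar> \<le> real j * h * ?C) \<and> (\<forall>x. \<bar>f 2 x - g 2 x\<bar> \<le> real j * h * ?C)"
    if "real j * h \<le> 1" for j
    using that
  proof (induction j)
    case 0
    have "interp_bound v b 0 = b" by (auto simp: interp_bound_def)
    then show ?case using g by (intro exI[of _ g]) auto
  next
    case (Suc j)
    have t: "0 \<le> real j * h" "real j * h \<le> 1" using Suc.prems h by (auto simp: algebra_simps)
    then obtain f where f: "f 0 = (ref_op v e h ^^ j) (g 0)" "smooth4 (interp_bound v b (real j * h)) f"
      "\<And>x. \<bar>f 0 x - g 0 x\<bar> \<le> real j * h * ?C" "\<And>x. \<bar>f 2 x - g 2 x\<bar> \<le> real j * h * ?C"
      using Suc.IH by blast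
    have fc: "smooth4 ?c f" by (rule smooth4_mono[OF f(2)]) (use ib t in auto)
    let ?f = "ref_tower v e h f"
    have "smooth4 (ref_bound (v * h) (interp_bound v b (real j * h))) ?f"
      by (rule smooth4_ref_tower[OF f(2)]) (use v h vhb in \<open>auto simp: interp_bound_def time_bound_def\<close>)
    then have sm: "smooth4 (interp_bound v b (real (Suc j) * h)) ?f"
      by (rule smooth4_mono) (use key[OF t] in \<open>auto simp: algebra_simps\<close>)
    have eq: "real (Suc j) * h * ?C = real j * h * ?C + h * ?C" by (simp add: algebra_simps)
    have "\<bar>?f 0 x - g 0 x\<bar> \<le> real (Suc j) * h * ?C" for x
      using ref_tower_step(1)[OF fc v e h, of x] f(3)[of x] unfolding eq by linarith
    moreover have "\<bar>?f 2 x - g 2 x\<bar> \<le> real (Suc j) * h * ?C" for x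
      using ref_tower_step(2)[OF fc v e h, of x] f(4)[of x] unfolding eq by linarith
    moreover have "?f 0 = (ref_op v e h ^^ Suc j) (g 0)"
      by (simp add: ref_tower_0 f(1))
    ultimately show ?case using sm by blast
  qed
  from this[OF j] show ?thesis using smooth4_mono ib j by meson
qed

text \<open>Many small steps agree with one Euler step of length m h up to its square: the local
  errors add up to order m h^2, and \<open>limit_gen\<close> drifts by at most order m h along the
  way. The constant does not involve m, so one generation can be matched with arbitrarily many steps
  of the scheme.\<close>

lemma ref_iter_consistent:
  assumes g: "smooth4 b g" and v: "v \<ge> 0" and e: "e \<ge> 0" and h: "h \<ge> 0" and vhb: "v * h * b 0 \<le> 1"
    and m: "real m * h \<le> 1"
  shows "\<bar>(ref_op v e h ^^ m) (g 0) x - g 0 x - real m * h * limit_gen v e g x\<bar>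
    \<le> (real m * h)\<^sup>2 * (step_const v e (time_bound v b) * (1 + e / 2 + v * b 0))"
proof -
  let ?c = "time_bound v b"
  let ?C = "step_const v e ?c"
  let ?D = "?C * (e / 2 + v * b 0)"
  have b0: "0 \<le> b i" if "i \<le> 4" for i using smooth4D(5)[OF g that] .
  have c0: "0 \<le> ?c i" if "i \<le> 4" for i using time_bound_ge[of b v i] b0 v that by force
  have C0: "?C \<ge> 0" unfolding step_const_def
    using v e c0 by (intro add_nonneg_nonneg mult_nonneg_nonneg) auto
  have D0: "?D \<ge> 0" using C0 v e b0[of 0] by (intro mult_nonneg_nonneg add_nonneg_nonneg) auto
  have "\<bar>(ref_op v e h ^^ j) (g 0) x - g 0 x - real j * h * limit_gen v e g x\<bar>
    \<le> real j * h\<^sup>2 * (?C + real m * ?D)" if "j \<le> m" for j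
    using that
  proof (induction j)
    case (Suc j)
    have "real j * h \<le> real m * h" using Suc.prems h by (intro mult_right_mono) auto
    then have "real j * h \<le> 1" using m by linarith
    then obtain f where f: "f 0 = (ref_op v e h ^^ j) (g 0)" "smooth4 ?c f"
      "\<And>x. \<bar>f 0 x - g 0 x\<bar> \<le> real j * h * ?C" "\<And>x. \<bar>f 2 x - g 2 x\<bar> \<le> real j * h * ?C"
      using ref_iter_smooth[OF g v e h vhb] by blast
    have bd: "0 \<le> f 0 x" "f 0 x \<le> b 0" "0 \<le> g 0 x" "g 0 x \<le> b 0"
      using smooth4D(3,4)[OF f(2), of x] smooth4D(3,4)[OF g, of x] by (auto simp: time_bound_def)
    have "\<bar>(f 0 x)\<^sup>2 - (g 0 x)\<^sup>2\<bar> \<le> 2 * b 0 * (real j * h * ?C)"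
    proof -
      have "(f 0 x)\<^sup>2 - (g 0 x)\<^sup>2 = (f 0 x + g 0 x) * (f 0 x - g 0 x)" by (simp add: power2_eq_square algebra_simps)
      then have "\<bar>(f 0 x)\<^sup>2 - (g 0 x)\<^sup>2\<bar> = (f 0 x + g 0 x) * \<bar>f 0 x - g 0 x\<bar>" using bd by (simp add: abs_mult)
      also have "\<dots> \<le> 2 * b 0 * (real j * h * ?C)" using bd f(3)[of x] by (intro mult_mono) auto
      finally show ?thesis .
    qed
    then have 1: "\<bar>v / 2 * ((f 0 x)\<^sup>2 - (g 0 x)\<^sup>2)\<bar> \<le> v / 2 * (2 * b 0 * (real j * h * ?C))"
      unfolding abs_mult using v by (intro mult_mono) auto
    have 2: "\<bar>e / 2 * (f 2 x - g 2 x)\<bar> \<le> e / 2 * (real j * h * ?C)"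
      unfolding abs_mult using e f(4)[of x] by (intro mult_mono) auto
    have "limit_gen v e f x - limit_gen v e g x = e / 2 * (f 2 x - g 2 x) - v / 2 * ((f 0 x)\<^sup>2 - (g 0 x)\<^sup>2)"
      by (simp add: limit_gen_def algebra_simps)
    then have "\<bar>limit_gen v e f x - limit_gen v e g x\<bar> \<le> e / 2 * (real j * h * ?C) + v / 2 * (2 * b 0 * (real j * h * ?C))"
      using 1 2 by linarith
    also have "\<dots> = real j * h * ?D" by (simp add: algebra_simps)
    also have "\<dots> \<le> real m * h * ?D" using Suc.prems h D0 by (intro mult_right_mono) auto
    finally have hl: "h * \<bar>limit_gen v e f x - limit_gen v e g x\<bar> \<le> h * (real m * h * ?D)"
      using h by (intro mult_left_mono) auto
    have 3: "\<bar>h * (limit_gen v e f x - limit_gen v e g x)\<bar> \<le> h\<^sup>2 * (real m * ?D)"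
    proof -
      have "\<bar>h * (limit_gen v e f x - limit_gen v e g x)\<bar> = h * \<bar>limit_gen v e f x - limit_gen v e g x\<bar>"
        using h by (simp only: abs_mult abs_of_nonneg)
      moreover note hl
      moreover have "h * (real m * h * ?D) = h\<^sup>2 * (real m * ?D)" by (simp add: power2_eq_square)
      ultimately show ?thesis by simp
    qed
    have 4: "\<bar>ref_tower v e h f 0 x - f 0 x - h * limit_gen v e f x\<bar> \<le> h\<^sup>2 * ?C"
      by (rule ref_tower_step(3)[OF f(2) v e h])
    have 5: "\<bar>f 0 x - g 0 x - real j * h * limit_gen v e g x\<bar> \<le> real j * h\<^sup>2 * (?C + real m * ?D)"
      using Suc by (simp add: f(1))
    have 6: "(ref_op v e h ^^ Suc j) (g 0) x = ref_tower v e h f 0 x"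
      by (simp add: ref_tower_0 f(1))
    have "(ref_op v e h ^^ Suc j) (g 0) x - g 0 x - real (Suc j) * h * limit_gen v e g x
      = (ref_tower v e h f 0 x - f 0 x - h * limit_gen v e f x)
        + h * (limit_gen v e f x - limit_gen v e g x)
        + (f 0 x - g 0 x - real j * h * limit_gen v e g x)"
      unfolding 6 by (simp add: algebra_simps)
    then have "\<bar>(ref_op v e h ^^ Suc j) (g 0) x - g 0 x - real (Suc j) * h * limit_gen v e g x\<bar>
      \<le> h\<^sup>2 * ?C + h\<^sup>2 * (real m * ?D) + real j * h\<^sup>2 * (?C + real m * ?D)"
      using 3 4 5 by linarith
    also have "\<dots> = real (Suc j) * h\<^sup>2 * (?C + real m * ?D)" by (simp add: algebra_simps)
    finally show ?case .
  qed simp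
  then have "\<bar>(ref_op v e h ^^ m) (g 0) x - g 0 x - real m * h * limit_gen v e g x\<bar>
    \<le> real m * h\<^sup>2 * (?C + real m * ?D)" by simp
  also have "\<dots> \<le> real m * h\<^sup>2 * (real m * ?C + real m * ?D)"
  proof (cases "m = 0")
    case False
    then have "?C \<le> real m * ?C" using C0 by (simp add: mult_le_cancel_right1)
    then show ?thesis by (intro mult_left_mono) auto
  qed simp
  also have "\<dots> = (real m * h)\<^sup>2 * (?C * (1 + e / 2 + v * b 0))"
    by (simp add: power2_eq_square algebra_simps)
  finally show ?thesis .
qed

section \<open>Comparison of the branching walk with the reference scheme\<close>

context branching_walk
begin

definition abs1 :: real where "abs1 = measure_pmf.expectation a (\<lambda>d. \<bar>real_of_int d\<bar>)"
definition abs3 :: real where "abs3 = measure_pmf.expectation a (\<lambda>d. \<bar>real_of_int d\<bar> ^ 3)"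

lemma scaled_gen_expand:
  assumes "N \<ge> 1" "0 \<le> u" "u \<le> N"
  shows "\<bar>N * gen_compl p (u / N) - (u - v / (2 * N) * u\<^sup>2)\<bar> \<le> m3 * u ^ 3 / N\<^sup>2"
proof -
  have s: "0 \<le> u / N" "u / N \<le> 1" using assms by auto
  have N: "N > 0" using assms by auto
  have "N * gen_compl p (u / N) \<ge> N * (u / N - v / 2 * (u / N)\<^sup>2)"
    using gen_ge[OF s] N by simp
  moreover have "N * gen_compl p (u / N) \<le> N * (u / N - v / 2 * (u / N)\<^sup>2 + m3 * (u / N) ^ 3)"
    using gen_le[OF s] N by simp
  moreover have "N * (u / N - v / 2 * (u / N)\<^sup>2) = u - v / (2 * N) * u\<^sup>2"
    using N by (simp add: field_simps power2_eq_square)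
  moreover have "N * (u / N - v / 2 * (u / N)\<^sup>2 + m3 * (u / N) ^ 3) = u - v / (2 * N) * u\<^sup>2 + m3 * u ^ 3 / N\<^sup>2"
    using N by (simp add: field_simps power2_eq_square power3_eq_cube)
  moreover have "m3 * u ^ 3 / N\<^sup>2 \<ge> 0" using m3_nonneg assms by simp
  ultimately show ?thesis by linarith
qed

text \<open>Three errors occur: the cubic term of \<open>gen_compl\<close>, of order N^-2, and, both
  of order N^-3/2, the third-order Taylor remainder in space and the evaluation of the square at the
  displaced point instead of x. Over N generations they sum to order 1 / sqrt N.\<close>

lemma brw_op_consistent:
  assumes f: "smooth4 c f" and N: "N \<ge> 1" "c 0 \<le> N"
  shows "\<bar>brw_op a p N (f 0) x - f 0 x - limit_gen v e f x / N\<bar>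
    \<le> (m3 * c 0 ^ 3 + c 3 / 6 * abs3 + v * c 0 * c 1 * abs1) / (N * sqrt N)"
proof -
  define r where "r = sqrt N"
  have r: "r \<ge> 1" "r\<^sup>2 = N" using N by (auto simp: r_def)
  have c: "0 \<le> c i" if "i \<le> 4" for i using smooth4D(5)[OF f that] .
  have f0: "0 \<le> f 0 y" "f 0 y \<le> c 0" for y using smooth4D(3,4)[OF f] by auto
  let ?X = "\<lambda>d. N * gen_compl p (f 0 (x + real_of_int d / sqrt N) / N)"
  \<comment> \<open>The vanishing cubic and quartic terms give the expression the shape of
    \<open>expectation_quartic\<close>; as the mean is zero, only the variance survives in its
    expectation.\<close>
  let ?Y = "\<lambda>d. (f 0 x - v / (2 * N) * (f 0 x)\<^sup>2) + f 1 x / r * real_of_int d + f 2 x / (2 * N) * (real_of_int d)\<^sup>2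
      + 0 * real_of_int d ^ 3 + 0 * real_of_int d ^ 4"
  let ?Z = "\<lambda>d. m3 * c 0 ^ 3 / (N * r) + c 3 / 6 / (N * r) * \<bar>real_of_int d\<bar> ^ 3 + v * c 0 * c 1 / (N * r) * \<bar>real_of_int d\<bar> ^ 1"
  have X: "integrable (measure_pmf a) ?X"
  proof (rule scaled_gen_integrable[where g="f 0"])
    show "0 \<le> f 0 y \<and> f 0 y \<le> N" for y using f0[of y] N by auto
  qed (use N in auto)
  have Y: "integrable (measure_pmf a) ?Y" by (rule expectation_quartic)
  have Z: "integrable (measure_pmf a) ?Z"
    using integrable_power(1)[of 1] integrable_power(1)[of 3] by auto
  have pt: "\<bar>?X d - ?Y d\<bar> \<le> ?Z d" for d
  proof -
    define y where "y = real_of_int d / r"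
    define u where "u = f 0 (x + y)"
    have u: "0 \<le> u" "u \<le> c 0" using f0 by (auto simp: u_def)
    have "\<bar>N * gen_compl p (u / N) - (u - v / (2 * N) * u\<^sup>2)\<bar> \<le> m3 * u ^ 3 / N\<^sup>2"
      using u N by (intro scaled_gen_expand) auto
    also have "\<dots> \<le> m3 * c 0 ^ 3 / (N * r)"
    proof (intro frac_le mult_left_mono power_mono u m3_nonneg)
      have "r * 1 \<le> r * r" using r by (intro mult_left_mono) auto
      then have "r \<le> N" using r(2) unfolding power2_eq_square by linarith
      then show "N * r \<le> N\<^sup>2" unfolding power2_eq_square using N by (intro mult_left_mono) auto
    qed (use m3_nonneg c[of 0] N r in auto)
    finally have 1: "\<bar>N * gen_compl p (u / N) - (u - v / (2 * N) * u\<^sup>2)\<bar> \<le> m3 * c 0 ^ 3 / (N * r)" .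
    have "\<bar>f 0 (x + y) - (\<Sum>i<3. f i x / fact i * y ^ i)\<bar> \<le> c 3 / fact 3 * \<bar>y\<bar> ^ 3"
      by (rule taylor_bound) (use smooth4D[OF f] in auto)
    moreover have "(\<Sum>i<3. f i x / fact i * y ^ i) = f 0 x + f 1 x * y + f 2 x / 2 * y\<^sup>2"
      by (simp add: eval_nat_numeral)
    moreover have "fact 3 = (6::real)" by (simp add: fact_numeral)
    moreover have "\<bar>y\<bar> ^ 3 = \<bar>real_of_int d\<bar> ^ 3 / (N * r)"
      using r by (simp add: y_def power_divide power3_eq_cube power2_eq_square)
    ultimately have 2: "\<bar>u - (f 0 x + f 1 x * y + f 2 x / 2 * y\<^sup>2)\<bar> \<le> c 3 / 6 / (N * r) * \<bar>real_of_int d\<bar> ^ 3"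
      by (simp add: u_def)
    have "\<bar>f 0 (x + y) - (\<Sum>i<1. f i x / fact i * y ^ i)\<bar> \<le> c 1 / fact 1 * \<bar>y\<bar> ^ 1"
      by (rule taylor_bound) (use smooth4D[OF f] in auto)
    then have "\<bar>u - f 0 x\<bar> \<le> c 1 * \<bar>y\<bar>" by (simp add: u_def)
    moreover have "u\<^sup>2 - (f 0 x)\<^sup>2 = (u + f 0 x) * (u - f 0 x)" by (simp add: power2_eq_square algebra_simps)
    ultimately have "\<bar>u\<^sup>2 - (f 0 x)\<^sup>2\<bar> \<le> (2 * c 0) * (c 1 * \<bar>y\<bar>)"
      unfolding abs_mult using u f0[of x] by (auto simp: abs_mult intro!: mult_mono)
    then have "v / (2 * N) * \<bar>u\<^sup>2 - (f 0 x)\<^sup>2\<bar> \<le> v / (2 * N) * ((2 * c 0) * (c 1 * \<bar>y\<bar>))"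
      using v_pos N by (intro mult_left_mono) auto
    also have "\<dots> = v * c 0 * c 1 / (N * r) * \<bar>real_of_int d\<bar> ^ 1" using r N by (simp add: y_def field_simps)
    finally have 3: "\<bar>v / (2 * N) * (u\<^sup>2 - (f 0 x)\<^sup>2)\<bar> \<le> v * c 0 * c 1 / (N * r) * \<bar>real_of_int d\<bar> ^ 1"
      using v_pos N by (simp add: abs_mult)
    have "?X d - ?Y d = (N * gen_compl p (u / N) - (u - v / (2 * N) * u\<^sup>2))
       + (u - (f 0 x + f 1 x * y + f 2 x / 2 * y\<^sup>2)) - v / (2 * N) * (u\<^sup>2 - (f 0 x)\<^sup>2)"
      using r by (simp add: u_def y_def r_def[symmetric] power_divide algebra_simps)
    then show ?thesis using 1 2 3 by linarith
  qed
  have "measure_pmf.expectation a ?Y = f 0 x + limit_gen v e f x / N"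
    unfolding expectation_quartic using N by (simp add: limit_gen_def field_simps)
  then have "\<bar>brw_op a p N (f 0) x - f 0 x - limit_gen v e f x / N\<bar>
     = \<bar>measure_pmf.expectation a (\<lambda>d. ?X d - ?Y d)\<bar>"
    unfolding brw_op_def by (subst Bochner_Integration.integral_diff[OF X Y]) simp
  also have "\<dots> \<le> measure_pmf.expectation a (\<lambda>d. \<bar>?X d - ?Y d\<bar>)" by (rule integral_abs_bound)
  also have "\<dots> \<le> measure_pmf.expectation a ?Z"
    by (intro integral_mono pt Z Bochner_Integration.integrable_abs Bochner_Integration.integrable_diff X Y)
  also have "\<dots> = m3 * c 0 ^ 3 / (N * r) + c 3 / 6 / (N * r) * abs3 + v * c 0 * c 1 / (N * r) * abs1"
    using integrable_power(1)[of 1] integrable_power(1)[of 3]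
    by (simp add: abs1_def abs3_def)
  also have "\<dots> = (m3 * c 0 ^ 3 + c 3 / 6 * abs3 + v * c 0 * c 1 * abs1) / (N * sqrt N)"
    by (simp add: r_def add_divide_distrib)
  finally show ?thesis .
qed

text \<open>Consistency and stability come from different sides. Derivative bounds are available for
  the reference iterates, so one generation is compared with m steps of the scheme at such an
  iterate; the error accumulated before is carried on by the contraction property of
  \<open>brw_op\<close>. C and N0 do not depend on m.\<close>

lemma brw_ref_close:
  assumes g: "smooth4 b g"
  shows "\<exists>C. \<exists>N0\<ge>1. \<forall>N\<ge>N0. \<forall>m\<ge>1. \<forall>x.
    \<bar>(brw_op a p (real N) ^^ N) (g 0) x - (ref_op v e (1 / (real N * real m)) ^^ (N * m)) (g 0) x\<bar> \<le> C / sqrt (real N)"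
proof -
  let ?c = "time_bound v b"
  define C1 where "C1 = m3 * ?c 0 ^ 3 + ?c 3 / 6 * abs3 + v * ?c 0 * ?c 1 * abs1"
  define C2 where "C2 = step_const v e (time_bound v ?c) * (1 + e / 2 + v * ?c 0)"
  obtain N0 :: nat where N0: "real N0 \<ge> b 0 + v * b 0" using real_arch_simple by blast
  have b0: "0 \<le> b i" if "i \<le> 4" for i using smooth4D(5)[OF g that] .
  have v0: "v \<ge> 0" and e0: "e \<ge> 0" using v_pos e_pos by auto
  have c0: "0 \<le> ?c i" if "i \<le> 4" for i using time_bound_ge[of b v i] b0 v0 that by force
  have cc0: "0 \<le> time_bound v ?c i" if "i \<le> 4" for i using time_bound_ge[of ?c v i] c0 v0 that by force
  have C2: "C2 \<ge> 0" unfolding C2_def step_const_def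
    using v0 e0 cc0 c0[of 0] by (intro mult_nonneg_nonneg add_nonneg_nonneg) auto
  have "\<bar>(brw_op a p (real N) ^^ N) (g 0) x - (ref_op v e (1 / (real N * real m)) ^^ (N * m)) (g 0) x\<bar> \<le> (C1 + C2) / sqrt (real N)"
    if N: "N \<ge> N0 + 1" and m: "m \<ge> 1" for N m x
  proof -
    define h where "h = 1 / (real N * real m)"
    have N1: "real N \<ge> 1" and m1: "real m \<ge> 1" using N m by auto
    have vb: "v * b 0 \<ge> 0" using v0 b0[of 0] by simp
    have bN: "b 0 \<le> real N" "v * b 0 \<le> real N" using N N0 vb b0[of 0] by linarith+
    have h: "h \<ge> 0" "real m * h = 1 / real N" "real (N * m) * h = 1" using N1 m1 by (auto simp: h_def)
    have vhb: "v * h * b 0 \<le> 1"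
    proof -
      have "v * h * b 0 = v * b 0 / (real N * real m)" by (simp add: h_def)
      also have "\<dots> \<le> 1"
      proof -
        have "real N * 1 \<le> real N * real m" using N1 m1 by (intro mult_left_mono) auto
        then have "v * b 0 \<le> real N * real m" using bN by linarith
        moreover have "0 < real N * real m" using N1 m1 by (intro mult_pos_pos) auto
        ultimately show ?thesis by (simp only: divide_le_eq_1_pos)
      qed
      finally show ?thesis .
    qed
    let ?D = "brw_op a p (real N)" and ?R = "ref_op v e h"
    have g0: "0 \<le> g 0 y \<and> g 0 y \<le> b 0" for y using smooth4D(3,4)[OF g] by auto
    have "\<bar>(?D ^^ n) (g 0) x - (?R ^^ (n * m)) (g 0) x\<bar> \<le> real n * ((C1 + C2) / (real N * sqrt (real N)))"
      if "n \<le> N" for n x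
      using that
    proof (induction n arbitrary: x)
      case (Suc n)
      let ?E = "(C1 + C2) / (real N * sqrt (real N))"
      have "n * m \<le> N * m" using Suc.prems by (intro mult_le_mono1) auto
      then have "real (n * m) * h \<le> real (N * m) * h" using h by (intro mult_right_mono) (simp_all only: of_nat_le_iff)
      then have "real (n * m) * h \<le> 1" using h by simp
      then obtain f where f: "f 0 = (?R ^^ (n * m)) (g 0)" "smooth4 ?c f"
        using ref_iter_smooth[OF g v0 e0 h(1) vhb] by blast
      have tc: "?c 0 = b 0" by (simp add: time_bound_def)
      have f0: "0 \<le> f 0 y \<and> f 0 y \<le> real N" for y
        using smooth4D(3,4)[OF f(2), of y] bN unfolding tc by auto
      let ?u = "(?D ^^ n) (g 0)"
      have u: "0 \<le> ?u y \<and> ?u y \<le> real N" for y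
        using brw_op_iter_range[of "real N" "g 0" "b 0" n a y] g0 bN N1 by auto
      have IH: "\<bar>?u y - f 0 y\<bar> \<le> real n * ?E" for y using Suc f by simp
      have E0: "real n * ?E \<ge> 0" using IH[of 0] by linarith
      have "?D ?u x \<le> ?D (f 0) x + real n * ?E"
        by (intro brw_op_mono_add u f0 E0) (use N1 IH in \<open>auto simp: abs_le_iff algebra_simps\<close>)
      moreover have "?D (f 0) x \<le> ?D ?u x + real n * ?E"
        by (intro brw_op_mono_add u f0 E0) (use N1 IH in \<open>auto simp: abs_le_iff algebra_simps\<close>)
      ultimately have 1: "\<bar>?D ?u x - ?D (f 0) x\<bar> \<le> real n * ?E" by linarith
      have 2: "\<bar>?D (f 0) x - f 0 x - limit_gen v e f x / real N\<bar> \<le> C1 / (real N * sqrt (real N))"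
        unfolding C1_def by (rule brw_op_consistent[OF f(2)]) (use N1 bN tc in auto)
      have "\<bar>(?R ^^ m) (f 0) x - f 0 x - real m * h * limit_gen v e f x\<bar> \<le> (real m * h)\<^sup>2 * C2"
        unfolding C2_def
        by (rule ref_iter_consistent[OF f(2) v0 e0 h(1)]) (use vhb tc h N1 in auto)
      also have "\<dots> = C2 / (real N * real N)" using N1 unfolding h(2) by (simp add: power2_eq_square)
      also have "\<dots> \<le> C2 / (real N * sqrt (real N))"
      proof -
        have "sqrt (real N) * 1 \<le> sqrt (real N) * sqrt (real N)" using N1 by (intro mult_left_mono) auto
        then have "sqrt (real N) \<le> real N" using N1 by simp
        then show ?thesis using N1 C2 by (intro divide_left_mono mult_left_mono) auto
      qed
      finally have 3: "\<bar>(?R ^^ m) (f 0) x - f 0 x - limit_gen v e f x / real N\<bar> \<le> C2 / (real N * sqrt (real N))"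
        unfolding h(2) by simp
      have "(?R ^^ (Suc n * m)) (g 0) = (?R ^^ m) (f 0)" by (simp add: f(1) funpow_add)
      moreover have "(?D ^^ Suc n) (g 0) x = ?D ?u x" by simp
      moreover have "real (Suc n) * ?E = real n * ?E + (C1 / (real N * sqrt (real N)) + C2 / (real N * sqrt (real N)))"
        by (simp add: add_divide_distrib ring_distribs)
      ultimately show ?case using 1 2 3 by (auto simp only: abs_le_iff)
    qed simp
    from this[of N x] have "\<bar>(?D ^^ N) (g 0) x - (?R ^^ (N * m)) (g 0) x\<bar> \<le> real N * ((C1 + C2) / (real N * sqrt (real N)))"
      by simp
    also have "\<dots> = (C1 + C2) / sqrt (real N)" using N1 by simp
    finally show ?thesis by (simp add: h_def)
  qed
  then show ?thesis by (intro exI[of _ "C1 + C2"] exI[of _ "N0 + 1"]) auto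
qed

end

lemma brw_op_iter_universal:
  assumes "branching_walk p v a e" "branching_walk p' v a' e" and g: "smooth4 b g" and \<epsilon>: "\<epsilon> > 0"
  shows "\<exists>N0. \<forall>N\<ge>N0. \<forall>N'\<ge>N0. \<forall>x.
    \<bar>(brw_op a p (real N) ^^ N) (g 0) x - (brw_op a' p' (real N') ^^ N') (g 0) x\<bar> \<le> \<epsilon>"
proof -
  interpret A: branching_walk p v a e by fact
  interpret B: branching_walk p' v a' e by fact
  obtain C N0 where A: "N0 \<ge> 1" "\<And>N m x. N \<ge> N0 \<Longrightarrow> m \<ge> 1 \<Longrightarrow>
    \<bar>(brw_op a p (real N) ^^ N) (g 0) x - (ref_op v e (1 / (real N * real m)) ^^ (N * m)) (g 0) x\<bar> \<le> C / sqrt (real N)"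
    using A.brw_ref_close[OF g] by blast
  obtain C' N0' where B: "N0' \<ge> 1" "\<And>N m x. N \<ge> N0' \<Longrightarrow> m \<ge> 1 \<Longrightarrow>
    \<bar>(brw_op a' p' (real N) ^^ N) (g 0) x - (ref_op v e (1 / (real N * real m)) ^^ (N * m)) (g 0) x\<bar> \<le> C' / sqrt (real N)"
    using B.brw_ref_close[OF g] by blast
  have l: "(\<lambda>N. c / sqrt (real N)) \<longlonglongrightarrow> 0" for c by real_asymp
  have "\<forall>\<^sub>F N in sequentially. C / sqrt (real N) < \<epsilon> / 2 \<and> C' / sqrt (real N) < \<epsilon> / 2"
    using order_tendstoD(2)[OF l[of C], of "\<epsilon> / 2"] order_tendstoD(2)[OF l[of C'], of "\<epsilon> / 2"] \<epsilon>
    by (auto intro: eventually_conj)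
  then obtain N1 where N1: "\<And>N. N \<ge> N1 \<Longrightarrow> C / sqrt (real N) < \<epsilon> / 2 \<and> C' / sqrt (real N) < \<epsilon> / 2"
    by (auto simp: eventually_sequentially)
  have "\<bar>(brw_op a p (real N) ^^ N) (g 0) x - (brw_op a' p' (real N') ^^ N') (g 0) x\<bar> \<le> \<epsilon>"
    if "N \<ge> N0 + N0' + N1" "N' \<ge> N0 + N0' + N1" for N N' x
  proof -
    \<comment> \<open>With m = N' for the first walk and m = N for the second, both are compared
      with literally the same function: N N' steps of length 1/(N N').\<close>
    have "\<bar>(brw_op a p (real N) ^^ N) (g 0) x - (ref_op v e (1 / (real N * real N')) ^^ (N * N')) (g 0) x\<bar> \<le> C / sqrt (real N)"
      using that A(1) B(1) by (intro A(2)) auto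
    moreover have "\<bar>(brw_op a' p' (real N') ^^ N') (g 0) x - (ref_op v e (1 / (real N * real N')) ^^ (N * N')) (g 0) x\<bar> \<le> C' / sqrt (real N')"
      using B(2)[of N' N x] that A(1) B(1) by (simp add: mult.commute)
    moreover have "C / sqrt (real N) < \<epsilon> / 2" "C' / sqrt (real N') < \<epsilon> / 2" using N1 that by auto
    ultimately show ?thesis by linarith
  qed
  then show ?thesis by blast
qed

section \<open>Smoothed indicator functions\<close>

text \<open>A smooth step whose derivative is a polynomial in itself, s' = s - s^2. Hence all
  derivatives are explicit polynomials in a quantity from [0,1], and the distance to the indicator
  decays exponentially.\<close>

definition logistic :: "real \<Rightarrow> real" where
  "logistic x = 1 / (1 + exp (- x))"

lemma logistic_bounds: "0 < logistic x" "logistic x < 1"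
  by (auto simp: logistic_def add_pos_pos)

lemma logistic_mono: "x \<le> y \<Longrightarrow> logistic x \<le> logistic y"
  by (auto simp: logistic_def add_pos_pos intro!: divide_left_mono)

lemma logistic_ge: "1 - exp (- x) \<le> logistic x"
proof -
  have "(1 - exp (- x)) * (1 + exp (- x)) \<le> 1"
    by (simp add: algebra_simps)
  then show ?thesis by (simp add: logistic_def pos_le_divide_eq add_pos_pos)
qed

lemma logistic_le: "logistic x \<le> exp x"
proof -
  have "1 \<le> exp x * (1 + exp (- x))" by (simp add: algebra_simps flip: exp_add)
  then show ?thesis by (simp add: logistic_def pos_divide_le_eq add_pos_pos)
qed

lemma logistic_deriv: "(logistic has_real_derivative logistic x - (logistic x)\<^sup>2) (at x)"
proof -
  define w where "w = exp (- x)"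
  define u where "u = 1 / (1 + w)"
  have nz: "1 + exp (- x) \<noteq> 0" using exp_gt_zero[of "- x"] by linarith
  have "(logistic has_real_derivative exp (- x) / (1 + exp (- x))\<^sup>2) (at x)"
    unfolding logistic_def by (auto intro!: derivative_eq_intros simp: nz power2_eq_square)
  moreover have "exp (- x) / (1 + exp (- x))\<^sup>2 = u\<^sup>2 * w"
    by (simp add: u_def w_def power_divide)
  moreover have "u * (1 + w) = 1" using nz by (simp add: u_def w_def)
  then have "u\<^sup>2 * w = u - u\<^sup>2" by algebra
  moreover have "u = logistic x" by (simp add: u_def w_def logistic_def)
  ultimately show ?thesis by simp
qed

definition logistic_tower :: "real \<Rightarrow> real \<Rightarrow> nat \<Rightarrow> real \<Rightarrow> real" where
  "logistic_tower c l i x = (let s = logistic (l * x) in c * l ^ i *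
     (if i = 0 then s else if i = 1 then s - s ^ 2 else if i = 2 then s - 3 * s ^ 2 + 2 * s ^ 3
      else if i = 3 then s - 7 * s ^ 2 + 12 * s ^ 3 - 6 * s ^ 4
      else s - 15 * s ^ 2 + 50 * s ^ 3 - 60 * s ^ 4 + 24 * s ^ 5))"

lemma logistic_tower_0: "logistic_tower c l 0 x = c * logistic (l * x)"
  by (simp add: logistic_tower_def Let_def)

text \<open>The polynomials arise by repeated use of s' = s - s^2. The constant 200 exceeds the sum
  of the absolute coefficients of each of them; the largest sum is 150, at order four.\<close>

lemma logistic_tower_smooth4:
  assumes c: "c \<ge> 0" and l: "l > 0"
  shows "smooth4 (\<lambda>i. 200 * c * l ^ i) (logistic_tower c l)"
proof -
  define S where "S x = logistic (l * x)" for x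
  have S: "(S has_real_derivative l * (S x - S x ^ 2)) (at x)" for x
  proof -
    have "((\<lambda>x. logistic (l * x)) has_real_derivative (logistic (l * x) - (logistic (l * x))\<^sup>2) * l) (at x)"
      by (rule DERIV_chain2[OF logistic_deriv]) (auto intro!: derivative_eq_intros)
    then show ?thesis by (simp add: S_def[abs_def] mult.commute)
  qed
  have Sb: "0 \<le> S x" "S x \<le> 1" for x using logistic_bounds[of "l * x"] by (auto simp: S_def)
  have t: "logistic_tower c l 0 = (\<lambda>x. c * l ^ 0 * S x)"
    "logistic_tower c l 1 = (\<lambda>x. c * l ^ 1 * (S x - S x ^ 2))"
    "logistic_tower c l 2 = (\<lambda>x. c * l ^ 2 * (S x - 3 * S x ^ 2 + 2 * S x ^ 3))"
    "logistic_tower c l 3 = (\<lambda>x. c * l ^ 3 * (S x - 7 * S x ^ 2 + 12 * S x ^ 3 - 6 * S x ^ 4))"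
    "logistic_tower c l 4 = (\<lambda>x. c * l ^ 4 * (S x - 15 * S x ^ 2 + 50 * S x ^ 3 - 60 * S x ^ 4 + 24 * S x ^ 5))"
    by (auto simp: logistic_tower_def S_def Let_def)
  have "(logistic_tower c l 0 has_real_derivative logistic_tower c l 1 x) (at x)" for x
    unfolding t by (auto intro!: derivative_eq_intros S simp: algebra_simps eval_nat_numeral)
  moreover have "(logistic_tower c l 1 has_real_derivative logistic_tower c l 2 x) (at x)" for x
    unfolding t by (auto intro!: derivative_eq_intros S simp: algebra_simps eval_nat_numeral)
  moreover have "(logistic_tower c l 2 has_real_derivative logistic_tower c l 3 x) (at x)" for x
    unfolding t by (auto intro!: derivative_eq_intros S simp: algebra_simps eval_nat_numeral)
  moreover have "(logistic_tower c l 3 has_real_derivative logistic_tower c l 4 x) (at x)" for x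
    unfolding t by (auto intro!: derivative_eq_intros S simp: algebra_simps eval_nat_numeral)
  then have "(logistic_tower c l i has_real_derivative logistic_tower c l (Suc i) x) (at x)" if "i < 4" for i x
  proof -
    have "i = 0 \<or> i = 1 \<or> i = 2 \<or> i = 3" using that by linarith
    then show ?thesis
      using \<open>\<And>x. (logistic_tower c l 0 has_real_derivative logistic_tower c l 1 x) (at x)\<close>
        \<open>\<And>x. (logistic_tower c l 1 has_real_derivative logistic_tower c l 2 x) (at x)\<close>
        \<open>\<And>x. (logistic_tower c l 2 has_real_derivative logistic_tower c l 3 x) (at x)\<close>
        \<open>\<And>x. (logistic_tower c l 3 has_real_derivative logistic_tower c l 4 x) (at x)\<close>
      by (auto simp: eval_nat_numeral)
  qed
  moreover have "\<bar>logistic_tower c l i x\<bar> \<le> 200 * c * l ^ i" if "i \<le> 4" for i x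
  proof -
    have p: "0 \<le> S x ^ j" "S x ^ j \<le> 1" for j using Sb[of x] by (auto intro: power_le_one)
    have cl: "0 \<le> c * l ^ i" using c l by simp
    have m: "\<bar>c * l ^ i * P\<bar> \<le> 200 * c * l ^ i" if "\<bar>P\<bar> \<le> 200" for P
    proof -
      have "\<bar>c * l ^ i * P\<bar> = c * l ^ i * \<bar>P\<bar>" using cl by (simp only: abs_mult[of "c * l ^ i"] abs_of_nonneg)
      then show ?thesis using mult_left_mono[OF that cl] by (simp add: mult_ac)
    qed
    consider "i = 0" | "i = 1" | "i = 2" | "i = 3" | "i = 4" using \<open>i \<le> 4\<close> by linarith
    then show ?thesis
    proof cases
      case 1
      show ?thesis unfolding 1 t by (rule m[unfolded 1]) (use Sb[of x] in linarith)
    next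
      case 2
      show ?thesis unfolding 2 t by (rule m[unfolded 2]) (use Sb[of x] p[of 2] in linarith)
    next
      case 3
      show ?thesis unfolding 3 t by (rule m[unfolded 3]) (use Sb[of x] p[of 2] p[of 3] in linarith)
    next
      case 4
      show ?thesis unfolding 4 t by (rule m[unfolded 4]) (use Sb[of x] p[of 2] p[of 3] p[of 4] in linarith)
    next
      case 5
      show ?thesis unfolding 5 t by (rule m[unfolded 5]) (use Sb[of x] p[of 2] p[of 3] p[of 4] p[of 5] in linarith)
    qed
  qed
  moreover have "0 \<le> logistic_tower c l 0 x" for x
    using c Sb by (simp add: t)
  ultimately show ?thesis unfolding smooth4_def by blast
qed

section \<open>Squeezing the law of the rightmost particle\<close>

context branching_walk
begin

definition left_const :: real where
  "left_const = (SOME K. K > 0 \<and> (\<forall>z>0. \<forall>m. (brw_op a p 1 ^^ m) (\<lambda>y. if y \<le> 0 then 1 else 0) z \<le> K * real m / z ^ 4))"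

lemma left_const: "left_const > 0"
  "z > 0 \<Longrightarrow> (brw_op a p 1 ^^ m) (\<lambda>y. if y \<le> 0 then 1 else 0) z \<le> left_const * real m / z ^ 4"
  using someI_ex[OF brw_tail_left] unfolding left_const_def by blast+

definition squeeze_const :: real where "squeeze_const = tail_const + left_const"

lemma squeeze_const_pos: "squeeze_const > 0"
  using left_const(1) tail_const_pos by (simp add: squeeze_const_def)

lemma brw_iter_unit_step_range:
  "0 \<le> (brw_op a p 1 ^^ k) unit_step y" "(brw_op a p 1 ^^ k) unit_step y \<le> surv p k"
proof -
  show "0 \<le> (brw_op a p 1 ^^ k) unit_step y"
    using brw_op_iter_range[of 1 unit_step 1 k a y] unit_step_bounds by simp
  have "(brw_op a p 1 ^^ k) unit_step y \<le> (brw_op a p 1 ^^ k) (\<lambda>_. 1) y"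
    by (intro brw_op_iter_mono) (use unit_step_bounds in auto)
  then show "(brw_op a p 1 ^^ k) unit_step y \<le> surv p k" by (simp add: brw_op_iter_one)
qed

lemma brw_iter_unit_step_mono:
  "x \<le> y \<Longrightarrow> (brw_op a p 1 ^^ k) unit_step x \<le> (brw_op a p 1 ^^ k) unit_step y"
  by (rule brw_op_iter_monotone) (use unit_step_bounds in \<open>auto intro: unit_step_mono\<close>)

lemma brw_iter_unit_step_upper:
  assumes "t > 0"
  shows "(brw_op a p 1 ^^ k) unit_step y \<le> surv p k * unit_step (y + t) + squeeze_const * real k / t ^ 4"
proof (cases "y + t \<ge> 0")
  case True
  have "0 \<le> squeeze_const * real k / t ^ 4" using squeeze_const_pos assms by simp
  then show ?thesis using True brw_iter_unit_step_range[of k y] by (simp add: unit_step_def)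
next
  case False
  have "(brw_op a p 1 ^^ k) unit_step y \<le> (brw_op a p 1 ^^ k) unit_step (- t)"
    using False by (intro brw_iter_unit_step_mono) auto
  also have "\<dots> \<le> tail_const * real k / t ^ 4" by (rule brw_tail[OF assms])
  also have "\<dots> \<le> squeeze_const * real k / t ^ 4"
    using left_const(1) assms by (intro divide_right_mono mult_right_mono) (auto simp: squeeze_const_def)
  finally show ?thesis using False by (simp add: unit_step_def)
qed

text \<open>Survival means a particle at or above 0 or a particle below 0;
  \<open>brw_op_iter_subadd\<close> separates the two. Started at y >= t, the second event is a left
  tail and is controlled by the reflected walk.\<close>

lemma brw_iter_unit_step_lower:
  assumes "t > 0"
  shows "surv p k * unit_step (y - t) \<le> (brw_op a p 1 ^^ k) unit_step y + squeeze_const * real k / t ^ 4"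
proof (cases "y - t \<ge> 0")
  case False
  have "0 \<le> squeeze_const * real k / t ^ 4" using squeeze_const_pos assms by simp
  then show ?thesis using False brw_iter_unit_step_range[of k y] by (simp add: unit_step_def)
next
  case True
  let ?T = "brw_op a p 1 ^^ k" and ?l = "\<lambda>y. if y \<le> 0 then 1 else 0 :: real"
  have y: "y > 0" using True assms by simp
  have "surv p k = ?T (\<lambda>x. unit_step x + (1 - unit_step x)) y"
    by (simp add: brw_op_iter_one)
  also have "\<dots> \<le> ?T unit_step y + ?T (\<lambda>x. 1 - unit_step x) y"
    by (rule brw_op_iter_subadd) (auto simp: unit_step_def)
  also have "?T (\<lambda>x. 1 - unit_step x) y \<le> ?T ?l y"
    by (rule brw_op_iter_mono) (auto simp: unit_step_def)
  also have "\<dots> \<le> left_const * real k / y ^ 4" by (rule left_const(2)[OF y])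
  also have "\<dots> \<le> squeeze_const * real k / t ^ 4"
  proof (rule frac_le)
    show "left_const * real k \<le> squeeze_const * real k"
      using tail_const_pos by (intro mult_right_mono) (auto simp: squeeze_const_def)
    show "t ^ 4 \<le> y ^ 4" using True assms by (intro power_mono) auto
  qed (use squeeze_const_pos assms in auto)
  finally have "surv p k \<le> ?T unit_step y + squeeze_const * real k / t ^ 4" by simp
  moreover have "unit_step (y - t) = 1" using True by (simp add: unit_step_def)
  ultimately show ?thesis by simp
qed

text \<open>The summands measure, in order: N times the survival probability against its limit c;
  lines that move by more than \<delta> sqrt N within k generations; and the logistic function
  against the indicator at distance \<delta> from the jump.\<close>

definition squeeze_err :: "nat \<Rightarrow> nat \<Rightarrow> real \<Rightarrow> real \<Rightarrow> real \<Rightarrow> real" where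
  "squeeze_err N k c \<delta> l = \<bar>real N * surv p k - c\<bar> + squeeze_const * real k / (\<delta> ^ 4 * real N) + c * exp (- (l * \<delta>))"

text \<open>The k iterations applied first to the indicator are the last k generations of the
  population. They turn it into a function within \<open>squeeze_err\<close> of \<psi>, up to a
  shift of 2\<delta>: one \<delta> for the motion of the particles, one for the transition zone of
  the logistic function. The remaining N iterations preserve the inequality by monotone
  contraction.\<close>

lemma squeeze:
  assumes N: "N \<ge> 1" and c: "0 \<le> c" "c \<le> real N" and d: "\<delta> > 0" and l: "l > 0"
  defines "\<psi> \<equiv> \<lambda>y. c * logistic (l * y)"
  shows "real N * (brw_op a p 1 ^^ (N + k)) unit_step (z * sqrt (real N))
      \<le> (brw_op a p (real N) ^^ N) \<psi> (z + 2 * \<delta>) + squeeze_err N k c \<delta> l" (is ?A)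
    and "(brw_op a p (real N) ^^ N) \<psi> (z - 2 * \<delta>)
      \<le> real N * (brw_op a p 1 ^^ (N + k)) unit_step (z * sqrt (real N)) + squeeze_err N k c \<delta> l" (is ?B)
proof -
  let ?W = "(brw_op a p 1 ^^ k) unit_step"
  define r where "r = sqrt (real N)"
  have r: "r > 0" "r ^ 2 = real N" using N by (auto simp: r_def)
  have r4: "r ^ 4 = (real N)\<^sup>2" using r(2) by (simp add: power2_eq_square power4_eq_xxxx mult.assoc)
  have N0: "real N > 0" using N by simp
  define G where "G y = real N * ?W (y * r)" for y
  have G: "0 \<le> G y \<and> G y \<le> real N" for y
  proof -
    have "?W (y * r) \<le> 1" using brw_iter_unit_step_range[of k "y * r"] surv_pos_le[of k] by auto
    then show ?thesis using brw_iter_unit_step_range(1)[of k "y * r"] N0 by (auto simp: G_def mult_le_cancel_left2)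
  qed
  have psi: "0 \<le> \<psi> y \<and> \<psi> y \<le> real N" for y
  proof -
    have "c * logistic (l * y) \<le> c * 1" using c logistic_bounds[of "l * y"] by (intro mult_left_mono) auto
    then show ?thesis using c logistic_bounds[of "l * y"] by (auto simp: \<psi>_def)
  qed
  have W: "?W = (\<lambda>y. G (y / sqrt (real N)) / real N)"
    using r N0 by (auto simp: G_def r_def)
  have DG: "(brw_op a p (real N) ^^ N) G z = real N * (brw_op a p 1 ^^ (N + k)) unit_step (z * sqrt (real N))" for z
  proof -
    have "(brw_op a p 1 ^^ (N + k)) unit_step (z * r) = (brw_op a p 1 ^^ N) ?W (z * r)"
      by (simp add: funpow_add)
    also have "\<dots> = (brw_op a p (real N) ^^ N) G (z * r / sqrt (real N)) / real N"
      by (subst W) (simp only: brw_op_iter_scale[OF N0])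
    finally show ?thesis using N0 r(1) by (simp add: r_def)
  qed
  define K where "K = squeeze_const * real k / (\<delta> ^ 4 * real N)"
  have K: "K \<ge> 0" using squeeze_const_pos d by (simp add: K_def)
  have Kt: "real N * (squeeze_const * real k / (\<delta> * r) ^ 4) = K"
    using N0 d by (simp add: K_def power_mult_distrib r4 field_simps power2_eq_square)
  have err: "squeeze_err N k c \<delta> l = \<bar>real N * surv p k - c\<bar> + K + c * exp (- (l * \<delta>))"
    by (simp add: squeeze_err_def K_def)
  have err0: "squeeze_err N k c \<delta> l \<ge> 0" using K c by (simp add: err)
  have us: "unit_step (y * r + s * r) = unit_step (y + s)" for y s
    using r(1) by (simp add: unit_step_def zero_le_mult_iff flip: distrib_right)
  have us': "unit_step (y * r - s * r) = unit_step (y - s)" for y s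
    using us[of y "- s"] by simp
  have up: "G y \<le> \<psi> (y + 2 * \<delta>) + squeeze_err N k c \<delta> l" for y
  proof -
    have "?W (y * r) \<le> surv p k * unit_step (y + \<delta>) + squeeze_const * real k / (\<delta> * r) ^ 4"
      using brw_iter_unit_step_upper[of "\<delta> * r" k "y * r"] d r(1) us[of y \<delta>] by simp
    then have "G y \<le> real N * (surv p k * unit_step (y + \<delta>) + squeeze_const * real k / (\<delta> * r) ^ 4)"
      unfolding G_def using N0 by (intro mult_left_mono) auto
    also have "\<dots> = (real N * surv p k) * unit_step (y + \<delta>) + K"
      unfolding distrib_left Kt by simp
    also have "(real N * surv p k) * unit_step (y + \<delta>) \<le> c * unit_step (y + \<delta>) + \<bar>real N * surv p k - c\<bar>"
      by (auto simp: unit_step_def)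
    also have "c * unit_step (y + \<delta>) \<le> \<psi> (y + 2 * \<delta>) + c * exp (- (l * \<delta>))"
    proof (cases "y + \<delta> \<ge> 0")
      case True
      have "1 - exp (- (l * \<delta>)) \<le> logistic (l * \<delta>)" by (rule logistic_ge)
      also have "\<dots> \<le> logistic (l * (y + 2 * \<delta>))" using True l by (intro logistic_mono mult_left_mono) auto
      finally have "c * (1 - exp (- (l * \<delta>))) \<le> c * logistic (l * (y + 2 * \<delta>))" using c by (intro mult_left_mono)
      then show ?thesis using True by (simp add: unit_step_def \<psi>_def algebra_simps)
    next
      case False
      then show ?thesis using c psi[of "y + 2 * \<delta>"] by (simp add: unit_step_def)
    qed
    finally show ?thesis by (simp add: err)
  qed
  have low: "\<psi> (y - 2 * \<delta>) \<le> G y + squeeze_err N k c \<delta> l" for y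
  proof -
    have "\<psi> (y - 2 * \<delta>) \<le> c * unit_step (y - \<delta>) + c * exp (- (l * \<delta>))"
    proof (cases "y - \<delta> \<ge> 0")
      case True
      have "\<psi> (y - 2 * \<delta>) \<le> c * 1" unfolding \<psi>_def using c logistic_bounds[of "l * (y - 2 * \<delta>)"]
        by (intro mult_left_mono) auto
      then show ?thesis using True c by (simp add: unit_step_def add_increasing2)
    next
      case False
      have "logistic (l * (y - 2 * \<delta>)) \<le> logistic (- (l * \<delta>))"
        using False l mult_left_mono[of "y - 2 * \<delta>" "- \<delta>" l] by (intro logistic_mono) auto
      also have "\<dots> \<le> exp (- (l * \<delta>))" by (rule logistic_le)
      finally have "\<psi> (y - 2 * \<delta>) \<le> c * exp (- (l * \<delta>))" unfolding \<psi>_def using c by (intro mult_left_mono)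
      then show ?thesis using False by (simp add: unit_step_def)
    qed
    also have "c * unit_step (y - \<delta>) \<le> real N * (surv p k * unit_step (y - \<delta>)) + \<bar>real N * surv p k - c\<bar>"
      by (auto simp: unit_step_def)
    also have "real N * (surv p k * unit_step (y - \<delta>)) \<le> real N * (?W (y * r) + squeeze_const * real k / (\<delta> * r) ^ 4)"
      using brw_iter_unit_step_lower[of "\<delta> * r" k "y * r"] d r(1) us'[of y \<delta>] N0
      by (intro mult_left_mono) auto
    also have "\<dots> = G y + K" unfolding distrib_left Kt by (simp add: G_def)
    finally show ?thesis by (simp add: err)
  qed
  have "(brw_op a p (real N) ^^ N) G z \<le> (brw_op a p (real N) ^^ N) (\<lambda>y. \<psi> (y + 2 * \<delta>)) z + squeeze_err N k c \<delta> l"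
    by (rule brw_op_iter_mono_add[OF N0 G psi err0 up])
  then show ?A unfolding DG brw_op_iter_shift .
  have "(brw_op a p (real N) ^^ N) (\<lambda>y. \<psi> (y + (- 2 * \<delta>))) z \<le> (brw_op a p (real N) ^^ N) G z + squeeze_err N k c \<delta> l"
    by (rule brw_op_iter_mono_add[OF N0 psi G err0]) (use low in simp)
  then show ?B unfolding DG brw_op_iter_shift by simp
qed

end

section \<open>Splitting off a small fraction of the generations\<close>

definition initial_gens :: "real \<Rightarrow> nat \<Rightarrow> nat" where
  "initial_gens \<epsilon> n = nat \<lfloor>\<epsilon> * real n\<rfloor>"

lemma initial_gens:
  assumes "0 < \<epsilon>" "\<epsilon> \<le> 1 / 2"
  shows "initial_gens \<epsilon> n \<le> n" "(\<lambda>n. real (initial_gens \<epsilon> n) / real n) \<longlonglongrightarrow> \<epsilon>"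
    "filterlim (initial_gens \<epsilon>) at_top sequentially"
proof -
  have nn: "0 \<le> \<epsilon> * real n" for n using assms by simp
  have b: "\<epsilon> * real n - 1 < real (initial_gens \<epsilon> n)" "real (initial_gens \<epsilon> n) \<le> \<epsilon> * real n" for n
    using nn[of n] unfolding initial_gens_def by (auto simp: of_nat_nat)
  have "\<epsilon> * real n \<le> 1 * real n" using assms by (intro mult_right_mono) auto
  then show "initial_gens \<epsilon> n \<le> n" using b(2)[of n] by simp
  show "(\<lambda>n. real (initial_gens \<epsilon> n) / real n) \<longlonglongrightarrow> \<epsilon>"
  proof (rule tendsto_sandwich)
    have "\<epsilon> - 1 / real n \<le> real (initial_gens \<epsilon> n) / real n" if "n \<ge> 1" for n
    proof -
      have "\<epsilon> - 1 / real n = (\<epsilon> * real n - 1) / real n" using that by (simp add: diff_divide_distrib)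
      then show ?thesis using b(1)[of n] by (simp add: divide_right_mono)
    qed
    then show "\<forall>\<^sub>F n in sequentially. \<epsilon> - 1 / real n \<le> real (initial_gens \<epsilon> n) / real n"
      by (auto simp: eventually_sequentially)
    have "real (initial_gens \<epsilon> n) / real n \<le> \<epsilon>" if "n \<ge> 1" for n
      using b(2)[of n] that by (simp add: field_simps)
    then show "\<forall>\<^sub>F n in sequentially. real (initial_gens \<epsilon> n) / real n \<le> \<epsilon>"
      by (auto simp: eventually_sequentially)
    show "(\<lambda>n. \<epsilon> - 1 / real n) \<longlonglongrightarrow> \<epsilon>" by real_asymp
  qed simp
  show "filterlim (initial_gens \<epsilon>) at_top sequentially"
    unfolding filterlim_at_top
  proof
    fix Z :: nat
    obtain n0 :: nat where n0: "real n0 \<ge> (real Z + 1) / \<epsilon>" using real_arch_simple by blast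
    have "Z \<le> initial_gens \<epsilon> n" if "n \<ge> n0" for n
    proof -
      have "real Z + 1 \<le> \<epsilon> * real n0" using n0 assms by (simp add: field_simps)
      also have "\<dots> \<le> \<epsilon> * real n" using that assms by (intro mult_left_mono) auto
      finally show ?thesis using b(1)[of n] by linarith
    qed
    then show "\<forall>\<^sub>F n in sequentially. Z \<le> initial_gens \<epsilon> n" by (auto simp: eventually_sequentially)
  qed
qed

definition main_gens :: "real \<Rightarrow> nat \<Rightarrow> nat" where
  "main_gens \<epsilon> n = n - initial_gens \<epsilon> n"

lemma main_gens:
  assumes "0 < \<epsilon>" "\<epsilon> \<le> 1 / 2"
  shows "main_gens \<epsilon> n + initial_gens \<epsilon> n = n" "(\<lambda>n. real (main_gens \<epsilon> n) / real n) \<longlonglongrightarrow> 1 - \<epsilon>"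
    "filterlim (main_gens \<epsilon>) at_top sequentially"
proof -
  show 1: "main_gens \<epsilon> n + initial_gens \<epsilon> n = n" for n
    using initial_gens(1)[OF assms, of n] by (simp add: main_gens_def)
  have "\<forall>\<^sub>F n in sequentially. 1 - real (initial_gens \<epsilon> n) / real n = real (main_gens \<epsilon> n) / real n"
  proof (rule eventually_sequentiallyI[of 1])
    fix n :: nat assume n: "n \<ge> 1"
    have "real (main_gens \<epsilon> n) = real n - real (initial_gens \<epsilon> n)" using 1[of n] by linarith
    then show "1 - real (initial_gens \<epsilon> n) / real n = real (main_gens \<epsilon> n) / real n"
      using n by (simp add: diff_divide_distrib)
  qed
  moreover have "(\<lambda>n. 1 - real (initial_gens \<epsilon> n) / real n) \<longlonglongrightarrow> 1 - \<epsilon>"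
    by (intro tendsto_intros initial_gens(2) assms)
  ultimately show "(\<lambda>n. real (main_gens \<epsilon> n) / real n) \<longlonglongrightarrow> 1 - \<epsilon>"
    by (rule Lim_transform_eventually[rotated])
  have le: "initial_gens \<epsilon> n \<le> main_gens \<epsilon> n" for n
  proof -
    have "real (initial_gens \<epsilon> n) \<le> \<epsilon> * real n" using assms unfolding initial_gens_def by (simp add: of_nat_nat)
    also have "\<dots> \<le> 1 / 2 * real n" using assms by (intro mult_right_mono) auto
    finally show ?thesis using 1[of n] by linarith
  qed
  show "filterlim (main_gens \<epsilon>) at_top sequentially"
    by (rule filterlim_at_top_mono[OF initial_gens(3)[OF assms]]) (use le in auto)
qed

context branching_walk
begin

text \<open>The value of c comes from \<open>surv_asymp\<close>: with k about \<epsilon> n and N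
  about (1 - \<epsilon>) n, N times the survival probability 2/(v k) tends to it. It contains no
  feature of the offspring law except v.\<close>

lemma squeeze_eventually:
  assumes \<epsilon>: "0 < \<epsilon>" "\<epsilon> \<le> 1 / 2" and d: "\<delta> > 0" and l: "l > 0" and \<kappa>: "\<kappa> > 0" and \<eta>: "\<eta> > 0"
  assumes c_def: "c = 2 * (1 - \<epsilon>) / (v * \<epsilon>)"
    and small: "squeeze_const * (4 * \<epsilon>) / \<delta> ^ 4 \<le> \<kappa>" "c * exp (- (l * \<delta>)) \<le> \<kappa>"
  defines "\<psi> \<equiv> \<lambda>y. c * logistic (l * y)"
  defines "N \<equiv> main_gens \<epsilon>"
  shows "\<forall>\<^sub>F n in sequentially. N n \<ge> N0 \<and> N n \<ge> 1 \<and>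
    (\<forall>z. real (N n) * (brw_op a p 1 ^^ n) unit_step (z * sqrt (real (N n)))
        \<le> (brw_op a p (real (N n)) ^^ N n) \<psi> (z + 2 * \<delta>) + 3 * \<kappa>) \<and>
    (\<forall>z. (brw_op a p (real (N n)) ^^ N n) \<psi> (z - 2 * \<delta>)
        \<le> real (N n) * (brw_op a p 1 ^^ n) unit_step (z * sqrt (real (N n))) + 3 * \<kappa>) \<and>
    \<bar>real (N n) * surv p n - 2 * (1 - \<epsilon>) / v\<bar> \<le> \<kappa> \<and>
    \<bar>sqrt (real n / real (N n)) - 1 / sqrt (1 - \<epsilon>)\<bar> \<le> \<eta>"
proof -
  let ?k = "initial_gens \<epsilon>"
  note k = initial_gens[OF \<epsilon>] and Nn = main_gens[OF \<epsilon>, folded N_def]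
  have c0: "c \<ge> 0" using \<epsilon> v_pos by (simp add: c_def)
  have e1: "1 - \<epsilon> > 0" using \<epsilon> by simp
  have ev_pos: "\<forall>\<^sub>F n in sequentially. N n \<ge> 1 \<and> ?k n \<ge> 1 \<and> n \<ge> 1"
    using filterlim_at_top[THEN iffD1, OF Nn(3), rule_format, of 1] filterlim_at_top[THEN iffD1, OF k(3), rule_format, of 1]
      eventually_ge_at_top[of 1] by eventually_elim auto
  have A: "(\<lambda>n. real (N n) * surv p (?k n)) \<longlonglongrightarrow> c"
  proof -
    have "(\<lambda>n. real (?k n) * surv p (?k n)) \<longlonglongrightarrow> 2 / v"
      by (rule filterlim_compose[OF surv_asymp k(3)])
    then have "(\<lambda>n. (real (N n) / real n) / (real (?k n) / real n) * (real (?k n) * surv p (?k n))) \<longlonglongrightarrow> (1 - \<epsilon>) / \<epsilon> * (2 / v)"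
      using \<epsilon> by (intro tendsto_mult tendsto_divide Nn(2) k(2)) auto
    moreover have "\<forall>\<^sub>F n in sequentially. (real (N n) / real n) / (real (?k n) / real n) * (real (?k n) * surv p (?k n)) = real (N n) * surv p (?k n)"
      using ev_pos by eventually_elim auto
    moreover have "(1 - \<epsilon>) / \<epsilon> * (2 / v) = c" by (simp add: c_def mult.commute)
    ultimately show ?thesis using Lim_transform_eventually by fastforce
  qed
  have B: "(\<lambda>n. real (?k n) / real (N n)) \<longlonglongrightarrow> \<epsilon> / (1 - \<epsilon>)"
  proof -
    have "(\<lambda>n. (real (?k n) / real n) / (real (N n) / real n)) \<longlonglongrightarrow> \<epsilon> / (1 - \<epsilon>)"
      using \<epsilon> by (intro tendsto_divide Nn(2) k(2)) auto
    moreover have "\<forall>\<^sub>F n in sequentially. (real (?k n) / real n) / (real (N n) / real n) = real (?k n) / real (N n)"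
      using ev_pos by eventually_elim auto
    ultimately show ?thesis using Lim_transform_eventually by fastforce
  qed
  have D: "(\<lambda>n. real (N n) * surv p n) \<longlonglongrightarrow> 2 * (1 - \<epsilon>) / v"
  proof -
    have "(\<lambda>n. (real (N n) / real n) * (real n * surv p n)) \<longlonglongrightarrow> (1 - \<epsilon>) * (2 / v)"
      by (intro tendsto_mult Nn(2) surv_asymp)
    moreover have "\<forall>\<^sub>F n in sequentially. (real (N n) / real n) * (real n * surv p n) = real (N n) * surv p n"
      using ev_pos by eventually_elim auto
    ultimately have "(\<lambda>n. real (N n) * surv p n) \<longlonglongrightarrow> (1 - \<epsilon>) * (2 / v)"
      by (rule Lim_transform_eventually)
    then show ?thesis by (simp add: mult.commute)
  qed
  have F: "(\<lambda>n. sqrt (real n / real (N n))) \<longlonglongrightarrow> 1 / sqrt (1 - \<epsilon>)"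
  proof -
    have "(\<lambda>n. 1 / sqrt (real (N n) / real n)) \<longlonglongrightarrow> 1 / sqrt (1 - \<epsilon>)"
      using e1 by (intro tendsto_divide tendsto_const tendsto_real_sqrt Nn(2)) auto
    then show ?thesis by (simp add: real_sqrt_divide)
  qed
  have close: "\<forall>\<^sub>F n in sequentially. \<bar>f n - L\<bar> < s" if "f \<longlonglongrightarrow> L" "s > 0" for f :: "nat \<Rightarrow> real" and L s
    using tendstoD[OF that] by (simp add: dist_real_def)
  \<comment> \<open>For \<epsilon> <= 1/2 the limit of k/N is at most 2\<epsilon>; the factor 4
    leaves the strict gap that makes the bound hold eventually.\<close>
  have "\<epsilon> / (1 - \<epsilon>) < 4 * \<epsilon>" using \<epsilon> by (simp add: field_simps)
  then have kN: "\<forall>\<^sub>F n in sequentially. real (?k n) / real (N n) < 4 * \<epsilon>"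
    by (rule order_tendstoD(2)[OF B])
  \<comment> \<open>Once N is at least M, the function \<psi> takes its values in [0,N], where the
    operator behaves well.\<close>
  obtain M :: nat where M: "real M \<ge> c" using real_arch_simple by blast
  have NM: "\<forall>\<^sub>F n in sequentially. N n \<ge> M + N0"
    using filterlim_at_top[THEN iffD1, OF Nn(3)] by blast
  show ?thesis
    using ev_pos kN NM close[OF A \<kappa>] close[OF D \<kappa>] close[OF F \<eta>]
  proof eventually_elim
    case (elim n)
    have cN: "c \<le> real (N n)" using M elim by linarith
    have "squeeze_const * real (?k n) / (\<delta> ^ 4 * real (N n)) = squeeze_const / \<delta> ^ 4 * (real (?k n) / real (N n))"
      by simp
    also have "\<dots> \<le> squeeze_const / \<delta> ^ 4 * (4 * \<epsilon>)"
      using elim squeeze_const_pos d by (intro mult_left_mono) auto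
    also have "\<dots> \<le> \<kappa>" using small(1) by simp
    finally have err: "squeeze_err (N n) (?k n) c \<delta> l \<le> 3 * \<kappa>"
      unfolding squeeze_err_def using elim small(2) by linarith
    have N1: "1 \<le> N n" using elim by simp
    have 1: "real (N n) * (brw_op a p 1 ^^ n) unit_step (z * sqrt (real (N n)))
        \<le> (brw_op a p (real (N n)) ^^ N n) \<psi> (z + 2 * \<delta>) + 3 * \<kappa>" for z
      using squeeze(1)[OF N1 c0 cN d l, where k="?k n" and z=z] err unfolding Nn(1) \<psi>_def by linarith
    have 2: "(brw_op a p (real (N n)) ^^ N n) \<psi> (z - 2 * \<delta>)
        \<le> real (N n) * (brw_op a p 1 ^^ n) unit_step (z * sqrt (real (N n))) + 3 * \<kappa>" for z
      using squeeze(2)[OF N1 c0 cN d l, where k="?k n" and z=z] err unfolding Nn(1) \<psi>_def by linarith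
    show ?case using 1 2 elim by auto
  qed
qed

end

text \<open>Each walk is squeezed at its own scale by translates of the same \<psi>, and
  \<open>brw_op_iter_universal\<close> exchanges one walk for the other in between. The shift
  \<theta> pays for the translates and for the different ratios n/N and m/M. One inequality is
  enough, since the walks may be interchanged.\<close>

lemma rightmost_comparison:
  assumes wa: "branching_walk p v a e" and wb: "branching_walk p' v a' e" and \<theta>: "\<theta> > 0" and \<kappa>: "\<kappa> > 0"
  shows "\<exists>n0. \<forall>n\<ge>n0. \<forall>m\<ge>n0.
    (brw_op a p 1 ^^ n) unit_step (- (x * sqrt (real n))) / surv p n
    \<le> (brw_op a' p' 1 ^^ m) unit_step (- ((x - \<theta>) * sqrt (real m))) / surv p' m + \<kappa>"
proof -
  interpret A: branching_walk p v a e by fact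
  interpret B: branching_walk p' v a' e by fact
  have v: "v > 0" by (rule A.v_pos)
  \<comment> \<open>The errors add up to nine times \<kappa>1: three for each squeeze, one for the
    exchange of the walks, one for each normalisation by the survival probability. The final
    division is by c1 >= 1/v.\<close>
  define \<kappa>1 where "\<kappa>1 = \<kappa> / (9 * v)"
  have \<kappa>1: "\<kappa>1 > 0" using \<kappa> v by (simp add: \<kappa>1_def)
  \<comment> \<open>The two squeezes shift by 4\<delta> = \<theta>/2 in total; the other half of
    \<theta> is kept for the mismatch of sqrt(n/N) and sqrt(m/M), which \<eta> below
    controls.\<close>
  define \<delta> where "\<delta> = \<theta> / 8"
  have \<delta>: "\<delta> > 0" using \<theta> by (simp add: \<delta>_def)
  define K where "K = A.squeeze_const + B.squeeze_const"
  have K: "K > 0" "A.squeeze_const \<le> K" "B.squeeze_const \<le> K"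
    using A.squeeze_const_pos B.squeeze_const_pos by (auto simp: K_def)
  define \<epsilon> where "\<epsilon> = min (1 / 2) (\<kappa>1 * \<delta> ^ 4 / (4 * K))"
  have \<epsilon>: "0 < \<epsilon>" "\<epsilon> \<le> 1 / 2" using \<kappa>1 \<delta> K by (auto simp: \<epsilon>_def)
  have "\<epsilon> \<le> \<kappa>1 * \<delta> ^ 4 / (4 * K)" by (simp add: \<epsilon>_def)
  then have "K * (4 * \<epsilon>) / \<delta> ^ 4 \<le> \<kappa>1" using K \<delta> by (simp add: field_simps)
  moreover have "S * (4 * \<epsilon>) / \<delta> ^ 4 \<le> K * (4 * \<epsilon>) / \<delta> ^ 4" if "S \<le> K" for S
    using that \<epsilon> \<delta> by (intro divide_right_mono mult_right_mono) auto
  ultimately have smA: "A.squeeze_const * (4 * \<epsilon>) / \<delta> ^ 4 \<le> \<kappa>1" and smB: "B.squeeze_const * (4 * \<epsilon>) / \<delta> ^ 4 \<le> \<kappa>1"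
    using K by (meson order_trans)+
  define c where "c = 2 * (1 - \<epsilon>) / (v * \<epsilon>)"
  have c: "c > 0" using \<epsilon> v by (simp add: c_def)
  \<comment> \<open>The steepness is chosen after c, which grows like 1/\<epsilon>, and \<epsilon>
    in turn after \<delta>.\<close>
  define l where "l = (\<bar>ln (\<kappa>1 / c)\<bar> + 1) / \<delta>"
  have l: "l > 0" using \<delta> by (simp add: l_def add_nonneg_pos)
  have lc: "c * exp (- (l * \<delta>)) \<le> \<kappa>1"
  proof -
    have "- (l * \<delta>) \<le> ln (\<kappa>1 / c)" using \<delta> by (simp add: l_def)
    then have "exp (- (l * \<delta>)) \<le> \<kappa>1 / c" using \<kappa>1 c by (metis divide_pos_pos exp_le_cancel_iff exp_ln)
    then show ?thesis using c by (simp add: field_simps)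
  qed
  define \<eta> where "\<eta> = \<theta> / (4 * (\<bar>x\<bar> + 1))"
  have \<eta>: "\<eta> > 0" "2 * \<eta> * \<bar>x\<bar> \<le> \<theta> / 2" using \<theta> by (auto simp: \<eta>_def field_simps)
  define \<psi> where "\<psi> = logistic_tower c l 0"
  have psi: "\<psi> = (\<lambda>y. c * logistic (l * y))" by (simp add: \<psi>_def logistic_tower_0 fun_eq_iff)
  have "smooth4 (\<lambda>i. 200 * c * l ^ i) (logistic_tower c l)"
    using c l by (intro logistic_tower_smooth4) auto
  from brw_op_iter_universal[OF wa wb this \<kappa>1]
  obtain N0 where N0: "\<And>N N' x. N \<ge> N0 \<Longrightarrow> N' \<ge> N0 \<Longrightarrow>
    \<bar>(brw_op a p (real N) ^^ N) \<psi> x - (brw_op a' p' (real N') ^^ N') \<psi> x\<bar> \<le> \<kappa>1"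
    unfolding \<psi>_def by blast
  let ?N = "main_gens \<epsilon>"
  obtain nA where nA: "\<And>n. n \<ge> nA \<Longrightarrow> ?N n \<ge> N0 \<and> ?N n \<ge> 1 \<and>
    (\<forall>z. real (?N n) * (brw_op a p 1 ^^ n) unit_step (z * sqrt (real (?N n)))
        \<le> (brw_op a p (real (?N n)) ^^ ?N n) \<psi> (z + 2 * \<delta>) + 3 * \<kappa>1) \<and>
    (\<forall>z. (brw_op a p (real (?N n)) ^^ ?N n) \<psi> (z - 2 * \<delta>)
        \<le> real (?N n) * (brw_op a p 1 ^^ n) unit_step (z * sqrt (real (?N n))) + 3 * \<kappa>1) \<and>
    \<bar>real (?N n) * surv p n - 2 * (1 - \<epsilon>) / v\<bar> \<le> \<kappa>1 \<and>
    \<bar>sqrt (real n / real (?N n)) - 1 / sqrt (1 - \<epsilon>)\<bar> \<le> \<eta>"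
    using A.squeeze_eventually[OF \<epsilon> \<delta> l \<kappa>1 \<eta>(1) c_def smA lc, of N0]
    unfolding eventually_sequentially psi by blast
  obtain nB where nB: "\<And>n. n \<ge> nB \<Longrightarrow> ?N n \<ge> N0 \<and> ?N n \<ge> 1 \<and>
    (\<forall>z. real (?N n) * (brw_op a' p' 1 ^^ n) unit_step (z * sqrt (real (?N n)))
        \<le> (brw_op a' p' (real (?N n)) ^^ ?N n) \<psi> (z + 2 * \<delta>) + 3 * \<kappa>1) \<and>
    (\<forall>z. (brw_op a' p' (real (?N n)) ^^ ?N n) \<psi> (z - 2 * \<delta>)
        \<le> real (?N n) * (brw_op a' p' 1 ^^ n) unit_step (z * sqrt (real (?N n))) + 3 * \<kappa>1) \<and>
    \<bar>real (?N n) * surv p' n - 2 * (1 - \<epsilon>) / v\<bar> \<le> \<kappa>1 \<and>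
    \<bar>sqrt (real n / real (?N n)) - 1 / sqrt (1 - \<epsilon>)\<bar> \<le> \<eta>"
    using B.squeeze_eventually[OF \<epsilon> \<delta> l \<kappa>1 \<eta>(1) c_def smB lc, of N0]
    unfolding eventually_sequentially psi by blast
  have "(brw_op a p 1 ^^ n) unit_step (- (x * sqrt (real n))) / surv p n
    \<le> (brw_op a' p' 1 ^^ m) unit_step (- ((x - \<theta>) * sqrt (real m))) / surv p' m + \<kappa>"
    if n: "n \<ge> nA + nB" and m: "m \<ge> nA + nB" for n m
  proof -
    define N M where "N = ?N n" and "M = ?N m"
    define U where "U = (brw_op a p 1 ^^ n) unit_step (- (x * sqrt (real n)))"
    define V where "V = (brw_op a' p' 1 ^^ m) unit_step (- ((x - \<theta>) * sqrt (real m)))"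
    have hA: "N \<ge> N0" "N \<ge> 1" "\<And>z. real N * (brw_op a p 1 ^^ n) unit_step (z * sqrt (real N))
        \<le> (brw_op a p (real N) ^^ N) \<psi> (z + 2 * \<delta>) + 3 * \<kappa>1"
      "\<bar>real N * surv p n - 2 * (1 - \<epsilon>) / v\<bar> \<le> \<kappa>1" "\<bar>sqrt (real n / real N) - 1 / sqrt (1 - \<epsilon>)\<bar> \<le> \<eta>"
      using nA[of n] n unfolding N_def by auto
    have hB: "M \<ge> N0" "M \<ge> 1" "\<And>z. (brw_op a' p' (real M) ^^ M) \<psi> (z - 2 * \<delta>)
        \<le> real M * (brw_op a' p' 1 ^^ m) unit_step (z * sqrt (real M)) + 3 * \<kappa>1"
      "\<bar>real M * surv p' m - 2 * (1 - \<epsilon>) / v\<bar> \<le> \<kappa>1" "\<bar>sqrt (real m / real M) - 1 / sqrt (1 - \<epsilon>)\<bar> \<le> \<eta>"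
      using nB[of m] m unfolding M_def by auto
    define rn rm where "rn = sqrt (real n / real N)" and "rm = sqrt (real m / real M)"
    have rn: "sqrt (real n) = rn * sqrt (real N)" and rm': "sqrt (real m) = rm * sqrt (real M)"
      using hA(2) hB(2) by (simp_all add: rn_def rm_def flip: real_sqrt_mult)
    have "M \<le> m" using main_gens(1)[OF \<epsilon>, of m] by (simp add: M_def)
    then have rm1: "rm \<ge> 1" using hB(2) by (simp add: rm_def)
    define z where "z = - x * rn"
    have zz: "z + 4 * \<delta> \<le> - ((x - \<theta>) * rm)"
    proof -
      have "\<bar>rm - rn\<bar> \<le> 2 * \<eta>" using hA(5) hB(5) unfolding rn_def rm_def by linarith
      then have "\<bar>x\<bar> * \<bar>rm - rn\<bar> \<le> \<bar>x\<bar> * (2 * \<eta>)" by (intro mult_left_mono) auto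
      then have "\<bar>x * (rm - rn)\<bar> \<le> \<theta> / 2" using \<eta>(2) by (simp add: abs_mult mult_ac)
      then have "x * (rm - rn) \<le> \<theta> / 2" by linarith
      moreover have "\<theta> * 1 \<le> \<theta> * rm" using \<theta> rm1 by (intro mult_left_mono) auto
      ultimately show ?thesis unfolding z_def \<delta>_def by (simp add: algebra_simps)
    qed
    have "real N * U = real N * (brw_op a p 1 ^^ n) unit_step (z * sqrt (real N))"
      by (simp add: U_def z_def rn mult.assoc)
    also have "\<dots> \<le> (brw_op a p (real N) ^^ N) \<psi> (z + 2 * \<delta>) + 3 * \<kappa>1" by (rule hA(3))
    also have "(brw_op a p (real N) ^^ N) \<psi> (z + 2 * \<delta>) \<le> (brw_op a' p' (real M) ^^ M) \<psi> (z + 2 * \<delta>) + \<kappa>1"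
      using N0[OF hA(1) hB(1), of "z + 2 * \<delta>"] by linarith
    also have "(brw_op a' p' (real M) ^^ M) \<psi> (z + 2 * \<delta>) = (brw_op a' p' (real M) ^^ M) \<psi> ((z + 4 * \<delta>) - 2 * \<delta>)"
      by (simp add: algebra_simps)
    also have "\<dots> \<le> real M * (brw_op a' p' 1 ^^ m) unit_step ((z + 4 * \<delta>) * sqrt (real M)) + 3 * \<kappa>1" by (rule hB(3))
    also have "(brw_op a' p' 1 ^^ m) unit_step ((z + 4 * \<delta>) * sqrt (real M)) \<le> V"
      unfolding V_def
    proof (rule B.brw_iter_unit_step_mono)
      have "(z + 4 * \<delta>) * sqrt (real M) \<le> - ((x - \<theta>) * rm) * sqrt (real M)"
        using zz by (intro mult_right_mono) auto
      then show "(z + 4 * \<delta>) * sqrt (real M) \<le> - ((x - \<theta>) * sqrt (real m))" by (simp add: rm' mult.assoc)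
    qed
    finally have UV: "real N * U \<le> real M * V + 7 * \<kappa>1" using hB(2) by (simp add: mult_left_mono)
    define c1 where "c1 = 2 * (1 - \<epsilon>) / v"
    have c1: "c1 \<ge> 1 / v" unfolding c1_def using \<epsilon> v by (intro divide_right_mono) auto
    have s: "surv p n > 0" "surv p' m > 0" using A.surv_pos_le[of n] B.surv_pos_le[of m] by auto
    define P Q where "P = U / surv p n" and "Q = V / surv p' m"
    have P: "0 \<le> P" "P \<le> 1" using A.brw_iter_unit_step_range[of n "- (x * sqrt (real n))"] s by (auto simp: P_def U_def)
    have Q: "0 \<le> Q" "Q \<le> 1" using B.brw_iter_unit_step_range[of m "- ((x - \<theta>) * sqrt (real m))"] s by (auto simp: Q_def V_def)
    have "P * (c1 - real N * surv p n) \<le> P * \<kappa>1" using P hA(4) by (intro mult_left_mono) (auto simp: c1_def abs_le_iff)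
    also have "\<dots> \<le> \<kappa>1" using P \<kappa>1 by (simp add: mult_left_le_one_le)
    finally have 1: "P * c1 \<le> real N * U + \<kappa>1" using s by (simp add: P_def algebra_simps)
    have "Q * (real M * surv p' m - c1) \<le> Q * \<kappa>1" using Q hB(4) by (intro mult_left_mono) (auto simp: c1_def abs_le_iff)
    also have "\<dots> \<le> \<kappa>1" using Q \<kappa>1 by (simp add: mult_left_le_one_le)
    finally have 2: "real M * V \<le> Q * c1 + \<kappa>1" using s by (simp add: Q_def algebra_simps)
    have "(P - Q) * c1 \<le> 9 * \<kappa>1" using 1 2 UV by (simp add: algebra_simps)
    also have "\<dots> = \<kappa> * (1 / v)" using v by (simp add: \<kappa>1_def)
    also have "\<dots> \<le> \<kappa> * c1" using \<kappa> c1 by (intro mult_left_mono) auto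
    finally have "P - Q \<le> \<kappa>" using c1 v by (meson mult_le_cancel_right_pos less_le_trans zero_less_divide_1_iff)
    then show ?thesis by (simp add: P_def Q_def U_def V_def)
  qed
  then show ?thesis by blast
qed

section \<open>Convergence of the conditional laws\<close>

context branching_walk
begin

abbreviation (input) law :: "nat \<Rightarrow> real measure" where
  "law \<equiv> cond_scaled_max_law a p"

lemma law_real_distribution: "real_distribution (law n)"
  unfolding cond_scaled_max_law_def by (rule prob_space.real_distribution_distr[OF measure_pmf.prob_space_axioms]) simp

lemma measure_law:
  assumes "A \<in> sets borel"
  shows "measure (law n) A = measure_pmf.prob (brw a p n)
    ({xs. length xs \<ge> 1} \<inter> {xs. real_of_int (rightmost xs) / sqrt (real n) \<in> A}) / surv p n"
proof -
  let ?S = "{xs :: int list. length xs \<ge> 1}"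
  have ne: "set_pmf (brw a p n) \<inter> ?S \<noteq> {}" by (rule brw_survival_possible[OF mean_one])
  have "measure (law n) A = measure_pmf.prob (brw_surviving a p n) {xs. real_of_int (rightmost xs) / sqrt (real n) \<in> A}"
    unfolding cond_scaled_max_law_def using assms by (subst measure_distr) (auto simp: vimage_def)
  also have "\<dots> = measure_pmf.prob (brw a p n) (?S \<inter> {xs. real_of_int (rightmost xs) / sqrt (real n) \<in> A})
      / measure_pmf.prob (brw a p n) ?S"
    unfolding brw_surviving_def cond_pmf.rep_eq[OF ne]
    by (subst measure_uniform_measure)
       (use ne in \<open>auto simp: emeasure_measure_pmf_not_zero measure_pmf.emeasure_eq_measure measure_measure_pmf_not_zero\<close>)
  finally show ?thesis by (simp only: prob_brw_survive)
qed

definition upper_tail :: "nat \<Rightarrow> real \<Rightarrow> real" where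
  "upper_tail n x = (brw_op a p 1 ^^ n) unit_step (- (x * sqrt (real n))) / surv p n"

lemma measure_law_atLeast:
  assumes n: "n \<ge> 1"
  shows "measure (law n) {x..} = upper_tail n x"
proof -
  have "{xs :: int list. length xs \<ge> 1} \<inter> {xs. real_of_int (rightmost xs) / sqrt (real n) \<in> {x..}}
    = {xs. \<exists>y\<in>set xs. x * sqrt (real n) \<le> real_of_int y}"
  proof (intro set_eqI iffI; clarsimp)
    fix xs :: "int list"
    assume "Suc 0 \<le> length xs" "x \<le> real_of_int (rightmost xs) / sqrt (real n)"
    moreover from this have "rightmost xs \<in> set xs"
      unfolding rightmost_def by (intro Max_in) auto
    ultimately show "\<exists>y\<in>set xs. x * sqrt (real n) \<le> real_of_int y"
      using n by (intro bexI[of _ "rightmost xs"]) (auto simp: field_simps)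
  next
    fix xs :: "int list" and y
    assume y: "y \<in> set xs" "x * sqrt (real n) \<le> real_of_int y"
    have "y \<le> rightmost xs" unfolding rightmost_def using y by (intro Max_ge) auto
    then have "x * sqrt (real n) \<le> real_of_int (rightmost xs)" using y by linarith
    then show "Suc 0 \<le> length xs \<and> x \<le> real_of_int (rightmost xs) / sqrt (real n)"
      using y n by (cases xs) (auto simp: field_simps)
  qed
  then show ?thesis
    using measure_law[of "{x..}" n] by (simp only: prob_brw_ge upper_tail_def) simp
qed

text \<open>Both half-lines are closed, and the gap between x and y makes them disjoint, so a
  possible atom is not counted twice.\<close>

lemma cdf_law_upper:
  assumes "n \<ge> 1" "x < y"
  shows "cdf (law n) x \<le> 1 - upper_tail n y"
proof -
  interpret L: real_distribution "law n" by (rule law_real_distribution)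
  have "cdf (law n) x \<le> measure (law n) (space (law n) - {y..})"
    unfolding cdf_def using assms by (intro L.finite_measure_mono) (auto simp: L.space_eq_univ)
  also have "\<dots> = 1 - upper_tail n y"
    using measure_law_atLeast[OF assms(1), of y] by (subst L.prob_compl) auto
  finally show ?thesis .
qed

lemma cdf_law_lower:
  assumes "n \<ge> 1"
  shows "1 - upper_tail n x \<le> cdf (law n) x"
proof -
  interpret L: real_distribution "law n" by (rule law_real_distribution)
  have "1 - upper_tail n x = measure (law n) (space (law n) - {x..})"
    using measure_law_atLeast[OF assms, of x] by (subst L.prob_compl) auto
  also have "\<dots> \<le> cdf (law n) x"
    unfolding cdf_def by (intro L.finite_measure_mono) (auto simp: L.space_eq_univ)
  finally show ?thesis .
qed

lemma surv_bounded_below: "\<exists>B>0. \<forall>n\<ge>1. 1 / surv p n \<le> B * real n"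
proof -
  have "(\<lambda>n. 1 / (real n * surv p n)) \<longlonglongrightarrow> 1 / (2 / v)"
    using v_pos by (intro tendsto_divide surv_asymp tendsto_const) auto
  then have "Bseq (\<lambda>n. 1 / (real n * surv p n))"
    by (intro convergent_imp_Bseq) (auto simp: convergent_def)
  then obtain B where B: "B > 0" "\<And>n. norm (1 / (real n * surv p n)) \<le> B"
    by (auto simp: Bseq_def)
  have "1 / surv p n \<le> B * real n" if n: "n \<ge> 1" for n
  proof -
    have "1 / (real n * surv p n) \<le> B" using abs_le_D1[OF B(2)[of n, unfolded real_norm_def]] .
    then show ?thesis using n surv_pos_le[of n] by (simp add: field_simps)
  qed
  then show ?thesis using B(1) by blast
qed

text \<open>Conditioning on survival costs a factor of order n, and at height b sqrt n the tail
  bounds linear in n are of order 1/(n b^4). The left tail uses that a rightmost particle below a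
  level is in particular some particle below it.\<close>

lemma law_tails:
  "\<exists>C>0. \<forall>n\<ge>1. \<forall>b>0. upper_tail n b \<le> C / b ^ 4 \<and> cdf (law n) (- b) \<le> C / b ^ 4"
proof -
  obtain B where B: "B > 0" "\<And>n. n \<ge> 1 \<Longrightarrow> 1 / surv p n \<le> B * real n"
    using surv_bounded_below by blast
  have scale: "P / surv p n \<le> squeeze_const * B / b ^ 4"
    if "P \<le> squeeze_const * real n / (b * sqrt (real n)) ^ 4" and n: "n \<ge> 1" and b: "b > 0" for P n b
  proof -
    have "(b * sqrt (real n)) ^ 4 = b ^ 4 * (real n)\<^sup>2"
      by (simp add: power_mult_distrib) (simp add: power2_eq_square power4_eq_xxxx)
    then have "P \<le> squeeze_const * real n / (b ^ 4 * (real n)\<^sup>2)" using that by simp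
    also have "\<dots> = squeeze_const / (b ^ 4 * real n)" using n by (simp add: power2_eq_square)
    finally have "P * (1 / surv p n) \<le> squeeze_const / (b ^ 4 * real n) * (1 / surv p n)"
      using surv_pos_le[of n] by (intro mult_right_mono) auto
    also have "\<dots> \<le> squeeze_const / (b ^ 4 * real n) * (B * real n)"
      using B(2)[OF n] squeeze_const_pos b by (intro mult_left_mono) auto
    also have "\<dots> = squeeze_const * B / b ^ 4" using n by simp
    finally show ?thesis by simp
  qed
  have "upper_tail n b \<le> squeeze_const * B / b ^ 4 \<and> cdf (law n) (- b) \<le> squeeze_const * B / b ^ 4"
    if n: "n \<ge> 1" and b: "b > 0" for n b
  proof
    define t where "t = b * sqrt (real n)"
    have t: "t > 0" using n b by (simp add: t_def)
    have mono: "K * real n / t ^ 4 \<le> squeeze_const * real n / t ^ 4" if "K \<le> squeeze_const" for K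
      using that t by (intro divide_right_mono mult_right_mono) auto
    have "(brw_op a p 1 ^^ n) unit_step (- t) \<le> squeeze_const * real n / t ^ 4"
      using brw_tail[OF t, of n] mono[of tail_const] left_const(1) by (simp add: squeeze_const_def)
    then show "upper_tail n b \<le> squeeze_const * B / b ^ 4"
      unfolding upper_tail_def t_def by (intro scale n b)
    let ?l = "\<lambda>y :: real. if y \<le> 0 then 1 else 0 :: real"
    have "cdf (law n) (- b) = measure_pmf.prob (brw a p n)
      ({xs. length xs \<ge> 1} \<inter> {xs. real_of_int (rightmost xs) / sqrt (real n) \<in> {..- b}}) / surv p n"
      unfolding cdf_def by (rule measure_law) simp
    also have "\<dots> \<le> measure_pmf.prob (brw a p n) {xs. \<exists>y\<in>set xs. real_of_int y \<le> - t} / surv p n"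
    proof (intro divide_right_mono measure_pmf.finite_measure_mono subsetI)
      fix xs :: "int list"
      assume xs: "xs \<in> {xs. length xs \<ge> 1} \<inter> {xs. real_of_int (rightmost xs) / sqrt (real n) \<in> {..- b}}"
      then have "rightmost xs \<in> set xs" unfolding rightmost_def by (intro Max_in) auto
      moreover have "real_of_int (rightmost xs) \<le> - t" using xs n by (simp add: t_def field_simps)
      ultimately show "xs \<in> {xs. \<exists>y\<in>set xs. real_of_int y \<le> - t}" by blast
    qed (use surv_pos_le[of n] in auto)
    also have "measure_pmf.prob (brw a p n) {xs. \<exists>y\<in>set xs. real_of_int y \<le> - t} = (brw_op a p 1 ^^ n) ?l t"
    proof -
      have "(\<lambda>y. if y \<le> - t then 1 else 0) = (\<lambda>y. ?l (y + t))" by (auto simp: fun_eq_iff)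
      then show ?thesis
        unfolding prob_brw_exists[of a n "\<lambda>y. y \<le> - t"] by (simp only: brw_op_iter_shift[where g="?l"]) simp
    qed
    also have "(brw_op a p 1 ^^ n) ?l t / surv p n \<le> squeeze_const * B / b ^ 4"
    proof (rule scale[OF _ n b])
      show "(brw_op a p 1 ^^ n) ?l t \<le> squeeze_const * real n / (b * sqrt (real n)) ^ 4"
        using left_const(2)[OF t, of n] mono[of left_const] tail_const_pos
        unfolding t_def[symmetric] by (simp add: squeeze_const_def)
    qed
    finally show "cdf (law n) (- b) \<le> squeeze_const * B / b ^ 4" .
  qed
  then show ?thesis using squeeze_const_pos B(1) by (intro exI[of _ "squeeze_const * B"]) auto
qed

text \<open>Tightness quantifies over all n. At n = 0 division by \<open>sqrt 0\<close> yields 0, so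
  this law is the point mass at 0 and has to be treated separately.\<close>

lemma law_0: "x \<ge> 0 \<Longrightarrow> cdf (law 0) x = 1" "x < 0 \<Longrightarrow> cdf (law 0) x = 0"
proof -
  have "cdf (law 0) x = measure_pmf.prob (brw_surviving a p 0) {xs. 0 \<le> x}" for x
    unfolding cdf_def cond_scaled_max_law_def by (subst measure_distr) (auto simp: vimage_def)
  then show "x \<ge> 0 \<Longrightarrow> cdf (law 0) x = 1" "x < 0 \<Longrightarrow> cdf (law 0) x = 0"
    by auto
qed

lemma law_tight: "tight law"
  unfolding tight_def
proof (intro conjI allI impI)
  fix n show "real_distribution (law n)" by (rule law_real_distribution)
next
  fix \<epsilon> :: real assume \<epsilon>: "\<epsilon> > 0"
  obtain C where C: "C > 0" "\<And>n b. n \<ge> 1 \<Longrightarrow> b > 0 \<Longrightarrow> upper_tail n b \<le> C / b ^ 4 \<and> cdf (law n) (- b) \<le> C / b ^ 4"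
    using law_tails by blast
  \<comment> \<open>As b > 1, its fourth power is at least b > 2C/\<epsilon>, so each of the two
    tails is below \<epsilon>/2.\<close>
  define b where "b = 1 + 2 * C / \<epsilon>"
  have b: "b > 1" using C \<epsilon> by (simp add: b_def)
  have "b ^ 1 \<le> b ^ 4" using b by (intro power_increasing) auto
  then have "2 * C / \<epsilon> < b ^ 4" by (simp add: b_def)
  then have Cb: "2 * (C / b ^ 4) < \<epsilon>" using \<epsilon> b by (simp add: field_simps)
  have "1 - \<epsilon> < measure (law n) {- b<..b}" for n
  proof -
    interpret L: real_distribution "law n" by (rule law_real_distribution)
    have "measure (law n) {- b<..b} = cdf (law n) b - cdf (law n) (- b)"
      using b by (intro L.cdf_diff_eq[symmetric]) auto
    moreover have "1 - \<epsilon> < cdf (law n) b - cdf (law n) (- b)"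
    proof (cases "n = 0")
      case True
      then show ?thesis using law_0 b \<epsilon> by simp
    next
      case False
      then have "n \<ge> 1" "b > 0" using b by auto
      from C(2)[OF this] cdf_law_lower[OF this(1), of b] Cb show ?thesis by linarith
    qed
    ultimately show ?thesis by simp
  qed
  then show "\<exists>a b. a < b \<and> (\<forall>n. 1 - \<epsilon> < measure (law n) {a<..b})"
    using b by (intro exI[of _ "- b"] exI[of _ b]) auto
qed

lemma upper_tail_bounded_below: "\<exists>q>0. \<exists>n0\<ge>1. \<forall>n\<ge>n0. q \<le> upper_tail n x"
proof -
  obtain q n0 where q: "q > 0" "n0 \<ge> 1" "\<And>n. n \<ge> n0 \<Longrightarrow> q / real n \<le> (brw_op a p 1 ^^ n) unit_step (- (x * sqrt (real n)))"
    using brw_lower by blast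
  have "q * p2 \<le> upper_tail n x" if n: "n \<ge> n0" for n
  proof -
    have n0: "real n > 0" using n q(2) by simp
    have "surv p n \<le> 1 / (1 + p2 * real n)" by (rule surv_upper)
    also have "\<dots> \<le> 1 / (p2 * real n)"
      using p2_pos n0 by (intro divide_left_mono) (auto intro!: mult_pos_pos add_pos_pos)
    finally have "q * p2 * surv p n \<le> q * p2 * (1 / (p2 * real n))"
      using q p2_pos by (intro mult_left_mono) auto
    also have "\<dots> = q / real n" using p2_pos by simp
    also have "\<dots> \<le> (brw_op a p 1 ^^ n) unit_step (- (x * sqrt (real n)))" by (rule q(3)[OF n])
    finally show ?thesis using surv_pos_le[of n] by (simp add: upper_tail_def pos_le_divide_eq)
  qed
  then show ?thesis using q p2_pos by (intro exI[of _ "q * p2"]) auto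
qed

text \<open>A fixed mass q stays to the right of c + 1, so the distribution functions at c + 1/2
  stay below 1 - q. For the point mass at c this is a continuity point with value 1.\<close>

lemma weak_limit_nontrivial:
  assumes M: "real_distribution M" and conv: "weak_conv_m law M"
  shows "M \<noteq> return borel c"
proof
  assume Mc: "M = return borel c"
  interpret M: real_distribution M by fact
  obtain q n0 where q: "q > 0" "n0 \<ge> 1" "\<And>n. n \<ge> n0 \<Longrightarrow> q \<le> upper_tail n (c + 1)"
    using upper_tail_bounded_below by blast
  have "measure M {c + 1 / 2} = 0" by (simp add: Mc measure_return)
  then have "isCont (cdf M) (c + 1 / 2)" using M.isCont_cdf by simp
  then have "(\<lambda>n. cdf (law n) (c + 1 / 2)) \<longlonglongrightarrow> cdf M (c + 1 / 2)"
    using conv by (simp add: weak_conv_m_def weak_conv_def)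
  moreover have "cdf M (c + 1 / 2) = 1" by (simp add: Mc cdf_def measure_return)
  ultimately have lim: "(\<lambda>n. cdf (law n) (c + 1 / 2)) \<longlonglongrightarrow> 1" by simp
  have "cdf (law n) (c + 1 / 2) \<le> 1 - q" if "n \<ge> n0" for n
    using cdf_law_upper[of n "c + 1 / 2" "c + 1"] q(3)[OF that] q(2) that by simp
  then have "1 \<le> 1 - q" by (intro LIMSEQ_le_const2[OF lim]) blast
  then show False using q by simp
qed

end

section \<open>From the comparison of two walks to one common limit\<close>

lemma cdf_law_comparison:
  assumes wa: "branching_walk p v a e" and wb: "branching_walk p' v a' e" and xy: "x < y" and \<kappa>: "\<kappa> > 0"
  shows "\<exists>n0. \<forall>n\<ge>n0. \<forall>m\<ge>n0. cdf (cond_scaled_max_law a p n) x \<le> cdf (cond_scaled_max_law a' p' m) y + \<kappa>"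
proof -
  interpret A: branching_walk p v a e by fact
  interpret B: branching_walk p' v a' e by fact
  \<comment> \<open>Half of the gap is the shift of \<open>rightmost_comparison\<close>, the other
    half the gap in \<open>cdf_law_upper\<close>. Passing to complements reverses the inequality, so
    the two walks enter in exchanged order.\<close>
  define \<theta> where "\<theta> = (y - x) / 2"
  have \<theta>: "\<theta> > 0" "x < y - \<theta>" using xy by (auto simp: \<theta>_def field_simps)
  obtain n0 where n0: "\<And>n m. n \<ge> n0 \<Longrightarrow> m \<ge> n0 \<Longrightarrow> B.upper_tail n y \<le> A.upper_tail m (y - \<theta>) + \<kappa>"
    using rightmost_comparison[OF wb wa \<theta>(1) \<kappa>, of y]
    unfolding A.upper_tail_def B.upper_tail_def by blast
  have "cdf (cond_scaled_max_law a p n) x \<le> cdf (cond_scaled_max_law a' p' m) y + \<kappa>"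
    if "n \<ge> n0 + 1" "m \<ge> n0 + 1" for n m
    using n0[of m n] A.cdf_law_upper[of n x "y - \<theta>"] B.cdf_law_lower[of m y] \<theta>(2) that by simp
  then show ?thesis by blast
qed

text \<open>Every late distribution function of the second walk at x lies between late values of the
  first walk at nearby points s < x < t, and these are known along the subsequence. With both walks
  equal this upgrades subsequential to full convergence.\<close>

lemma weak_conv_law:
  assumes wa: "branching_walk p v a e" and wb: "branching_walk p' v a' e"
    and M: "real_distribution M" and r: "strict_mono r"
    and sub: "weak_conv_m (\<lambda>j. cond_scaled_max_law a p (r j)) M"
  shows "weak_conv_m (cond_scaled_max_law a' p') M"
  unfolding weak_conv_m_def weak_conv_def
proof (intro allI impI)
  interpret M: real_distribution M by fact
  let ?F = "cdf M"
  fix x assume x: "isCont ?F x"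
  have ctb: "countable {z. \<not> isCont ?F z}"
    by (intro mono_ctble_discont monoI M.cdf_nondecreasing)
  \<comment> \<open>Convergence along the subsequence is known only at continuity points of the
    limit; a monotone function has at most countably many discontinuities, so s and t can be taken
    among them arbitrarily close to x.\<close>
  have pick: "\<exists>z\<in>{s<..<t}. isCont ?F z" if "s < t" for s t :: real
  proof (rule ccontr)
    assume "\<not> ?thesis"
    then have "{s<..<t} \<subseteq> {z. \<not> isCont ?F z}" by auto
    then have "countable {s<..<t}" using ctb by (rule countable_subset)
    then show False using that uncountable_open_interval[of s t] by simp
  qed
  have rj: "r j \<ge> j" for j using r by (rule seq_suble)
  show "(\<lambda>n. cdf (cond_scaled_max_law a' p' n) x) \<longlonglongrightarrow> ?F x"
  proof (rule LIMSEQ_I)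
    fix \<epsilon> :: real assume \<epsilon>: "\<epsilon> > 0"
    have "\<epsilon> / 4 > 0" using \<epsilon> by simp
    then obtain d where d: "d > 0" "\<And>z. \<bar>z - x\<bar> < d \<Longrightarrow> \<bar>?F z - ?F x\<bar> < \<epsilon> / 4"
      using x unfolding continuous_at_eps_delta dist_real_def by blast
    obtain s where s: "s \<in> {x - d<..<x}" "isCont ?F s" using pick[of "x - d" x] d by auto
    obtain t where t: "t \<in> {x<..<x + d}" "isCont ?F t" using pick[of x "x + d"] d by auto
    have Fs: "\<bar>?F s - ?F x\<bar> < \<epsilon> / 4" "\<bar>?F t - ?F x\<bar> < \<epsilon> / 4" 
      using d(2)[of s] d(2)[of t] s(1) t(1) by auto
    have lim: "\<forall>\<^sub>F j in sequentially. \<bar>cdf (cond_scaled_max_law a p (r j)) z - ?F z\<bar> < \<epsilon> / 4" if "isCont ?F z" for z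
    proof -
      have "(\<lambda>j. cdf (cond_scaled_max_law a p (r j)) z) \<longlonglongrightarrow> ?F z"
        using sub that by (simp add: weak_conv_m_def weak_conv_def)
      from tendstoD[OF this, of "\<epsilon> / 4"] \<epsilon> show ?thesis by (simp add: dist_real_def)
    qed
    have e4: "\<epsilon> / 4 > 0" using \<epsilon> by simp
    obtain n1 where n1: "\<And>n m. n \<ge> n1 \<Longrightarrow> m \<ge> n1 \<Longrightarrow>
      cdf (cond_scaled_max_law a' p' n) x \<le> cdf (cond_scaled_max_law a p m) t + \<epsilon> / 4"
      using cdf_law_comparison[OF wb wa _ e4, of x t] t by auto
    obtain n2 where n2: "\<And>n m. n \<ge> n2 \<Longrightarrow> m \<ge> n2 \<Longrightarrow>
      cdf (cond_scaled_max_law a p n) s \<le> cdf (cond_scaled_max_law a' p' m) x + \<epsilon> / 4"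
      using cdf_law_comparison[OF wa wb _ e4, of s x] s by auto
    have "\<forall>\<^sub>F j in sequentially. j \<ge> n1 + n2 \<and> \<bar>cdf (cond_scaled_max_law a p (r j)) s - ?F s\<bar> < \<epsilon> / 4
        \<and> \<bar>cdf (cond_scaled_max_law a p (r j)) t - ?F t\<bar> < \<epsilon> / 4"
      using eventually_ge_at_top[of "n1 + n2"] lim[OF s(2)] lim[OF t(2)] by eventually_elim auto
    then obtain j where j: "j \<ge> n1 + n2" "\<bar>cdf (cond_scaled_max_law a p (r j)) s - ?F s\<bar> < \<epsilon> / 4"
        "\<bar>cdf (cond_scaled_max_law a p (r j)) t - ?F t\<bar> < \<epsilon> / 4"
      using eventually_happens by fastforce
    have rj: "r j \<ge> n1 + n2" using rj[of j] j(1) by linarith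
    have "norm (cdf (cond_scaled_max_law a' p' n) x - ?F x) < \<epsilon>" if n: "n \<ge> n1 + n2" for n
    proof -
      have "cdf (cond_scaled_max_law a' p' n) x \<le> cdf (cond_scaled_max_law a p (r j)) t + \<epsilon> / 4"
        using n rj by (intro n1) auto
      moreover have "cdf (cond_scaled_max_law a p (r j)) s \<le> cdf (cond_scaled_max_law a' p' n) x + \<epsilon> / 4"
        using n rj by (intro n2) auto
      ultimately show ?thesis using j(2,3) Fs unfolding real_norm_def abs_less_iff by linarith
    qed
    then show "\<exists>no. \<forall>n\<ge>no. norm (cdf (cond_scaled_max_law a' p' n) x - ?F x) < \<epsilon>" by blast
  qed
qed

text \<open>The limit is a subsequential limit of one arbitrary walk with the given parameters, and
  \<open>weak_conv_law\<close> transfers it to all walks, that one included. If there is no such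
  walk, nothing is claimed.\<close>

lemma universal_limit:
  "\<exists>M. \<forall>a p. branching_walk p v a e \<longrightarrow>
    real_distribution M \<and> (\<forall>c. M \<noteq> return borel c) \<and> weak_conv_m (cond_scaled_max_law a p) M"
proof (cases "\<exists>a p. branching_walk p v a e")
  case True
  then obtain a p where w: "branching_walk p v a e" by blast
  interpret A: branching_walk p v a e by fact
  obtain r M where r: "strict_mono r" and M: "real_distribution M"
    and sub: "weak_conv_m (cond_scaled_max_law a p \<circ> id \<circ> r) M"
    using tight_imp_convergent_subsubsequence[OF A.law_tight, of id] by (auto simp: strict_mono_def)
  have sub': "weak_conv_m (\<lambda>j. cond_scaled_max_law a p (r j)) M" using sub by (simp add: o_def)
  have conv: "weak_conv_m (cond_scaled_max_law a' p') M" if "branching_walk p' v a' e" for a' p'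
    by (rule weak_conv_law[OF w that M r sub'])
  then show ?thesis using M A.weak_limit_nontrivial[OF M conv[OF w]] by blast
qed blast

text \<open>Displacements are integers, so off zero they have modulus at least 1 and the r-th
  absolute power dominates the fourth.\<close>

lemma branching_walk_of_hyps:
  assumes a: "step_hyp a" "measure_pmf.variance a real_of_int = e"
    and p: "offspring_hyp p" "measure_pmf.variance p real = v"
  shows "branching_walk p v a e"
proof -
  obtain r :: real where r: "r > 4" "integrable (measure_pmf a) (\<lambda>k. \<bar>real_of_int k\<bar> powr r)"
    using a(1) unfolding step_hyp_def by blast
  have "integrable (measure_pmf a) (\<lambda>k. real_of_int k ^ 4)"
  proof (rule Bochner_Integration.integrable_bound[OF r(2)])
    have "real_of_int k ^ 4 \<le> \<bar>real_of_int k\<bar> powr r" for k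
    proof (cases "k = 0")
      case False
      then have k: "\<bar>real_of_int k\<bar> \<ge> 1" by linarith
      have "real_of_int k ^ 4 = \<bar>real_of_int k\<bar> ^ 4" by simp
      also have "\<dots> = \<bar>real_of_int k\<bar> powr 4" using k powr_realpow[of "\<bar>real_of_int k\<bar>" 4] by simp
      also have "\<dots> \<le> \<bar>real_of_int k\<bar> powr r" using k r by (intro powr_mono) auto
      finally show ?thesis .
    qed auto
    then show "AE k in measure_pmf a. norm (real_of_int k ^ 4) \<le> norm (\<bar>real_of_int k\<bar> powr r)"
      by simp
  qed simp
  with assms show ?thesis
    unfolding step_hyp_def offspring_hyp_def
    by unfold_locales auto
qed

theorem theorem3:
  shows "\<exists>G :: real \<Rightarrow> real \<Rightarrow> real measure.
    \<forall>(a :: int pmf) (p :: nat pmf) \<sigma>2 \<eta>2.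
      step_hyp a \<and> measure_pmf.variance a real_of_int = \<eta>2 \<and>
      offspring_hyp p \<and> measure_pmf.variance p real = \<sigma>2 \<longrightarrow>
        real_distribution (G \<sigma>2 \<eta>2) \<and>
        (\<forall>c. G \<sigma>2 \<eta>2 \<noteq> return borel c) \<and>
        weak_conv_m (cond_scaled_max_law a p) (G \<sigma>2 \<eta>2)"
proof -
  have "\<forall>\<sigma>2 \<eta>2. \<exists>M. \<forall>a p. branching_walk p \<sigma>2 a \<eta>2 \<longrightarrow>
    real_distribution M \<and> (\<forall>c. M \<noteq> return borel c) \<and> weak_conv_m (cond_scaled_max_law a p) M"
    using universal_limit by blast
  then obtain G where G: "\<And>\<sigma>2 \<eta>2 a p. branching_walk p \<sigma>2 a \<eta>2 \<Longrightarrow>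
    real_distribution (G \<sigma>2 \<eta>2) \<and> (\<forall>c. G \<sigma>2 \<eta>2 \<noteq> return borel c) \<and>
    weak_conv_m (cond_scaled_max_law a p) (G \<sigma>2 \<eta>2)"
    by metis
  show ?thesis
    by (intro exI[of _ G] allI impI) (elim conjE, rule G, rule branching_walk_of_hyps)
qed

end
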